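(* Let $\{x^k\}_{k\in\mathbb N}$ be generated by the inexact MBA algorithm described in the context, and suppose that: (1) for all $k,j\in\mathbb{N}$ arising in the algorithm, the multifunction $x\mapsto G(x,x^k,L^{k,j})-\mathbb{R}_-^m$ is metrically subregular at $(\overline{x}^{k,j},0)$; (2) $\{x^k\}_{k\in\mathbb N}$ is bounded; (3) the system $H(u,x)\in\mathbb{R}_-^m$ satisfies the partial bounded multiplier property (BMP) with respect to $x$ at every $(u^*,\overline{x}^* )\in\Omega^*$; (4) $g$ is twice differentiable and $\psi^*$ is continuous relative to its domain; (5) $\Phi$ has the KL property of exponent $q\in[1/2,1)$ at every point of $Z^*$, the set of cluster points of $\{z^k\}_{k\in\mathbb N}$. Let $\varpi^*:=\lim_{k\to\infty}F(x^k)$ and let $x^*$ be the limit of $\{x^k\}_{k\in\mathbb N}$ (both limits exist under these hypotheses). Then: (i) when $q=1/2$, there exist $\widehat a_1>0$ and $\rho,\widehat\rho\in(0,1)$ such that for all $k$ large enough, $F(x^{k+1})-\varpi^*\le\rho(F(x^k)-\varpi^* )$ and $\|x^k-x^*\|\le\widehat a_1\widehat\rho^{\,k}$; (ii) when $q\in(1/2,1)$, there exist $\widehat a_2>0$ and $\widehat a_3>0$ such that for all sufficiently large $k$, $F(x^k)-\varpi^*\le\widehat a_2k^{\frac{1}{1-2q}}$ and $\|x^k-x^*\|\le\widehat a_3k^{\frac{1-q}{1-2q}}$.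
   Context: Problem and standing assumptions. Consider $\min_{x\in\mathbb{R}^n}F(x):=f(x)+\phi(x)-\psi(x)+\delta_{\mathbb{R}_-^m}(g(x))$, where $\delta_C$ is the indicator function of $C$ and: (i) $g:\mathbb{R}^n\to\mathbb{R}^m$ is $\mathcal{C}^{1,1}$ (differentiable with locally Lipschitz derivative) and $\Gamma:=g^{-1}(\mathbb{R}_-^m)\neq\emptyset$; (ii) $f:\mathbb{R}^n\to(-\infty,\infty]$ is proper lsc and $\mathcal{C}^{1,1}$ on an open convex set $\mathcal{O}\supset\Gamma$; (iii) $\phi,\psi:\mathbb{R}^n\to\mathbb{R}$ are convex; (iv) $\inf_{\Gamma}F>-\infty$. $\partial$ denotes the limiting subdifferential, $\mathcal{N}_C$ the limiting normal cone, $\nabla g(x):=g'(x)^\top$, $t_+=\max\{0,t\}$ (componentwise for vectors), $\psi^*$ the conjugate of $\psi$. A multifunction $\mathcal{F}$ is metrically subregular at $(\overline x,\overline y)\in{\rm gph}\,\mathcal F$ if there are $\kappa,\delta>0$ with ${\rm dist}(x,\mathcal{F}^{-1}(\overline y))\le\kappa\,{\rm dist}(\overline y,\mathcal{F}(x))$ for all $x$ with $\|x-\overline x\|\le\delta$. Algorithm (inexact MBA). Let $G(x,s,L):=g(s)+g'(s)(x-s)+\frac12\|x-s\|^2L$ for $x,s\in\mathbb{R}^n$, $L\in\mathbb{R}^m_{++}$. Input: $0<\mu_{\min}\le\mu_{\max}$, $0<L_{\min}\le L_{\max}$, $M,\beta_R,\beta_F,\alpha>0$, $\tau>1$, $x^0\in\Gamma$.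 For $k=0,1,2,\ldots$: choose $\xi^k\in\partial(-\psi)(x^k)$, $\mu_{k,0}\in[\mu_{\min},\mu_{\max}]$, $L^{k,0}\in\mathbb{R}^m$ with entries in $[L_{\min},L_{\max}]$. Inner loop, $j=0,1,2,\ldots$: choose a self-adjoint linear $\mathcal{Q}_{k,j}:\mathbb{R}^n\to\mathbb{R}^n$ with $\mu_{k,j}\mathcal{I}\preceq\mathcal{Q}_{k,j}\preceq(\mu_{k,j}+M)\mathcal{I}$; put $\vartheta_{k,j}(x):=f(x^k)-\psi(x^k)+\langle\nabla f(x^k)+\xi^k,x-x^k\rangle+\frac12\langle x-x^k,\mathcal{Q}_{k,j}(x-x^k)\rangle$, $F_{k,j}:=\vartheta_{k,j}+\phi$, $\Gamma_{k,j}:=\{x: G(x,x^k,L^{k,j})\le0\}$, and let $\overline{x}^{k,j}$ be the unique minimizer of $F_{k,j}$ on $\Gamma_{k,j}$. Find $y^{k,j}\in\mathbb{R}^n$, $v^{k,j}\in\partial\phi(y^{k,j})$, $\lambda^{k,j}\in\mathbb{R}^m_+$ with $R_{k,j}(y^{k,j},v^{k,j},\lambda^{k,j})\le\frac{\beta_R}{2}\|y^{k,j}-x^k\|^2$, $F_{k,j}(y^{k,j})\le F_{k,j}(x^k)$ and $F_{k,j}(y^{k,j})-F_{k,j}(\overline{x}^{k,j})\le\frac{\beta_F}{2}\|y^{k,j}-x^k\|^2$, where, with $r:=\nabla\vartheta_{k,j}(x)+v+\nabla_xG(x,x^k,L^{k,j})\lambda$, $R_{k,j}(x,v,\lambda):=(\langle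 x,r\rangle)_++(-\langle\lambda,G(x,x^k,L^{k,j})\rangle)_++\|r\|+\|[G(x,x^k,L^{k,j})]_+\|_\infty$. If $g(y^{k,j})\le0$ and $F(y^{k,j})\le F(x^k)-\frac\alpha2\|y^{k,j}-x^k\|^2$, set $j_k:=j$ and leave the inner loop; else if $g(y^{k,j})\not\le0$, set $L^{k,j+1}=\tau L^{k,j}$, $\mu_{k,j+1}=\mu_{k,j}$; else set $L^{k,j+1}=L^{k,j}$, $\mu_{k,j+1}=\tau\mu_{k,j}$. After the inner loop set $(\mu_k,L^k,\mathcal{Q}_k,\overline{x}^k):=(\mu_{k,j_k},L^{k,j_k},\mathcal{Q}_{k,j_k},\overline{x}^{k,j_k})$ and $(x^{k+1},v^{k+1},\lambda^{k+1}):=(y^{k,j_k},v^{k,j_k},\lambda^{k,j_k})$. Partial BMP. Let $\mathbb{U}:=\mathbb{R}^m_+\times\mathbb{S}\times\mathbb{R}^n\times\mathbb{R}^n$ with $\mathbb{S}$ the set of positive definite linear mappings on $\mathbb{R}^n$; for $u=(L,\mathcal{Q},\xi,s)\in\mathbb{U}$ let $H(u,x):=G(x,s,L)$ and $\mathcal{S}(u):=\{x: H(u,x)\in\mathbb{R}^m_-\}$. The system $H(u,x)\in\mathbb{R}^m_-$ satisfies the partial BMP with respect to $x$ at $(u^*,x^* )$ with $x^*\in\mathcal{S}(u^* )$ if there are $\kappa>0$ and neighborhoods $\mathcal{U}$ of $u^*$, $\mathcal{V}$ of $x^*$ such that for all $u\in\mathcal{U}$, $x\in\mathcal{V}\cap\mathcal{S}(u)$,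 $y\in\mathcal{N}_{\mathcal{S}(u)}(x)$ there is $\lambda\in\mathcal{N}_{\mathbb{R}^m_-}(H(u,x))$ with $\nabla_xH(u,x)\lambda=y$ and $\|\lambda\|\le\kappa\|y\|$. Let $u^k:=(L^k,\mathcal{Q}_k,\xi^k,x^k)$ and $\Omega^*$ the set of cluster points of $\{(u^k,\overline{x}^k)\}_{k\in\mathbb{N}}$. The function $\Phi$. For $z=(x,s,L,\xi)\in\mathbb{Z}:=\mathbb{R}^n\times\mathbb{R}^n\times\mathbb{R}^m_{++}\times\mathbb{R}^n$, $\Phi(z):=f(x)+\phi(x)+\delta_{G^{-1}(\mathbb{R}^m_-)}(x,s,L)+\langle x,\xi\rangle+\psi^*(-\xi)$. Put $z^k:=(\overline{x}^k,x^k,L^k,\xi^k)$. KL property of exponent $q\in[0,1)$. A proper function $h$ has the KL property of exponent $q$ at $\overline x\in{\rm dom}\,\partial h$ if there are $\delta>0$, $\eta\in(0,\infty]$, $c>0$ such that, with $\varphi(t)=ct^{1-q}$, $\varphi'(h(x)-h(\overline x))\,{\rm dist}(0,\partial h(x))\ge1$ for all $x$ with $\|x-\overline x\|\le\delta$ and $h(\overline x)<h(x)<h(\overline x)+\eta$. *)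

theory Defs
  imports "HOL-Analysis.Analysis"
begin

section \<open>Variational analysis\<close>

definition proper_fun :: "('a \<Rightarrow> ereal) \<Rightarrow> bool" where
  "proper_fun h \<longleftrightarrow> (\<forall>x. h x \<noteq> -\<infinity>) \<and> (\<exists>x. h x \<noteq> \<infinity>)"

definition lsc_fun :: "('a::topological_space \<Rightarrow> ereal) \<Rightarrow> bool" where
  "lsc_fun h \<longleftrightarrow> (\<forall>x. h x \<le> Liminf (at x) h)"

definition indicator_fun :: "'a set \<Rightarrow> 'a \<Rightarrow> ereal" where
  "indicator_fun C x = (if x \<in> C then 0 else \<infinity>)"

text \<open>Unlike \<^const>\<open>infdist\<close>, the distance to the empty set is \<open>\<infinity>\<close> here.\<close>

definition edist_set :: "'a::metric_space \<Rightarrow> 'a set \<Rightarrow> ereal" where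
  "edist_set x A = (INF a\<in>A. ereal (dist x a))"

definition cluster_points :: "(nat \<Rightarrow> 'a::topological_space) \<Rightarrow> 'a set" where
  "cluster_points s = {p. \<exists>r. strict_mono r \<and> (s \<circ> r) \<longlonglongrightarrow> p}"

definition regular_subdiff :: "('a::real_inner \<Rightarrow> ereal) \<Rightarrow> 'a \<Rightarrow> 'a set" where
  "regular_subdiff h x =
     {v. \<bar>h x\<bar> \<noteq> \<infinity> \<and>
         0 \<le> Liminf (at x) (\<lambda>y. (h y - h x - ereal (v \<bullet> (y - x))) / ereal (norm (y - x)))}"

definition limiting_subdiff :: "('a::real_inner \<Rightarrow> ereal) \<Rightarrow> 'a \<Rightarrow> 'a set" where
  "limiting_subdiff h x =
     {v. \<bar>h x\<bar> \<noteq> \<infinity> \<and>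
         (\<exists>X V. X \<longlonglongrightarrow> x \<and> (\<lambda>i. h (X i)) \<longlonglongrightarrow> h x \<and>
                (\<forall>i. V i \<in> regular_subdiff h (X i)) \<and> V \<longlonglongrightarrow> v)}"

definition limiting_normal_cone :: "'a::real_inner set \<Rightarrow> 'a \<Rightarrow> 'a set" where
  "limiting_normal_cone C x = limiting_subdiff (indicator_fun C) x"

definition conjugate_fun :: "('a::real_inner \<Rightarrow> real) \<Rightarrow> 'a \<Rightarrow> ereal" where
  "conjugate_fun h y = (SUP x. ereal (y \<bullet> x - h x))"

definition gradient :: "('a::real_inner \<Rightarrow> real) \<Rightarrow> 'a \<Rightarrow> 'a" where
  "gradient h x = (THE D. GDERIV h x :> D)"

text \<open>The transposed Jacobian \<open>h'(x)\<^sup>T\<close>, as a linear map.\<close>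

definition nabla :: "('a::euclidean_space \<Rightarrow> 'b::euclidean_space) \<Rightarrow> 'a \<Rightarrow> 'b \<Rightarrow> 'a" where
  "nabla h x = adjoint (frechet_derivative h (at x))"

definition C11_on :: "'a::euclidean_space set \<Rightarrow> ('a \<Rightarrow> 'b::euclidean_space) \<Rightarrow> bool" where
  "C11_on S h \<longleftrightarrow>
     (\<exists>h' :: 'a \<Rightarrow> 'a \<Rightarrow>\<^sub>L 'b.
        (\<forall>x\<in>S. (h has_derivative blinfun_apply (h' x)) (at x)) \<and>
        (\<forall>x\<in>S. \<exists>\<epsilon>>0. \<exists>C. C-lipschitz_on (ball x \<epsilon> \<inter> S) h'))"

definition twice_differentiable :: "('a::euclidean_space \<Rightarrow> 'b::euclidean_space) \<Rightarrow> bool" where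
  "twice_differentiable h \<longleftrightarrow>
     (\<exists>h' :: 'a \<Rightarrow> 'a \<Rightarrow>\<^sub>L 'b.
        (\<forall>x. (h has_derivative blinfun_apply (h' x)) (at x)) \<and>
        (\<forall>x. h' differentiable (at x)))"

definition metrically_subregular ::
  "('a::metric_space \<Rightarrow> 'b::metric_space set) \<Rightarrow> 'a \<Rightarrow> 'b \<Rightarrow> bool" where
  "metrically_subregular \<F> xb yb \<longleftrightarrow>
     yb \<in> \<F> xb \<and>
     (\<exists>\<kappa>>0. \<exists>\<delta>>0. \<forall>x. dist x xb \<le> \<delta> \<longrightarrow>
        edist_set x {x'. yb \<in> \<F> x'} \<le> ereal \<kappa> * edist_set yb (\<F> x))"

definition KL_exponent :: "('a::real_inner \<Rightarrow> ereal) \<Rightarrow> real \<Rightarrow> 'a \<Rightarrow> bool" where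
  "KL_exponent h q xb \<longleftrightarrow>
     proper_fun h \<and> limiting_subdiff h xb \<noteq> {} \<and>
     (\<exists>\<delta>>0. \<exists>\<eta>::ereal. 0 < \<eta> \<and> (\<exists>c>0. \<forall>x.
        norm (x - xb) \<le> \<delta> \<and> h xb < h x \<and> h x < h xb + \<eta> \<longrightarrow>
        ereal (deriv (\<lambda>t. c * t powr (1 - q)) (real_of_ereal (h x - h xb)))
          * edist_set 0 (limiting_subdiff h x) \<ge> 1))"

definition self_adjoint :: "('a::real_inner \<Rightarrow>\<^sub>L 'a) \<Rightarrow> bool" where
  "self_adjoint A \<longleftrightarrow> (\<forall>x y. A x \<bullet> y = x \<bullet> A y)"

definition loewner_le :: "('a::real_inner \<Rightarrow>\<^sub>L 'a) \<Rightarrow> ('a \<Rightarrow>\<^sub>L 'a) \<Rightarrow> bool" where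
  "loewner_le A B \<longleftrightarrow> (\<forall>x. x \<bullet> A x \<le> x \<bullet> B x)"

definition posdef :: "('a::real_inner \<Rightarrow>\<^sub>L 'a) \<Rightarrow> bool" where
  "posdef A \<longleftrightarrow> self_adjoint A \<and> (\<forall>x. x \<noteq> 0 \<longrightarrow> 0 < x \<bullet> A x)"


section \<open>The constrained DC problem\<close>

text \<open>The order on \<^typ>\<open>real^'m\<close> is the componentwise one, so \<open>z \<le> 0\<close> means
  \<open>z \<in> \<real>\<^sup>m\<^sub>-\<close>; but \<open>0 < z\<close> does not mean that all components are positive.\<close>

definition feasible :: "(real^'n \<Rightarrow> real^'m) \<Rightarrow> (real^'n) set" where
  "feasible g = {x. g x \<le> 0}"

definition objective ::
  "(real^'n \<Rightarrow> ereal) \<Rightarrow> (real^'n \<Rightarrow> real) \<Rightarrow> (real^'n \<Rightarrow> real) \<Rightarrow> (real^'n \<Rightarrow> real^'m)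
     \<Rightarrow> real^'n \<Rightarrow> ereal" where
  "objective f \<phi> \<psi> g x =
     f x + ereal (\<phi> x) - ereal (\<psi> x) + indicator_fun {z. z \<le> 0} (g x)"

locale DC_problem =
  fixes f :: "real^'n \<Rightarrow> ereal"
    and \<phi> \<psi> :: "real^'n \<Rightarrow> real"
    and g :: "real^'n \<Rightarrow> real^'m"
    and \<O> :: "(real^'n) set"
  assumes g_C11: "C11_on UNIV g"
    and feasible_nonempty: "feasible g \<noteq> {}"
    and f_proper: "proper_fun f"
    and f_lsc: "lsc_fun f"
    and \<O>_open: "open \<O>"
    and \<O>_convex: "convex \<O>"
    and feasible_subset: "feasible g \<subseteq> \<O>"
    and f_finite: "\<forall>x\<in>\<O>. \<bar>f x\<bar> \<noteq> \<infinity>"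
    and f_C11: "C11_on \<O> (\<lambda>x. real_of_ereal (f x))"
    and \<phi>_convex: "convex_on UNIV \<phi>"
    and \<psi>_convex: "convex_on UNIV \<psi>"
    and bounded_below: "(INF x\<in>feasible g. objective f \<phi> \<psi> g x) > -\<infinity>"


section \<open>The inexact MBA method\<close>

definition Gfun ::
  "(real^'n \<Rightarrow> real^'m) \<Rightarrow> real^'n \<Rightarrow> real^'n \<Rightarrow> real^'m \<Rightarrow> real^'m" where
  "Gfun g x s L = g s + frechet_derivative g (at s) (x - s) + (1/2 * (norm (x - s))\<^sup>2) *\<^sub>R L"

text \<open>In the next definitions \<open>s\<close>, \<open>\<xi>\<close>, \<open>L\<close>, \<open>Q\<close> stand for \<open>x\<^sup>k\<close>, \<open>\<xi>\<^sup>k\<close>, \<open>L\<^sup>k\<^sup>,\<^sup>j\<close>, \<open>\<Q>\<^sub>k\<^sub>,\<^sub>j\<close>;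
  the point \<open>s\<close> is always feasible, hence \<open>f s\<close> is finite.\<close>

definition theta_model ::
  "(real^'n \<Rightarrow> ereal) \<Rightarrow> (real^'n \<Rightarrow> real) \<Rightarrow> real^'n \<Rightarrow> real^'n \<Rightarrow> ((real^'n) \<Rightarrow>\<^sub>L (real^'n))
     \<Rightarrow> real^'n \<Rightarrow> real" where
  "theta_model f \<psi> s \<xi> Q x =
     real_of_ereal (f s) - \<psi> s
     + (gradient (\<lambda>x'. real_of_ereal (f x')) s + \<xi>) \<bullet> (x - s)
     + 1/2 * ((x - s) \<bullet> Q (x - s))"

definition F_model ::
  "(real^'n \<Rightarrow> ereal) \<Rightarrow> (real^'n \<Rightarrow> real) \<Rightarrow> (real^'n \<Rightarrow> real) \<Rightarrow> real^'n \<Rightarrow> real^'n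
     \<Rightarrow> ((real^'n) \<Rightarrow>\<^sub>L (real^'n)) \<Rightarrow> real^'n \<Rightarrow> real" where
  "F_model f \<phi> \<psi> s \<xi> Q x = theta_model f \<psi> s \<xi> Q x + \<phi> x"

definition Gamma_model ::
  "(real^'n \<Rightarrow> real^'m) \<Rightarrow> real^'n \<Rightarrow> real^'m \<Rightarrow> (real^'n) set" where
  "Gamma_model g s L = {x. Gfun g x s L \<le> 0}"

definition pos_part :: "real^'m \<Rightarrow> real^'m" where
  "pos_part z = (\<chi> i. max 0 (z $ i))"

definition KKT_residual ::
  "(real^'n \<Rightarrow> ereal) \<Rightarrow> (real^'n \<Rightarrow> real) \<Rightarrow> (real^'n \<Rightarrow> real^'m)
     \<Rightarrow> real^'n \<Rightarrow> real^'n \<Rightarrow> real^'m \<Rightarrow> ((real^'n) \<Rightarrow>\<^sub>L (real^'n))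
     \<Rightarrow> real^'n \<Rightarrow> real^'n \<Rightarrow> real^'m \<Rightarrow> real" where
  "KKT_residual f \<psi> g s \<xi> L Q x v lam =
     (let r = gradient (theta_model f \<psi> s \<xi> Q) x + v + nabla (\<lambda>x'. Gfun g x' s L) x lam
      in max 0 (x \<bullet> r) + max 0 (- (lam \<bullet> Gfun g x s L)) + norm r
         + infnorm (pos_part (Gfun g x s L)))"

definition accepted ::
  "(real^'n \<Rightarrow> ereal) \<Rightarrow> (real^'n \<Rightarrow> real) \<Rightarrow> (real^'n \<Rightarrow> real) \<Rightarrow> (real^'n \<Rightarrow> real^'m)
     \<Rightarrow> real \<Rightarrow> real^'n \<Rightarrow> real^'n \<Rightarrow> bool" where
  "accepted f \<phi> \<psi> g \<alpha> s y \<longleftrightarrow>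
     g y \<le> 0 \<and>
     objective f \<phi> \<psi> g y \<le> objective f \<phi> \<psi> g s - ereal (\<alpha>/2 * (norm (y - s))\<^sup>2)"

text \<open>An infinite run of the method. The inner loop of iteration \<open>k\<close> stops at index \<open>jk k\<close>, so
  inner iterates with index \<open>j > jk k\<close> do not occur and are unconstrained.\<close>

locale inexact_MBA = DC_problem f \<phi> \<psi> g \<O>
  for f :: "real^'n \<Rightarrow> ereal"
    and \<phi> \<psi> :: "real^'n \<Rightarrow> real"
    and g :: "real^'n \<Rightarrow> real^'m"
    and \<O> :: "(real^'n) set" +
  fixes \<mu>min \<mu>max Lmin Lmax M \<beta>R \<beta>F \<alpha> \<tau> :: real
    and x \<xi> :: "nat \<Rightarrow> real^'n"
    and \<mu> :: "nat \<Rightarrow> nat \<Rightarrow> real"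
    and L :: "nat \<Rightarrow> nat \<Rightarrow> real^'m"
    and Q :: "nat \<Rightarrow> nat \<Rightarrow> ((real^'n) \<Rightarrow>\<^sub>L (real^'n))"
    and xbar y v :: "nat \<Rightarrow> nat \<Rightarrow> real^'n"
    and lam :: "nat \<Rightarrow> nat \<Rightarrow> real^'m"
    and jk :: "nat \<Rightarrow> nat"
  assumes mu_bounds: "0 < \<mu>min" "\<mu>min \<le> \<mu>max"
    and L_bounds: "0 < Lmin" "Lmin \<le> Lmax"
    and params_pos: "0 < M" "0 < \<beta>R" "0 < \<beta>F" "0 < \<alpha>"
    and tau: "1 < \<tau>"
    and x0: "x 0 \<in> feasible g"
    and xi: "\<And>k. \<xi> k \<in> limiting_subdiff (\<lambda>z. ereal (- \<psi> z)) (x k)"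
    and mu_init: "\<And>k. \<mu> k 0 \<in> {\<mu>min..\<mu>max}"
    and L_init: "\<And>k i. L k 0 $ i \<in> {Lmin..Lmax}"
    and Q_self_adjoint: "\<And>k j. j \<le> jk k \<Longrightarrow> self_adjoint (Q k j)"
    and Q_lower: "\<And>k j. j \<le> jk k \<Longrightarrow> loewner_le (\<mu> k j *\<^sub>R id_blinfun) (Q k j)"
    and Q_upper: "\<And>k j. j \<le> jk k \<Longrightarrow> loewner_le (Q k j) ((\<mu> k j + M) *\<^sub>R id_blinfun)"
    and xbar: "\<And>k j. j \<le> jk k \<Longrightarrow>
      is_arg_min (F_model f \<phi> \<psi> (x k) (\<xi> k) (Q k j))
                 (\<lambda>z. z \<in> Gamma_model g (x k) (L k j)) (xbar k j)"
    and v: "\<And>k j. j \<le> jk k \<Longrightarrow> v k j \<in> limiting_subdiff (\<lambda>z. ereal (\<phi> z)) (y k j)"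
    and lam: "\<And>k j. j \<le> jk k \<Longrightarrow> 0 \<le> lam k j"
    and residual: "\<And>k j. j \<le> jk k \<Longrightarrow>
      KKT_residual f \<psi> g (x k) (\<xi> k) (L k j) (Q k j) (y k j) (v k j) (lam k j)
        \<le> \<beta>R / 2 * (norm (y k j - x k))\<^sup>2"
    and model_decrease: "\<And>k j. j \<le> jk k \<Longrightarrow>
      F_model f \<phi> \<psi> (x k) (\<xi> k) (Q k j) (y k j) \<le> F_model f \<phi> \<psi> (x k) (\<xi> k) (Q k j) (x k)"
    and model_gap: "\<And>k j. j \<le> jk k \<Longrightarrow>
      F_model f \<phi> \<psi> (x k) (\<xi> k) (Q k j) (y k j) - F_model f \<phi> \<psi> (x k) (\<xi> k) (Q k j) (xbar k j)
        \<le> \<beta>F / 2 * (norm (y k j - x k))\<^sup>2"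
    and inner_continue: "\<And>k j. j < jk k \<Longrightarrow> \<not> accepted f \<phi> \<psi> g \<alpha> (x k) (y k j)"
    and update_infeasible: "\<And>k j. j < jk k \<Longrightarrow> \<not> g (y k j) \<le> 0 \<Longrightarrow>
      L k (Suc j) = \<tau> *\<^sub>R L k j \<and> \<mu> k (Suc j) = \<mu> k j"
    and update_feasible: "\<And>k j. j < jk k \<Longrightarrow> g (y k j) \<le> 0 \<Longrightarrow>
      L k (Suc j) = L k j \<and> \<mu> k (Suc j) = \<tau> * \<mu> k j"
    and inner_stop: "\<And>k. accepted f \<phi> \<psi> g \<alpha> (x k) (y k (jk k))"
    and outer_step: "\<And>k. x (Suc k) = y k (jk k)"


section \<open>Partial bounded multiplier property\<close>

type_synonym ('n, 'm) bmp_param =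
  "(real^'m) \<times> ((real^'n) \<Rightarrow>\<^sub>L (real^'n)) \<times> (real^'n) \<times> (real^'n)"

definition U_space :: "('n::finite, 'm::finite) bmp_param set" where
  "U_space = {(L, Q, \<xi>, s). 0 \<le> L \<and> posdef Q}"

definition Hfun ::
  "(real^'n \<Rightarrow> real^'m) \<Rightarrow> ('n::finite, 'm::finite) bmp_param \<Rightarrow> real^'n \<Rightarrow> real^'m" where
  "Hfun g u x = (case u of (L, Q, \<xi>, s) \<Rightarrow> Gfun g x s L)"

definition S_set ::
  "(real^'n \<Rightarrow> real^'m) \<Rightarrow> ('n::finite, 'm::finite) bmp_param \<Rightarrow> (real^'n) set" where
  "S_set g u = {x. Hfun g u x \<le> 0}"

text \<open>Neighbourhoods of \<open>us\<close> are taken relative to the parameter set \<open>U_space\<close>.\<close>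

definition partial_BMP ::
  "(real^'n \<Rightarrow> real^'m) \<Rightarrow> ('n::finite, 'm::finite) bmp_param \<Rightarrow> real^'n \<Rightarrow> bool" where
  "partial_BMP g us xs \<longleftrightarrow>
     us \<in> U_space \<and> xs \<in> S_set g us \<and>
     (\<exists>\<kappa>>0. \<exists>\<U> \<V>. open \<U> \<and> us \<in> \<U> \<and> open \<V> \<and> xs \<in> \<V> \<and>
        (\<forall>u \<in> \<U> \<inter> U_space. \<forall>x \<in> \<V> \<inter> S_set g u. \<forall>y \<in> limiting_normal_cone (S_set g u) x.
           \<exists>lam \<in> limiting_normal_cone {z. z \<le> 0} (Hfun g u x).
             nabla (Hfun g u) x lam = y \<and> norm lam \<le> \<kappa> * norm y))"


section \<open>The potential function\<close>

text \<open>The domain \<open>{(x, s, L, \<xi>). L \<in> \<real>\<^sup>m\<^sub>+\<^sub>+}\<close> is open; outside of it the function is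
  set to \<open>\<infinity>\<close>, which affects neither subdifferentials at points of the domain nor the KL
  inequality there.\<close>

definition Phi ::
  "(real^'n \<Rightarrow> ereal) \<Rightarrow> (real^'n \<Rightarrow> real) \<Rightarrow> (real^'n \<Rightarrow> real) \<Rightarrow> (real^'n \<Rightarrow> real^'m)
     \<Rightarrow> (real^'n) \<times> (real^'n) \<times> (real^'m) \<times> (real^'n) \<Rightarrow> ereal" where
  "Phi f \<phi> \<psi> g = (\<lambda>(x, s, L, \<xi>).
     if \<forall>i. 0 < L $ i then
       f x + ereal (\<phi> x) + indicator_fun {(x, s, L). Gfun g x s L \<le> 0} (x, s, L)
       + ereal (x \<bullet> \<xi>) + conjugate_fun \<psi> (- \<xi>)
     else \<infinity>)"

end

theory Submission
  imports Defs
begin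

text \<open>The bounded multiplier property at all cluster points gives, along the bounded sequence,
  multipliers of uniformly bounded norm for the convex subproblems. Strong convexity and the
  residual test then bound \<open>xbar\<^sub>k - x\<^sub>k\<close> by a multiple of the step \<open>d\<^sub>k = norm (x\<^sub>k\<^sub>+\<^sub>1 - x\<^sub>k)\<close>, so that
  the potential has a subgradient of norm \<open>O(d\<^sub>k)\<close> at \<open>z\<^sub>k\<close> and
  \<open>F(x\<^sub>k\<^sub>+\<^sub>1) - O(d\<^sub>k\<^sup>2) \<le> \<Phi>(z\<^sub>k) \<le> F(x\<^sub>k) + O(d\<^sub>k\<^sup>2)\<close>. The KL inequality turns this into
  \<open>(F(x\<^sub>k\<^sub>+\<^sub>1) - \<omega>)\<^sup>q = O(d\<^sub>k)\<close>; together with the sufficient decrease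
  \<open>d\<^sub>k\<^sup>2 = O(F(x\<^sub>k) - F(x\<^sub>k\<^sub>+\<^sub>1))\<close>, this is a scalar recursion that determines both rates.\<close>

section \<open>The scalar recursion\<close>

text \<open>The constraint set of the subproblem moves with \<open>x k\<close> and with
  \<open>L\<close>, so the optimality conditions at hand are not those of one fixed objective. The
  potential repairs this by taking base point, \<open>L\<close> and \<open>\<xi>\<close> as
  variables and by replacing \<open>- \<psi>\<close> with the Fenchel term
  \<open>x \<bullet> \<xi> + conjugate_fun \<psi> (- \<xi>)\<close>. The computed point passes only
  a residual test and may violate the model constraint, whereas the minimizer \<open>xbar\<close>
  obeys exact optimality conditions; hence the potential is evaluated there. Descent is known for
  the objective, not for the potential, so the two are compared up to squared steps. Such errors are
  harmless because \<open>2 * q \<ge> 1\<close> gives \<open>(d\<^sup>2) powr q \<le> d\<close> for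
  small steps \<open>d\<close>. The multiplier bound and the KL inequality hold near cluster points
  only, with constants that depend on the point; boundedness of the run makes them uniform.\<close>

lemma arith_geo_mean_square: "u * v \<le> ((u + v) / 2)\<^sup>2" for u v :: real
proof -
  have "0 \<le> ((u - v) / 2)\<^sup>2" by simp
  then show ?thesis by (simp add: power2_eq_square field_simps)
qed

lemma powr_add_le:
  fixes s t q :: real
  assumes "0 \<le> s" "0 \<le> t" "0 < q"
  shows "(s + t) powr q \<le> 2 powr q * (s powr q + t powr q)"
proof -
  have "(s + t) powr q \<le> (2 * max s t) powr q" using assms by (intro powr_mono2) auto
  also have "\<dots> = 2 powr q * max s t powr q" by (rule powr_mult)
  also have "max s t powr q \<le> s powr q + t powr q" by (simp add: max_def)
  finally show ?thesis by simp
qed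

text \<open>Tangent inequality at \<open>s\<close> for a concave power. By homogeneity only the
  ratio \<open>u = t / s\<close> matters, and for it the claim is a weighted arithmetic-geometric
  mean inequality.\<close>

lemma powr_tangent_concave:
  fixes s t q :: real
  assumes "0 < s" "0 \<le> t" "t \<le> s" "0 < q" "q < 1"
  shows "(1 - q) * s powr (- q) * (s - t) \<le> s powr (1 - q) - t powr (1 - q)"
proof -
  define u where "u = t / s"
  have u: "0 \<le> u" "u \<le> 1" "t = u * s" using assms by (auto simp: u_def)
  have "u powr (1 - q) \<le> 1 + (1 - q) * (u - 1)"
  proof (cases "u = 0")
    case True then show ?thesis using assms by simp
  next
    case False
    with u have "0 < u" by simp
    have "1 powr q * u powr (1 - q) \<le> q * 1 + (1 - q) * u"
      by (rule Youngs_inequality_0) (use assms \<open>0 < u\<close> in auto)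
    then show ?thesis by (simp add: algebra_simps)
  qed
  then have "u powr (1 - q) * s powr (1 - q) \<le> (1 + (1 - q) * (u - 1)) * s powr (1 - q)"
    by (rule mult_right_mono) simp
  moreover have "t powr (1 - q) = u powr (1 - q) * s powr (1 - q)"
    using u assms by (simp add: powr_mult)
  moreover have "s powr (1 - q) = s * s powr (- q)"
    using assms by (simp add: powr_diff powr_minus field_simps)
  ultimately show ?thesis using u by (simp add: algebra_simps)
qed

text \<open>Tangent inequality at \<open>s\<close> for a convex power. For the ratio
  \<open>u = t / s\<close> it follows from \<open>ln u \<le> u - 1\<close> together with
  \<open>1 + z \<le> exp z\<close>.\<close>

lemma powr_tangent_convex:
  fixes s t r :: real
  assumes "0 < s" "0 < t" "0 < r"
  shows "r * s powr (- (1 + r)) * (s - t) \<le> t powr (- r) - s powr (- r)"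
proof -
  define u where "u = t / s"
  have u: "0 < u" "t = u * s" using assms by (auto simp: u_def)
  have "r * ln u \<le> r * (u - 1)"
    using u assms by (intro mult_left_mono ln_le_minus_one) auto
  moreover have "1 + (- r * ln u) \<le> exp (- r * ln u)" by (rule exp_ge_add_one_self)
  ultimately have "1 - r * (u - 1) \<le> u powr (- r)" using u by (simp add: powr_def)
  then have "(1 - r * (u - 1)) * s powr (- r) \<le> u powr (- r) * s powr (- r)"
    by (rule mult_right_mono) simp
  moreover have "t powr (- r) = u powr (- r) * s powr (- r)"
    using u assms by (simp add: powr_mult)
  moreover have "s powr (- r) = s powr 1 * s powr (- (1 + r))"
    by (simp add: powr_add[symmetric] del: powr_one powr_one')
  then have "s powr (- r) = s * s powr (- (1 + r))" using assms by simp
  ultimately show ?thesis using u by (simp add: algebra_simps)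
qed

text \<open>The shift of the index in \<open>KL_step\<close> matters: the step \<open>d k\<close>
  controls the value reached after it, so the recursion is implicit in
  \<open>a (Suc k)\<close>.\<close>

locale KL_recursion =
  fixes a d :: "nat \<Rightarrow> real" and c C q :: real
  assumes a_nonneg: "\<And>k. 0 \<le> a k"
    and d_nonneg: "\<And>k. 0 \<le> d k"
    and c_pos: "0 < c" and C_pos: "0 < C"
    and q_ge: "1/2 \<le> q" and q_less: "q < 1"
    and descent: "\<And>k. c * (d k)\<^sup>2 \<le> a k - a (Suc k)"
    and a_tendsto: "a \<longlonglongrightarrow> 0"
    and KL_step: "\<forall>\<^sub>F k in sequentially. a (Suc k) powr q \<le> C * d k"
begin

lemma a_antimono: "a (Suc k) \<le> a k"
  using descent[of k] c_pos by (smt (verit) mult_nonneg_nonneg zero_le_power2)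

lemma a_decseq: "decseq a"
  by (rule decseq_SucI) (rule a_antimono)

text \<open>The tangent inequality turns the decrease of \<open>a\<close> into a decrease of
  \<open>a powr (1 - q)\<close>, and the KL bound cancels the singular slope
  \<open>a (Suc k) powr (- q)\<close>. This gives \<open>(d (Suc k))\<^sup>2 \<le> d k * W\<close>;
  splitting the product by the arithmetic-geometric mean halves the step up to a telescoping
  term.\<close>

lemma d_step:
  assumes "a (Suc k) powr q \<le> C * d k"
  shows "d (Suc k) \<le> d k / 2
    + C / (2 * c * (1 - q)) * (a (Suc k) powr (1 - q) - a (Suc (Suc k)) powr (1 - q))"
proof (cases "a (Suc k) = 0")
  \<comment> \<open>At value zero there is no tangent, but descent then forces the next step to
    vanish.\<close>
  case True
  then have "a (Suc (Suc k)) = 0" using a_antimono[of "Suc k"] a_nonneg[of "Suc (Suc k)"] by simp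
  then have "c * (d (Suc k))\<^sup>2 \<le> 0" using descent[of "Suc k"] True by simp
  then have "d (Suc k) = 0" using c_pos by (simp add: mult_le_0_iff)
  then show ?thesis using True \<open>a (Suc (Suc k)) = 0\<close> d_nonneg[of k] by simp
next
  case False
  then have a: "0 < a (Suc k)" using a_nonneg[of "Suc k"] by simp
  define E where "E = a (Suc k) powr (1 - q) - a (Suc (Suc k)) powr (1 - q)"
  define W where "W = C / (c * (1 - q)) * E"
  have aq: "0 < a (Suc k) powr q" using a by simp
  then have "0 < C * d k" using assms by linarith
  then have dk: "0 < d k" using C_pos by (simp add: zero_less_mult_iff)
  have "(1 - q) * a (Suc k) powr (- q) * (a (Suc k) - a (Suc (Suc k))) \<le> E"
    unfolding E_def using a a_nonneg a_antimono q_ge q_less by (intro powr_tangent_concave) auto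
  moreover have "(1 - q) * a (Suc k) powr (- q) * (c * (d (Suc k))\<^sup>2)
      \<le> (1 - q) * a (Suc k) powr (- q) * (a (Suc k) - a (Suc (Suc k)))"
    using descent[of "Suc k"] q_less by (intro mult_left_mono) auto
  ultimately have "(1 - q) * a (Suc k) powr (- q) * (c * (d (Suc k))\<^sup>2) \<le> E" by linarith
  then have "(1 - q) * a (Suc k) powr (- q) * (c * (d (Suc k))\<^sup>2) * a (Suc k) powr q
      \<le> E * a (Suc k) powr q"
    using aq by (intro mult_right_mono) auto
  moreover have "(1 - q) * a (Suc k) powr (- q) * (c * (d (Suc k))\<^sup>2) * a (Suc k) powr q
      = (1 - q) * c * (d (Suc k))\<^sup>2 * (a (Suc k) powr (- q) * a (Suc k) powr q)"
    by (simp only: mult_ac)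
  moreover have "a (Suc k) powr (- q) * a (Suc k) powr q = 1"
    using a by (simp only: powr_add[symmetric]) simp
  ultimately have "(1 - q) * c * (d (Suc k))\<^sup>2 \<le> E * a (Suc k) powr q"
    by simp
  moreover have E: "0 \<le> E"
    unfolding E_def using a_antimono[of "Suc k"] a_nonneg q_less by (simp add: powr_mono2)
  then have "E * a (Suc k) powr q \<le> E * (C * d k)" using assms by (intro mult_left_mono) auto
  ultimately have "(d (Suc k))\<^sup>2 * ((1 - q) * c) \<le> E * (C * d k)"
    by (simp only: mult_ac)
  moreover have "0 < (1 - q) * c" using c_pos q_less by simp
  ultimately have "(d (Suc k))\<^sup>2 \<le> E * (C * d k) / ((1 - q) * c)"
    by (simp only: pos_le_divide_eq)
  also have "\<dots> = d k * (C / (c * (1 - q)) * E)" by (simp only: divide_inverse inverse_mult_distrib mult_ac)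
  finally have *: "(d (Suc k))\<^sup>2 \<le> d k * W" by (simp only: W_def)
  have "0 \<le> W" using \<open>0 \<le> E\<close> C_pos c_pos q_less by (simp add: W_def)
  have "(d (Suc k))\<^sup>2 \<le> ((d k + W) / 2)\<^sup>2"
    using * arith_geo_mean_square[of "d k" W] by linarith
  then have "d (Suc k) \<le> (d k + W) / 2"
    by (rule power2_le_imp_le) (use dk \<open>0 \<le> W\<close> in simp)
  also have "\<dots> = d k / 2 + W / 2" by (rule add_divide_distrib)
  also have "W / 2 = C / (2 * c * (1 - q)) * E" by (simp add: W_def mult.assoc)
  finally show ?thesis unfolding E_def .
qed

text \<open>The factor one half in \<open>d_step\<close> lets the sum of steps absorb itself,
  leaving one initial step and a telescoping sum. By descent the initial step is of order
  \<open>a k powr (1/2)\<close>, which \<open>a k powr (1 - q)\<close> dominates once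
  \<open>a k < 1\<close>, because \<open>1 - q \<le> 1/2\<close>.\<close>

lemma tail_sum_bound:
  "\<exists>D>0. \<forall>\<^sub>F k in sequentially. \<forall>n. (\<Sum>j=Suc k..<Suc k + n. d j) \<le> D * a k powr (1 - q)"
proof -
  obtain N where N: "\<And>k. N \<le> k \<Longrightarrow> a (Suc k) powr q \<le> C * d k"
    using KL_step unfolding eventually_sequentially by blast
  have "\<forall>\<^sub>F k in sequentially. a k < 1" using a_tendsto by (rule order_tendstoD) simp
  then obtain N' where N': "\<And>k. N' \<le> k \<Longrightarrow> a k < 1" unfolding eventually_sequentially by blast
  define B where "B = C / (2 * c * (1 - q))"
  have B: "0 < B" using C_pos c_pos q_less by (simp add: B_def)
  have step: "d (Suc j) \<le> d j / 2 + B * (a (Suc j) powr (1 - q) - a (Suc (Suc j)) powr (1 - q))"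
    if "N \<le> j" for j
    using d_step[OF N[OF that]] by (simp add: B_def)
  \<comment> \<open>The surplus \<open>d (k + n)\<close> on the left is what the induction consumes:
    \<open>step\<close> bounds twice the next step by it, one copy joins the sum and the other is
    the new surplus.\<close>
  have tele: "(\<Sum>j=Suc k..<Suc k + n. d j) + d (k + n) \<le>
      2 * d k + 2 * B * (a (Suc k) powr (1 - q) - a (Suc (k + n)) powr (1 - q))"
    if "N \<le> k" for k n
  proof (induction n)
    case 0 then show ?case using d_nonneg[of k] by simp
  next
    case (Suc n)
    have "(\<Sum>j=Suc k..<Suc k + Suc n. d j) = (\<Sum>j=Suc k..<Suc k + n. d j) + d (Suc (k + n))"
      by simp
    moreover have "2 * d (Suc (k + n)) \<le> d (k + n)
        + 2 * B * (a (Suc (k + n)) powr (1 - q) - a (Suc (Suc (k + n))) powr (1 - q))"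
      using step[of "k + n"] that by (simp add: algebra_simps)
    ultimately show ?case using Suc by (simp add: algebra_simps)
  qed
  define D where "D = 2 / sqrt c + 2 * B"
  have bound: "(\<Sum>j=Suc k..<Suc k + n. d j) \<le> D * a k powr (1 - q)" if "N \<le> k" "N' \<le> k" for k n
  proof -
    have "c * (d k)\<^sup>2 \<le> a k" using descent[of k] a_nonneg[of "Suc k"] by linarith
    then have "(d k)\<^sup>2 \<le> a k / c" using c_pos by (simp add: field_simps)
    then have "d k \<le> sqrt (a k / c)" by (rule real_le_rsqrt)
    also have "\<dots> = a k powr (1/2) / sqrt c"
      using a_nonneg[of k] by (simp add: real_sqrt_divide powr_half_sqrt)
    also have "a k powr (1/2) \<le> a k powr (1 - q)"
      using N'[OF that(2)] a_nonneg[of k] q_ge by (intro powr_mono') auto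
    finally have "d k \<le> a k powr (1 - q) / sqrt c"
      using c_pos by (simp add: divide_right_mono)
    moreover have "B * a (Suc k) powr (1 - q) \<le> B * a k powr (1 - q)"
      using a_antimono a_nonneg q_less B by (intro mult_left_mono powr_mono2) auto
    moreover have "0 \<le> B * a (Suc (k + n)) powr (1 - q)" using B by simp
    ultimately show ?thesis using tele[OF that(1), of n] d_nonneg[of "k + n"]
      unfolding D_def by (simp add: algebra_simps)
  qed
  have "0 < D" using B c_pos by (simp add: D_def add_pos_pos)
  then show ?thesis using bound unfolding eventually_sequentially
    by (intro exI[of _ D] conjI exI[of _ "max N N'"]) auto
qed

text \<open>Squaring the KL bound and inserting descent eliminates the steps; a recursion in the
  values alone remains.\<close>

lemma a_step:
  "\<exists>B>0. \<forall>\<^sub>F k in sequentially. a (Suc k) powr (2 * q) \<le> B * (a k - a (Suc k))"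
proof -
  have "\<forall>\<^sub>F k in sequentially. a (Suc k) powr (2 * q) \<le> C\<^sup>2 / c * (a k - a (Suc k))"
    using KL_step
  proof eventually_elim
    case (elim k)
    have "a (Suc k) powr (2 * q) = (a (Suc k) powr q)\<^sup>2"
      by (simp only: power2_eq_square powr_add[symmetric] mult_2)
    also have "\<dots> \<le> (C * d k)\<^sup>2" using elim by (intro power_mono) auto
    also have "\<dots> = C\<^sup>2 / c * (c * (d k)\<^sup>2)" using c_pos by (simp add: power_mult_distrib)
    also have "\<dots> \<le> C\<^sup>2 / c * (a k - a (Suc k))"
      using descent[of k] c_pos by (intro mult_left_mono) auto
    finally show ?case .
  qed
  then show ?thesis using C_pos c_pos by (intro exI[of _ "C\<^sup>2 / c"]) auto
qed

lemma linear_rate: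
  assumes "q = 1/2"
  shows "\<exists>\<rho>\<in>{0<..<1}. \<forall>\<^sub>F k in sequentially. a (Suc k) \<le> \<rho> * a k"
proof -
  obtain B where B: "0 < B" "\<forall>\<^sub>F k in sequentially. a (Suc k) powr (2 * q) \<le> B * (a k - a (Suc k))"
    using a_step by blast
  \<comment> \<open>For \<open>q = 1/2\<close> the power is one, and solving
    \<open>a (Suc k) \<le> B * (a k - a (Suc k))\<close> for \<open>a (Suc k)\<close> gives this
    ratio.\<close>
  from B(2) have "\<forall>\<^sub>F k in sequentially. a (Suc k) \<le> (B / (1 + B)) * a k"
  proof eventually_elim
    case (elim k)
    then have "a (Suc k) \<le> B * (a k - a (Suc k))" using assms a_nonneg[of "Suc k"] by simp
    then show ?case using B(1) by (simp add: field_simps)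
  qed
  then show ?thesis using B(1) by (intro bexI[of _ "B / (1 + B)"]) auto
qed

lemma linear_rate_explicit:
  assumes "q = 1/2"
  shows "\<exists>A>0. \<exists>\<rho>\<in>{0<..<1}. \<forall>\<^sub>F k in sequentially. a k \<le> A * \<rho> ^ k"
proof -
  obtain \<rho> where \<rho>: "\<rho> \<in> {0<..<1}" "\<forall>\<^sub>F k in sequentially. a (Suc k) \<le> \<rho> * a k"
    using linear_rate[OF assms] by blast
  then obtain N where N: "\<And>k. N \<le> k \<Longrightarrow> a (Suc k) \<le> \<rho> * a k"
    unfolding eventually_sequentially by blast
  \<comment> \<open>The first summand makes the bound exact at \<open>N\<close>; the extra
    \<open>1\<close> keeps \<open>A\<close> positive if \<open>a N = 0\<close>.\<close>
  define A where "A = a N / \<rho> ^ N + 1"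
  have "0 < A" using a_nonneg[of N] \<rho>(1) by (simp add: A_def add_nonneg_pos)
  moreover have "a k \<le> A * \<rho> ^ k" if "N \<le> k" for k
    using that
  proof (induction k rule: dec_induct)
    case base
    then show ?case using \<rho>(1) by (simp add: A_def algebra_simps)
  next
    case (step k)
    have "a (Suc k) \<le> \<rho> * a k" by (rule N) (use step in simp)
    also have "\<dots> \<le> \<rho> * (A * \<rho> ^ k)" using step \<rho>(1) by (intro mult_left_mono) auto
    finally show ?case by (simp add: algebra_simps)
  qed
  ultimately show ?thesis using \<rho>(1) unfolding eventually_sequentially by blast
qed

text \<open>The reciprocal power \<open>a\<^sub>k powr (1 - 2q)\<close> grows at least linearly.\<close>

lemma sublinear_rate:
  assumes "1/2 < q"
  shows "\<exists>A>0. \<forall>\<^sub>F k in sequentially. a k \<le> A * real k powr (1 / (1 - 2 * q))"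
proof -
  define r where "r = 2 * q - 1"
  have r: "0 < r" "2 * q = 1 + r" "1 / (1 - 2 * q) = - (1 / r)"
    using assms by (auto simp: r_def divide_minus_right[symmetric] simp del: divide_minus_right)
  obtain B where B: "0 < B" "\<forall>\<^sub>F k in sequentially. a (Suc k) powr (2 * q) \<le> B * (a k - a (Suc k))"
    using a_step by blast
  then obtain N where N: "\<And>k. N \<le> k \<Longrightarrow> a (Suc k) powr (2 * q) \<le> B * (a k - a (Suc k))"
    unfolding eventually_sequentially by blast
  \<comment> \<open>One increment for each case of the dichotomy below: comparable successive
    values, or a value that more than halves. The \<open>1\<close> only keeps \<open>E\<close>
    positive when \<open>a N = 0\<close>, where the power would be zero.\<close>
  define E where "E = min (r * 2 powr (- (1 + r)) / B)
    (if a N = 0 then 1 else (2 powr r - 1) * a N powr (- r))"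
  have "1 < 2 powr r" using r(1) by (simp add: gr_one_powr)
  then have E: "0 < E" using r(1) B(1) a_nonneg[of N] unfolding E_def by simp
  have incr: "a k powr (- r) + E \<le> a (Suc k) powr (- r)" if k: "N \<le> k" "0 < a (Suc k)" for k
  proof -
    have ak: "0 < a k" using k(2) a_antimono[of k] by linarith
    have akN: "a k \<le> a N" using a_decseq k(1) by (simp add: decseq_def)
    show ?thesis
    proof (cases "a k \<le> 2 * a (Suc k)")
      \<comment> \<open>Comparable values: in the recursion, \<open>a (Suc k) powr (1 + r)\<close>
        can be replaced by a multiple of \<open>a k powr (1 + r)\<close>, which cancels the slope of
        the tangent at \<open>a k\<close>.\<close>
      case True
      have "r * 2 powr (- (1 + r)) / B * B = r * 2 powr (- (1 + r))" using B(1) by simp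
      have "(a k / 2) powr (1 + r) \<le> a (Suc k) powr (1 + r)"
        using True ak r(1) by (intro powr_mono2) auto
      also have "\<dots> \<le> B * (a k - a (Suc k))" using N[OF k(1)] r(2) by simp
      finally have "r * a k powr (- (1 + r)) / B * (a k / 2) powr (1 + r)
          \<le> r * a k powr (- (1 + r)) / B * (B * (a k - a (Suc k)))"
        using r(1) B(1) by (intro mult_left_mono) auto
      also have "\<dots> = r * a k powr (- (1 + r)) * (a k - a (Suc k))" using B(1) by simp
      also have "\<dots> \<le> a (Suc k) powr (- r) - a k powr (- r)"
        using ak k(2) r(1) by (rule powr_tangent_convex)
      also have "r * a k powr (- (1 + r)) / B * (a k / 2) powr (1 + r)
          = r * (a k powr (- (1 + r)) * (a k / 2) powr (1 + r)) / B"
        by (simp only: times_divide_eq_left mult.assoc)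
      also have "a k powr (- (1 + r)) * (a k / 2) powr (1 + r) = 2 powr (- (1 + r))"
        using ak by (simp only: powr_divide powr_minus less_imp_le zero_le_numeral) (simp add: inverse_eq_divide)
      finally show ?thesis unfolding E_def by (simp add: min_def)
    next
      \<comment> \<open>The value more than halves, so its reciprocal power grows by the factor
        \<open>2 powr r\<close> at least, without any appeal to the recursion.\<close>
      case False
      have "a N powr (- r) \<le> a k powr (- r)"
        using akN ak r(1) by (intro powr_mono2') auto
      then have "(2 powr r - 1) * a N powr (- r) \<le> (2 powr r - 1) * a k powr (- r)"
        using \<open>1 < 2 powr r\<close> by (intro mult_left_mono) auto
      moreover have "(a k / 2) powr (- r) \<le> a (Suc k) powr (- r)"
        using False k(2) r(1) by (intro powr_mono2') auto
      moreover have "(a k / 2) powr (- r) = 2 powr r * a k powr (- r)"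
        using ak by (simp only: powr_divide powr_minus less_imp_le zero_le_numeral) (simp add: divide_inverse)
      ultimately have "(2 powr r - 1) * a N powr (- r) + a k powr (- r) \<le> a (Suc k) powr (- r)"
        by (simp add: algebra_simps)
      moreover have "E \<le> (2 powr r - 1) * a N powr (- r)"
        using akN ak unfolding E_def by simp
      ultimately show ?thesis by linarith
    qed
  qed
  have lin: "E * real (k - N) \<le> a k powr (- r)" if "N \<le> k" "0 < a k" for k
    using that
  proof (induction k rule: dec_induct)
    case base then show ?case by simp
  next
    case (step k)
    then have "0 < a k" using a_antimono[of k] by linarith
    then have "E * real (k - N) + E \<le> a (Suc k) powr (- r)"
      using incr[of k] step by simp
    moreover have "E * real (Suc k - N) = E * real (k - N) + E"
      using step by (simp add: Suc_diff_le algebra_simps)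
    ultimately show ?case by simp
  qed
  \<comment> \<open>For \<open>k \<ge> 2 * N + 1\<close> the difference \<open>k - N\<close> is at
    least \<open>k / 2\<close>; hence the factor \<open>E / 2\<close>, which is then raised to the
    inverse power.\<close>
  define A where "A = (E / 2) powr (- (1 / r))"
  have "a k \<le> A * real k powr (- (1 / r))" if k: "2 * N + 1 \<le> k" for k
  proof (cases "a k = 0")
    case True then show ?thesis using E by (simp add: A_def)
  next
    case False
    then have ak: "0 < a k" using a_nonneg[of k] by simp
    have "E / 2 * real k \<le> E * real (k - N)" using k E by (simp add: of_nat_diff)
    also have "\<dots> \<le> a k powr (- r)" using lin[of k] k ak by simp
    finally have "(a k powr (- r)) powr (- (1 / r)) \<le> (E / 2 * real k) powr (- (1 / r))"
      using E k r(1) by (intro powr_mono2') auto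
    moreover have "- r * - (1 / r) = 1" using r(1) by simp
    then have "(a k powr (- r)) powr (- (1 / r)) = a k" using ak by (simp only: powr_powr powr_one)
    moreover have "(E / 2 * real k) powr (- (1 / r)) = A * real k powr (- (1 / r))"
      unfolding A_def by (rule powr_mult)
    ultimately show ?thesis by simp
  qed
  then have "\<forall>\<^sub>F k in sequentially. a k \<le> A * real k powr (1 / (1 - 2 * q))"
    unfolding eventually_sequentially r(3) by (intro exI[of _ "2 * N + 1"]) simp
  moreover have "0 < A" using E by (simp add: A_def)
  ultimately show ?thesis by (intro exI[of _ A]) simp
qed

end

text \<open>Finite length: bounded tail sums make the increments summable. Letting the end of a tail
  tend to infinity turns the same bound into one for the distance to the limit; since tails start at
  \<open>Suc k\<close>, the value \<open>a k\<close> controls the distance at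
  \<open>Suc k\<close>.\<close>

lemma KL_recursion_limit:
  fixes x :: "nat \<Rightarrow> 'a::banach"
  assumes "KL_recursion a (\<lambda>k. norm (x (Suc k) - x k)) c C q"
  shows "\<exists>l D. 0 < D \<and> x \<longlonglongrightarrow> l \<and>
    (\<forall>\<^sub>F k in sequentially. norm (x (Suc k) - l) \<le> D * a k powr (1 - q))"
proof -
  interpret KL_recursion a "\<lambda>k. norm (x (Suc k) - x k)" c C q by fact
  obtain D where D: "0 < D" "\<forall>\<^sub>F k in sequentially. \<forall>n.
      (\<Sum>j=Suc k..<Suc k + n. norm (x (Suc j) - x j)) \<le> D * a k powr (1 - q)"
    using tail_sum_bound by blast
  then obtain N where N: "\<And>k n. N \<le> k \<Longrightarrow>
      (\<Sum>j=Suc k..<Suc k + n. norm (x (Suc j) - x j)) \<le> D * a k powr (1 - q)"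
    unfolding eventually_sequentially by blast
  have dist: "norm (x (Suc k + n) - x (Suc k)) \<le> D * a k powr (1 - q)" if "N \<le> k" for k n
  proof -
    have "x (Suc k + n) - x (Suc k) = (\<Sum>j=Suc k..<Suc k + n. x (Suc j) - x j)"
      by (simp add: sum_Suc_diff')
    then show ?thesis using norm_sum[of "\<lambda>j. x (Suc j) - x j" "{Suc k..<Suc k + n}"] N[OF that, of n] by simp
  qed
  have "summable (\<lambda>j. norm (x (Suc j) - x j))"
  proof (rule summableI_nonneg_bounded)
    fix n
    have "(\<Sum>j<n. norm (x (Suc j) - x j)) \<le> (\<Sum>j<Suc N + n. norm (x (Suc j) - x j))"
      by (intro sum_mono2) auto
    also have "\<dots> = (\<Sum>j<Suc N. norm (x (Suc j) - x j)) + (\<Sum>j=Suc N..<Suc N + n. norm (x (Suc j) - x j))"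
      unfolding lessThan_atLeast0 by (rule sum.atLeastLessThan_concat[symmetric]) auto
    finally show "(\<Sum>j<n. norm (x (Suc j) - x j)) \<le> (\<Sum>j<Suc N. norm (x (Suc j) - x j)) + D * a N powr (1 - q)"
      using N[of N n] by linarith
  qed simp
  then have "summable (\<lambda>j. x (Suc j) - x j)" by (rule summable_norm_cancel)
  then have "convergent (\<lambda>n. x n - x 0)" by (simp only: summable_iff_convergent sum_lessThan_telescope)
  then have "convergent x" by (simp only: convergent_diff_const_right_iff)
  then obtain l where l: "x \<longlonglongrightarrow> l" by (auto simp: convergent_def)
  have "norm (x (Suc k) - l) \<le> D * a k powr (1 - q)" if "N \<le> k" for k
  proof (rule LIMSEQ_le_const2)
    have "(\<lambda>n. x (n + Suc k)) \<longlonglongrightarrow> l" using l by (rule LIMSEQ_ignore_initial_segment)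
    then show "(\<lambda>n. norm (x (Suc k) - x (n + Suc k))) \<longlonglongrightarrow> norm (x (Suc k) - l)"
      by (intro tendsto_intros)
    show "\<exists>N. \<forall>n\<ge>N. norm (x (Suc k) - x (n + Suc k)) \<le> D * a k powr (1 - q)"
      using dist[OF that] by (simp add: norm_minus_commute add.commute)
  qed
  then have "\<forall>\<^sub>F k in sequentially. norm (x (Suc k) - l) \<le> D * a k powr (1 - q)"
    unfolding eventually_sequentially by (intro exI[of _ N]) simp
  then show ?thesis using D(1) l by (intro exI[of _ l] exI[of _ D]) simp
qed

lemma KL_recursion_rates:
  fixes x :: "nat \<Rightarrow> 'a::banach"
  assumes rec: "KL_recursion a (\<lambda>k. norm (x (Suc k) - x k)) c C q"
  shows "\<exists>l. x \<longlonglongrightarrow> l \<and>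
    (q = 1/2 \<longrightarrow> (\<exists>A \<rho> \<rho>'. 0 < A \<and> \<rho> \<in> {0<..<1} \<and> \<rho>' \<in> {0<..<1} \<and>
      (\<forall>\<^sub>F k in sequentially. a (Suc k) \<le> \<rho> * a k \<and> norm (x k - l) \<le> A * \<rho>' ^ k))) \<and>
    (1/2 < q \<longrightarrow> (\<exists>A B. 0 < A \<and> 0 < B \<and>
      (\<forall>\<^sub>F k in sequentially. a k \<le> A * real k powr (1 / (1 - 2 * q)) \<and>
        norm (x k - l) \<le> B * real k powr ((1 - q) / (1 - 2 * q)))))"
proof -
  interpret KL_recursion a "\<lambda>k. norm (x (Suc k) - x k)" c C q by fact
  obtain l D where D: "0 < D" "x \<longlonglongrightarrow> l"
    "\<forall>\<^sub>F k in sequentially. norm (x (Suc k) - l) \<le> D * a k powr (1 - q)"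
    using KL_recursion_limit[OF rec] by blast
  have lin: "\<exists>A \<rho> \<rho>'. 0 < A \<and> \<rho> \<in> {0<..<1} \<and> \<rho>' \<in> {0<..<1} \<and>
      (\<forall>\<^sub>F k in sequentially. a (Suc k) \<le> \<rho> * a k \<and> norm (x k - l) \<le> A * \<rho>' ^ k)" if q: "q = 1/2"
  proof -
    obtain \<rho> where \<rho>: "\<rho> \<in> {0<..<1}" "\<forall>\<^sub>F k in sequentially. a (Suc k) \<le> \<rho> * a k"
      using linear_rate[OF q] by blast
    obtain A s where A: "0 < A" "s \<in> {0<..<1}" "\<forall>\<^sub>F k in sequentially. a k \<le> A * s ^ k"
      using linear_rate_explicit[OF q] by blast
    \<comment> \<open>Dividing by \<open>sqrt s\<close> pays for moving the estimate from index
      \<open>k\<close> to \<open>Suc k\<close>; the rate for the iterates is the square root of that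
      for the values.\<close>
    define A' where "A' = D * sqrt A / sqrt s"
    have "\<forall>\<^sub>F k in sequentially. norm (x (Suc k) - l) \<le> A' * sqrt s ^ Suc k"
      using D(3) A(3)
    proof eventually_elim
      case (elim k)
      have "norm (x (Suc k) - l) \<le> D * sqrt (a k)"
        using elim(1) a_nonneg[of k] by (simp add: q powr_half_sqrt)
      also have "\<dots> \<le> D * sqrt (A * s ^ k)"
        using elim(2) D(1) by (intro mult_left_mono) auto
      also have "\<dots> = D * sqrt A * sqrt s ^ k" by (simp add: real_sqrt_mult real_sqrt_power)
      also have "\<dots> = A' * sqrt s ^ Suc k" using A(2) by (simp add: A'_def)
      finally show ?case .
    qed
    then have "\<forall>\<^sub>F k in sequentially. norm (x k - l) \<le> A' * sqrt s ^ k"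
      by (simp only: eventually_sequentially_Suc[of "\<lambda>k. norm (x k - l) \<le> A' * sqrt s ^ k"])
    with \<rho>(2) have "\<forall>\<^sub>F k in sequentially. a (Suc k) \<le> \<rho> * a k \<and> norm (x k - l) \<le> A' * sqrt s ^ k"
      by (rule eventually_conj)
    moreover have "0 < A'" using A D(1) by (simp add: A'_def)
    moreover have "sqrt s \<in> {0<..<1}" using A(2) by simp
    ultimately show ?thesis using \<rho>(1) by (intro exI[of _ A'] exI[of _ \<rho>] exI[of _ "sqrt s"]) simp
  qed
  have sub: "\<exists>A B. 0 < A \<and> 0 < B \<and>
      (\<forall>\<^sub>F k in sequentially. a k \<le> A * real k powr (1 / (1 - 2 * q)) \<and>
        norm (x k - l) \<le> B * real k powr ((1 - q) / (1 - 2 * q)))" if q: "1/2 < q"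
  proof -
    obtain A where A: "0 < A" "\<forall>\<^sub>F k in sequentially. a k \<le> A * real k powr (1 / (1 - 2 * q))"
      using sublinear_rate[OF q] by blast
    define t where "t = (1 - q) / (1 - 2 * q)"
    have t: "t \<le> 0" using q q_less by (simp add: t_def divide_nonneg_neg)
    \<comment> \<open>The factor \<open>(1/2) powr t\<close> pays for the index shift:
      \<open>k \<ge> Suc k / 2\<close> for positive \<open>k\<close>, and the exponent
      \<open>t\<close> is not positive.\<close>
    define B where "B = D * A powr (1 - q) * (1/2) powr t"
    have "\<forall>\<^sub>F k in sequentially. norm (x (Suc k) - l) \<le> B * real (Suc k) powr t"
      using D(3) A(2) eventually_gt_at_top[of 0]
    proof eventually_elim
      case (elim k)
      have "a k powr (1 - q) \<le> (A * real k powr (1 / (1 - 2 * q))) powr (1 - q)"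
        using elim(2) a_nonneg[of k] q_less by (intro powr_mono2) auto
      also have "\<dots> = A powr (1 - q) * real k powr t"
        by (simp add: powr_mult powr_powr t_def)
      also have "real k powr t \<le> (1/2 * real (Suc k)) powr t"
        using elim(3) t by (intro powr_mono2') auto
      also have "(1/2 * real (Suc k)) powr t = (1/2) powr t * real (Suc k) powr t" by (rule powr_mult)
      finally have "a k powr (1 - q) \<le> A powr (1 - q) * ((1/2) powr t * real (Suc k) powr t)"
        by (simp add: mult_left_mono)
      then have "D * a k powr (1 - q) \<le> D * (A powr (1 - q) * ((1/2) powr t * real (Suc k) powr t))"
        using D(1) by (intro mult_left_mono) auto
      then show ?case using elim(1) by (simp add: B_def mult.assoc)
    qed
    then have "\<forall>\<^sub>F k in sequentially. norm (x k - l) \<le> B * real k powr t"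
      by (simp only: eventually_sequentially_Suc[of "\<lambda>k. norm (x k - l) \<le> B * real k powr t"])
    with A(2) have "\<forall>\<^sub>F k in sequentially. a k \<le> A * real k powr (1 / (1 - 2 * q)) \<and> norm (x k - l) \<le> B * real k powr t"
      by (rule eventually_conj)
    moreover have "0 < B" using A(1) D(1) by (simp add: B_def)
    ultimately show ?thesis using A(1) unfolding t_def by (intro exI[of _ A] exI[of _ B]) simp
  qed
  show ?thesis using D(2) lin sub by (intro exI[of _ l]) simp
qed

section \<open>Subgradients and normal cones\<close>

text \<open>Working form of the difference quotient condition: a nonnegative lower limit means that
  every level \<open>- e\<close> is eventually exceeded. Multiplied out, the inequality needs no
  separate treatment of points where \<open>h\<close> is infinite.\<close>

lemma regular_subdiffI:
  fixes h :: "'a::real_inner \<Rightarrow> ereal"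
  assumes fin: "\<bar>h x\<bar> \<noteq> \<infinity>"
    and ev: "\<And>e. 0 < e \<Longrightarrow>
      \<forall>\<^sub>F y in at x. h x + ereal (v \<bullet> (y - x) - e * norm (y - x)) \<le> h y"
  shows "v \<in> regular_subdiff h x"
proof -
  obtain r where r: "h x = ereal r" using fin by auto
  have "\<forall>\<^sub>F y in at x. c < (h y - h x - ereal (v \<bullet> (y - x))) / ereal (norm (y - x))"
    if c0: "c < 0" for c :: ereal
  proof -
    obtain e' where "c < ereal e'" "ereal e' < 0" using ereal_dense2[OF c0] by blast
    then have e: "0 < - e'" "c < ereal (- (- e'))" by (auto simp: zero_ereal_def)
    define e where "e = - e'"
    note e = e[folded e_def]
    have "\<forall>\<^sub>F y in at x. y \<noteq> x" by (simp add: eventually_at_filter)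
    with ev[OF e(1)] show ?thesis
    proof eventually_elim
      case (elim y)
      then have n: "0 < norm (y - x)" by simp
      show ?case
      proof (cases "h y")
        case (real s)
        with elim r have "r + (v \<bullet> (y - x) - e * norm (y - x)) \<le> s" by simp
        then have "- e \<le> (s - r - v \<bullet> (y - x)) / norm (y - x)"
          using n by (simp add: pos_le_divide_eq)
        then have "ereal (- e) \<le> ereal ((s - r - v \<bullet> (y - x)) / norm (y - x))" by simp
        with e(2) have "c < ereal ((s - r - v \<bullet> (y - x)) / norm (y - x))" by (rule less_le_trans)
        then show ?thesis using real r n by simp
      next
        case PInf
        then have "(h y - h x - ereal (v \<bullet> (y - x))) / ereal (norm (y - x)) = \<infinity>"
          using r n by (simp add: divide_ereal_def)
        moreover have "c < \<infinity>" using c0 by (rule less_trans) simp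
        ultimately show ?thesis by simp
      next
        case MInf
        with elim r show ?thesis by simp
      qed
    qed
  qed
  then show ?thesis using fin by (simp add: regular_subdiff_def le_Liminf_iff)
qed

lemma regular_subdiffD:
  fixes h :: "'a::real_inner \<Rightarrow> ereal"
  assumes v: "v \<in> regular_subdiff h x" and e: "0 < e"
  shows "\<forall>\<^sub>F y in at x. h x + ereal (v \<bullet> (y - x) - e * norm (y - x)) \<le> h y"
proof -
  obtain r where r: "h x = ereal r" using v by (auto simp: regular_subdiff_def)
  have "ereal (- e) < 0" using e by simp
  then have "\<forall>\<^sub>F y in at x. ereal (- e) < (h y - h x - ereal (v \<bullet> (y - x))) / ereal (norm (y - x))"
    using v by (simp add: regular_subdiff_def le_Liminf_iff)
  moreover have "\<forall>\<^sub>F y in at x. y \<noteq> x" by (simp add: eventually_at_filter)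
  ultimately show ?thesis
  proof eventually_elim
    case (elim y)
    then have n: "0 < norm (y - x)" by simp
    show ?case
    proof (cases "h y")
      case (real s)
      with elim r n have "- e < (s - r - v \<bullet> (y - x)) / norm (y - x)" by simp
      then have "r + (v \<bullet> (y - x) - e * norm (y - x)) \<le> s"
        using n by (simp add: pos_less_divide_eq)
      then show ?thesis using real r by simp
    next
      case MInf
      with elim r n show ?thesis by simp
    qed simp
  qed
qed

lemma regular_subdiff_subset_limiting: "regular_subdiff h x \<subseteq> limiting_subdiff h x"
proof
  fix v assume "v \<in> regular_subdiff h x"
  then show "v \<in> limiting_subdiff h x"
    unfolding limiting_subdiff_def mem_Collect_eq
    by (intro conjI exI[of _ "\<lambda>_. x"] exI[of _ "\<lambda>_. v"]) (simp_all add: regular_subdiff_def)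
qed

text \<open>On the segment from \<open>x\<close> to \<open>z\<close> both sides of the local
  estimate scale linearly, so an estimate near \<open>x\<close> up to arbitrarily small slope is
  already global.\<close>

lemma convex_first_order_nonpos:
  fixes C :: "'a::real_inner set"
  assumes "convex C" "x \<in> C" "z \<in> C"
    and ev: "\<And>e. 0 < e \<Longrightarrow> \<forall>\<^sub>F y in at x. y \<in> C \<longrightarrow> u \<bullet> (y - x) \<le> e * norm (y - x)"
  shows "u \<bullet> (z - x) \<le> 0"
proof (cases "z = x")
  case False
  then have n: "0 < norm (z - x)" by simp
  show ?thesis
  proof (rule ccontr)
    assume "\<not> ?thesis"
    then have pos: "0 < u \<bullet> (z - x)" by simp
    \<comment> \<open>Half of the alleged slope, so that the estimate along the segment contradicts
      itself.\<close>
    define e where "e = u \<bullet> (z - x) / (2 * norm (z - x))"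
    have e: "0 < e" using pos n by (simp add: e_def)
    from ev[OF e] obtain d where d: "0 < d"
      "\<And>y. y \<noteq> x \<Longrightarrow> dist y x < d \<Longrightarrow> y \<in> C \<Longrightarrow> u \<bullet> (y - x) \<le> e * norm (y - x)"
      unfolding eventually_at by auto
    define t where "t = min 1 (d / (2 * norm (z - x)))"
    have t: "0 < t" "t \<le> 1" "t * norm (z - x) < d"
      using d(1) n by (auto simp: t_def min_def field_simps)
    have "x + t *\<^sub>R (z - x) \<in> C"
      using convexD_alt[OF assms(1-3), of t] t by (simp add: algebra_simps)
    then have "u \<bullet> (t *\<^sub>R (z - x)) \<le> e * norm (t *\<^sub>R (z - x))"
      using d(2)[of "x + t *\<^sub>R (z - x)"] t n False by (simp add: dist_norm)
    then have "t * (u \<bullet> (z - x)) \<le> t * (e * norm (z - x))" using t by (simp add: mult_ac)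
    then have "u \<bullet> (z - x) \<le> e * norm (z - x)" using t by simp
    also have "\<dots> = u \<bullet> (z - x) / 2" using n by (simp add: e_def)
    finally show False using pos by simp
  qed
qed simp

lemma limiting_normal_cone_convexI:
  fixes C :: "'a::real_inner set"
  assumes "x \<in> C" "\<And>z. z \<in> C \<Longrightarrow> y \<bullet> (z - x) \<le> 0"
  shows "y \<in> limiting_normal_cone C x"
proof -
  have "y \<in> regular_subdiff (indicator_fun C) x"
  proof (rule regular_subdiffI)
    fix e :: real assume "0 < e"
    have "indicator_fun C x + ereal (y \<bullet> (z - x) - e * norm (z - x)) \<le> indicator_fun C z" for z
    proof (cases "z \<in> C")
      case True
      have "0 \<le> e * norm (z - x)" using \<open>0 < e\<close> by simp
      then have "y \<bullet> (z - x) - e * norm (z - x) \<le> 0" using assms(2)[OF True] by linarith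
      then show ?thesis using True assms(1) by (simp add: indicator_fun_def)
    qed (simp add: indicator_fun_def)
    then show "\<forall>\<^sub>F z in at x. indicator_fun C x + ereal (y \<bullet> (z - x) - e * norm (z - x)) \<le> indicator_fun C z"
      by simp
  qed (use assms in \<open>simp add: indicator_fun_def\<close>)
  then show ?thesis
    unfolding limiting_normal_cone_def using regular_subdiff_subset_limiting by blast
qed

text \<open>For a convex set the limiting cone is the one of convex analysis: the inequality holds
  for regular normals by the first-order lemma and passes to limits. The approximating points lie in
  \<open>C\<close> because a regular subgradient requires a finite value of the indicator.\<close>

lemma limiting_normal_cone_convexD:
  fixes C :: "'a::real_inner set"
  assumes C: "convex C" and y: "y \<in> limiting_normal_cone C x"
  shows "x \<in> C" "\<And>z. z \<in> C \<Longrightarrow> y \<bullet> (z - x) \<le> 0"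
proof -
  show "x \<in> C" using y
    by (auto simp: limiting_normal_cone_def limiting_subdiff_def indicator_fun_def split: if_splits)
  obtain X V where XV: "X \<longlonglongrightarrow> x" "\<And>i. V i \<in> regular_subdiff (indicator_fun C) (X i)" "V \<longlonglongrightarrow> y"
    using y by (auto simp: limiting_normal_cone_def limiting_subdiff_def)
  have X: "X i \<in> C" for i
    using XV(2)[of i] by (auto simp: regular_subdiff_def indicator_fun_def split: if_splits)
  fix z assume z: "z \<in> C"
  have "V i \<bullet> (z - X i) \<le> 0" for i
  proof (rule convex_first_order_nonpos[OF C X z])
    fix e :: real assume "0 < e"
    from regular_subdiffD[OF XV(2) this]
    show "\<forall>\<^sub>F y in at (X i). y \<in> C \<longrightarrow> V i \<bullet> (y - X i) \<le> e * norm (y - X i)"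
      by (rule eventually_mono) (use X in \<open>auto simp: indicator_fun_def\<close>)
  qed
  moreover have "(\<lambda>i. V i \<bullet> (z - X i)) \<longlonglongrightarrow> y \<bullet> (z - x)"
    by (intro tendsto_intros XV)
  ultimately show "y \<bullet> (z - x) \<le> 0" by (intro LIMSEQ_le_const2) auto
qed

text \<open>Testing with \<open>0\<close> and \<open>2 *\<^sub>R z\<close> gives complementarity;
  testing with \<open>z\<close> lowered in one coordinate gives the sign of that coordinate of
  \<open>lam\<close>.\<close>

lemma nonpos_orthant_normal:
  fixes lam z :: "real^'m"
  assumes "lam \<in> limiting_normal_cone {z. z \<le> 0} z"
  shows "0 \<le> lam" "lam \<bullet> z = 0"
proof -
  have C: "convex {z :: real^'m. z \<le> 0}"
    by (auto simp: convex_def less_eq_vec_def intro!: add_nonpos_nonpos mult_nonneg_nonpos)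
  note D = limiting_normal_cone_convexD[OF C assms]
  have z: "z \<le> 0" using D(1) by simp
  have "lam \<bullet> (0 - z) \<le> 0" by (rule D(2)) simp
  moreover have "lam \<bullet> (2 *\<^sub>R z - z) \<le> 0"
    by (rule D(2)) (use z in \<open>simp add: less_eq_vec_def\<close>)
  ultimately show "lam \<bullet> z = 0" by (simp add: scaleR_2)
  have "0 \<le> lam $ i" for i
  proof -
    have "lam \<bullet> ((z - axis i 1) - z) \<le> 0"
    proof (rule D(2))
      show "z - axis i 1 \<in> {z. z \<le> 0}"
        using z by (simp add: less_eq_vec_def axis_def) (smt (verit))
    qed
    then show ?thesis by (simp add: inner_axis)
  qed
  then show "0 \<le> lam" by (simp add: less_eq_vec_def)
qed

section \<open>Finite convex functions: subgradients, conjugates and first-order optimality\<close>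

definition convex_subdiff :: "('a::real_inner \<Rightarrow> real) \<Rightarrow> 'a \<Rightarrow> 'a set" where
  "convex_subdiff h x = {w. \<forall>y. h x + w \<bullet> (y - x) \<le> h y}"

lemma convex_subdiffD: "w \<in> convex_subdiff h x \<Longrightarrow> h x + w \<bullet> (y - x) \<le> h y"
  by (simp add: convex_subdiff_def)

text \<open>Optimality condition over \<open>C\<close> with no interior point of \<open>C\<close>
  required. The strict epigraph of the excess \<open>k\<close> over the minimal value is separated
  from \<open>C \<times> {..0}\<close>; the slope of the separating hyperplane, less
  \<open>a\<close>, is the desired subgradient.\<close>

lemma convex_minimizer_subgradient:
  fixes h :: "'a::euclidean_space \<Rightarrow> real"
  assumes h: "convex_on UNIV h" and C: "convex C" and xb: "xb \<in> C"
    and min: "\<And>z. z \<in> C \<Longrightarrow> h xb \<le> a \<bullet> (z - xb) + h z"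
  shows "\<exists>w\<in>convex_subdiff h xb. \<forall>z\<in>C. 0 \<le> (a + w) \<bullet> (z - xb)"
proof -
  define k where "k z = a \<bullet> (z - xb) + h z - h xb" for z
  define S where "S = {p :: 'a \<times> real. k (fst p) < snd p}"
  have convS: "convex S"
  proof (rule convexI)
    fix p r :: "'a \<times> real" and u v :: real
    assume p: "p \<in> S" and r: "r \<in> S" and uv: "0 \<le> u" "0 \<le> v" "u + v = 1"
    have v: "v = 1 - u" using uv by simp
    have "h (u *\<^sub>R fst p + v *\<^sub>R fst r) \<le> u * h (fst p) + v * h (fst r)"
      using convex_onD[OF h, of v "fst p" "fst r"] uv v by simp
    then have "k (u *\<^sub>R fst p + v *\<^sub>R fst r) \<le> u * k (fst p) + v * k (fst r)"
      unfolding k_def v by (simp add: inner_add_right inner_diff_right algebra_simps)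
    also have "\<dots> < u * snd p + v * snd r"
    proof (cases "u = 0")
      case True then show ?thesis using r v by (simp add: S_def)
    next
      case False
      then have "u * k (fst p) < u * snd p" using p uv by (simp add: S_def)
      moreover have "v * k (fst r) \<le> v * snd r" using r uv by (simp add: S_def mult_left_mono)
      ultimately show ?thesis by linarith
    qed
    finally show "u *\<^sub>R p + v *\<^sub>R r \<in> S" by (simp add: S_def)
  qed
  have disj: "S \<inter> C \<times> {..0} = {}"
    using min by (force simp: S_def k_def)
  have "(xb, 1) \<in> S" by (simp add: S_def k_def)
  moreover have "(xb, 0) \<in> C \<times> {..0::real}" using xb by simp
  ultimately obtain pb c where pb: "pb \<noteq> 0" "\<And>x. x \<in> S \<Longrightarrow> pb \<bullet> x \<le> c"
      "\<And>x. x \<in> C \<times> {..0} \<Longrightarrow> c \<le> pb \<bullet> x"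
    using separating_hyperplane_sets[OF convS convex_Times[OF C convex_real_interval(2)] _ _ disj]
    by blast
  obtain p b where p: "pb = (p, b)" by fastforce
  have S: "p \<bullet> z + b * t \<le> c" if "k z < t" for z t
    using pb(2)[of "(z, t)"] that by (simp add: S_def p)
  have T: "c \<le> p \<bullet> z" if "z \<in> C" for z
    using pb(3)[of "(z, 0)"] that by (simp add: p)
  \<comment> \<open>The epigraph is unbounded upwards, so \<open>b\<close> cannot be positive; and
    \<open>h\<close> is finite everywhere, so a vertical hyperplane would bound the nonzero
    functional \<open>p\<close> on the whole space.\<close>
  have b: "b < 0"
  proof (rule ccontr)
    assume "\<not> b < 0"
    then consider "0 < b" | "b = 0" by linarith
    then show False
    proof cases
      case 1
      define t where "t = max 1 ((c - p \<bullet> xb) / b + 1)"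
      have "p \<bullet> xb + b * t \<le> c" by (rule S) (simp add: t_def k_def)
      moreover have "b * ((c - p \<bullet> xb) / b + 1) \<le> b * t" using 1 by (intro mult_left_mono) (auto simp: t_def)
      ultimately show False using 1 by (simp add: distrib_left)
    next
      case 2
      then have p0: "p \<noteq> 0" using pb(1) p by (simp add: zero_prod_def)
      define z where "z = ((c + 1) / (p \<bullet> p)) *\<^sub>R p"
      have "p \<bullet> z + b * (k z + 1) \<le> c" by (rule S) simp
      then show False using 2 p0 by (simp add: z_def)
    qed
  qed
  \<comment> \<open>Passes from the strict epigraph to its boundary.\<close>
  have Sle: "p \<bullet> z + b * k z \<le> c" for z
  proof (rule field_le_epsilon)
    fix e :: real assume "0 < e"
    then have "p \<bullet> z + b * (k z + e / - b) \<le> c" using b by (intro S) (simp add: divide_pos_neg)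
    moreover have "b * (k z + e / - b) = b * k z - e" using b by (simp add: field_simps)
    ultimately show "p \<bullet> z + b * k z \<le> c + e" by simp
  qed
  have c: "c = p \<bullet> xb" using Sle[of xb] T[OF xb] by (simp add: k_def)
  define w where "w = (- 1 / b) *\<^sub>R p - a"
  have aw: "(a + w) \<bullet> (z - xb) = (p \<bullet> (z - xb)) / (- b)" for z by (simp add: w_def)
  have "h xb + w \<bullet> (z - xb) \<le> h z" for z
  proof -
    have "p \<bullet> (z - xb) \<le> k z * (- b)" using Sle[of z] by (simp add: c inner_diff_right mult.commute)
    moreover have "0 < - b" using b by simp
    ultimately have "(a + w) \<bullet> (z - xb) \<le> k z" unfolding aw by (simp only: pos_divide_le_eq)
    then show ?thesis by (simp add: k_def inner_add_left)
  qed
  moreover have "0 \<le> (a + w) \<bullet> (z - xb)" if "z \<in> C" for z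
    unfolding aw using T[OF that] b by (simp add: c inner_diff_right divide_nonneg_neg)
  ultimately show ?thesis by (auto simp: convex_subdiff_def)
qed

text \<open>Every point is a minimizer over its own singleton.\<close>

lemma convex_subdiff_nonempty:
  fixes h :: "'a::euclidean_space \<Rightarrow> real"
  assumes "convex_on UNIV h"
  shows "convex_subdiff h x \<noteq> {}"
  using convex_minimizer_subgradient[OF assms, of "{x}" x 0] by auto

lemma convex_continuous_UNIV:
  fixes h :: "'a::euclidean_space \<Rightarrow> real"
  assumes "convex_on UNIV h"
  shows "continuous_on S h"
  using convex_on_continuous[OF open_UNIV assms] continuous_on_subset by blast

lemma convex_subdiff_bounded:
  fixes h :: "'a::euclidean_space \<Rightarrow> real"
  assumes h: "convex_on UNIV h"
  shows "\<exists>B>0. \<forall>x w. norm x \<le> R \<longrightarrow> w \<in> convex_subdiff h x \<longrightarrow> norm w \<le> B"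
proof -
  have "compact (h ` cball 0 (R + 1))"
    by (intro compact_continuous_image convex_continuous_UNIV h compact_cball)
  then have "bounded (h ` cball 0 (R + 1))" by (rule compact_imp_bounded)
  then obtain B where "\<forall>t\<in>h ` cball 0 (R + 1). norm t \<le> B" unfolding bounded_iff by blast
  then have B: "\<bar>h x\<bar> \<le> B" if "x \<in> cball 0 (R + 1)" for x using that by simp
  have "norm w \<le> 2 * \<bar>B\<bar> + 1" if "norm x \<le> R" "w \<in> convex_subdiff h x" for x w
  proof (cases "w = 0")
    case False
    \<comment> \<open>One unit along \<open>w\<close> the subgradient inequality gains exactly
      \<open>norm w\<close>, so the values of \<open>h\<close> on the larger ball bound it.\<close>
    define y where "y = x + (1 / norm w) *\<^sub>R w"
    have "norm y \<le> norm x + norm ((1 / norm w) *\<^sub>R w)" unfolding y_def by (rule norm_triangle_ineq)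
    then have "norm y \<le> R + 1" using that False by simp
    moreover have "w \<bullet> (y - x) = norm w" using False by (simp add: y_def dot_square_norm power2_eq_square)
    ultimately show ?thesis
      using convex_subdiffD[OF that(2), of y] B[of y] B[of x] that(1) by (simp add: abs_le_iff)
  qed simp
  then show ?thesis by (intro exI[of _ "2 * \<bar>B\<bar> + 1"]) auto
qed

lemma convex_lower_lipschitz:
  fixes h :: "'a::euclidean_space \<Rightarrow> real"
  assumes h: "convex_on UNIV h"
  shows "\<exists>B>0. \<forall>x y. norm x \<le> R \<longrightarrow> h x - B * norm (y - x) \<le> h y"
proof -
  obtain B where B: "0 < B" "\<And>x w. norm x \<le> R \<Longrightarrow> w \<in> convex_subdiff h x \<Longrightarrow> norm w \<le> B"
    using convex_subdiff_bounded[OF h] by blast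
  have "h x - B * norm (y - x) \<le> h y" if "norm x \<le> R" for x y
  proof -
    obtain w where w: "w \<in> convex_subdiff h x" using convex_subdiff_nonempty[OF h] by blast
    have "\<bar>w \<bullet> (y - x)\<bar> \<le> norm w * norm (y - x)" by (rule Cauchy_Schwarz_ineq2)
    also have "\<dots> \<le> B * norm (y - x)" using B(2)[OF that w] by (intro mult_right_mono) auto
    finally show ?thesis using convex_subdiffD[OF w, of y] by linarith
  qed
  then show ?thesis using B(1) by blast
qed

text \<open>Where the concave function \<open>- h\<close> has a regular subgradient, that vector
  plus any convex subgradient of \<open>h\<close> has nonpositive first-order effect in all
  directions and hence vanishes. The subgradient inequality then passes to the limit by continuity
  of \<open>h\<close>.\<close>

lemma limiting_subdiff_neg_convex:
  fixes h :: "'a::euclidean_space \<Rightarrow> real"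
  assumes h: "convex_on UNIV h" and v: "v \<in> limiting_subdiff (\<lambda>z. ereal (- h z)) x"
  shows "- v \<in> convex_subdiff h x"
proof -
  obtain X V where XV: "X \<longlonglongrightarrow> x" "\<And>i. V i \<in> regular_subdiff (\<lambda>z. ereal (- h z)) (X i)" "V \<longlonglongrightarrow> v"
    using v by (auto simp: limiting_subdiff_def)
  have V: "- V i \<in> convex_subdiff h (X i)" for i
  proof -
    obtain w where w: "w \<in> convex_subdiff h (X i)" using convex_subdiff_nonempty[OF h] by blast
    \<comment> \<open>The direction is the vector itself, so its squared norm is shown to be
      nonpositive.\<close>
    have "(V i + w) \<bullet> ((X i + (V i + w)) - X i) \<le> 0"
    proof (rule convex_first_order_nonpos[of UNIV])
      fix e :: real assume "0 < e"
      from regular_subdiffD[OF XV(2) this]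
      show "\<forall>\<^sub>F y in at (X i). y \<in> UNIV \<longrightarrow> (V i + w) \<bullet> (y - X i) \<le> e * norm (y - X i)"
      proof (rule eventually_mono)
        fix y assume "ereal (- h (X i)) + ereal (V i \<bullet> (y - X i) - e * norm (y - X i)) \<le> ereal (- h y)"
        then show "y \<in> UNIV \<longrightarrow> (V i + w) \<bullet> (y - X i) \<le> e * norm (y - X i)"
          using convex_subdiffD[OF w, of y] by (simp add: inner_add_left)
      qed
    qed auto
    then have "w = - V i" by (simp add: inner_eq_zero_iff[symmetric] del: inner_eq_zero_iff) (metis add.commute add_eq_0_iff inner_eq_zero_iff inner_ge_zero order_antisym)
    then show ?thesis using w by simp
  qed
  have "h x + (- v) \<bullet> (y - x) \<le> h y" for y
  proof (rule LIMSEQ_le_const2)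
    have "isCont h x" using convex_continuous_UNIV[OF h, of UNIV] by (simp add: continuous_on_eq_continuous_at)
    then have "(\<lambda>i. h (X i)) \<longlonglongrightarrow> h x" using XV(1) isCont_tendsto_compose by blast
    then show "(\<lambda>i. h (X i) + (- V i) \<bullet> (y - X i)) \<longlonglongrightarrow> h x + (- v) \<bullet> (y - x)"
      by (intro tendsto_intros XV)
    show "\<exists>N. \<forall>n\<ge>N. h (X n) + (- V n) \<bullet> (y - X n) \<le> h y"
      using convex_subdiffD[OF V] by blast
  qed
  then show ?thesis by (simp add: convex_subdiff_def)
qed

lemma conjugate_ge: "ereal (w \<bullet> y - h y) \<le> conjugate_fun h w"
  unfolding conjugate_fun_def by (rule SUP_upper) simp

text \<open>Fenchel equality: the subgradient inequality says that \<open>x\<close> attains the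
  supremum.\<close>

lemma conjugate_at_subgradient:
  assumes "w \<in> convex_subdiff h x"
  shows "conjugate_fun h w = ereal (w \<bullet> x - h x)"
proof (rule antisym)
  show "conjugate_fun h w \<le> ereal (w \<bullet> x - h x)"
    unfolding conjugate_fun_def
    by (rule SUP_least) (use convex_subdiffD[OF assms] in \<open>auto simp: inner_diff_right algebra_simps\<close>)
qed (rule conjugate_ge)

text \<open>Along a segment the quadratic term is of second order, so a minimizer of the quadratic
  model also minimizes the model without it. This is the form that
  \<open>convex_minimizer_subgradient\<close> accepts.\<close>

lemma quadratic_minimizer_first_order:
  fixes h :: "'a::real_inner \<Rightarrow> real"
  assumes h: "convex_on UNIV h" and C: "convex C" "xb \<in> C" "z \<in> C"
    and min: "\<And>z. z \<in> C \<Longrightarrow> h xb \<le> a \<bullet> (z - xb) + 1/2 * ((z - xb) \<bullet> blinfun_apply Q (z - xb)) + h z"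
  shows "h xb \<le> a \<bullet> (z - xb) + h z"
proof (rule ccontr)
  define s where "s = a \<bullet> (z - xb) + h z - h xb"
  define r where "r = (z - xb) \<bullet> blinfun_apply Q (z - xb)"
  assume "\<not> ?thesis"
  then have s: "s < 0" by (simp add: s_def)
  \<comment> \<open>Short enough that the quadratic term cannot make up for the negative first-order
    change \<open>s\<close>.\<close>
  define t where "t = min 1 (- s / (\<bar>r\<bar> + 1))"
  have t: "0 < t" "t \<le> 1" using s by (auto simp: t_def divide_neg_pos)
  have "t * (\<bar>r\<bar> + 1) \<le> - s / (\<bar>r\<bar> + 1) * (\<bar>r\<bar> + 1)" by (intro mult_right_mono) (auto simp: t_def)
  then have tr: "t * (\<bar>r\<bar> + 1) \<le> - s" by simp
  define zt where "zt = (1 - t) *\<^sub>R xb + t *\<^sub>R z"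
  have "zt \<in> C" unfolding zt_def using convexD_alt[OF C, of t] t by simp
  from min[OF this] have "h xb \<le> a \<bullet> (zt - xb) + 1/2 * ((zt - xb) \<bullet> blinfun_apply Q (zt - xb)) + h zt" .
  moreover have "zt - xb = t *\<^sub>R (z - xb)" by (simp add: zt_def algebra_simps)
  moreover have "h zt \<le> (1 - t) * h xb + t * h z"
    unfolding zt_def using convex_onD[OF h, of t xb z] t by simp
  ultimately have "h xb \<le> t * (a \<bullet> (z - xb)) + 1/2 * (t * (t * r)) + ((1 - t) * h xb + t * h z)"
    by (simp add: r_def blinfun.scaleR_right mult.assoc del: inner_diff_right)
  then have "0 \<le> t * s + 1/2 * (t * (t * r))"
    by (simp add: s_def algebra_simps)
  then have "0 \<le> t * (s + 1/2 * (t * r))" by (simp add: algebra_simps)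
  then have "0 \<le> s + 1/2 * (t * r)" using t(1) by (simp add: zero_le_mult_iff)
  moreover have "t * r \<le> t * (\<bar>r\<bar> + 1)" using t by (intro mult_left_mono) auto
  ultimately show False using tr s by linarith
qed

section \<open>Smooth maps and the quadratic models\<close>

text \<open>Compactness makes the local Lipschitz constants of the derivative uniform, and convexity
  of \<open>K\<close> keeps segments inside for the mean value estimate. One constant serves all
  three bounds.\<close>

lemma C11_on_compact_bounds:
  fixes h :: "'a::euclidean_space \<Rightarrow> 'b::euclidean_space"
  assumes C11: "C11_on S h" and K: "compact K" "convex K" "K \<subseteq> S"
  obtains h' C where "0 < C" "\<And>x. x \<in> S \<Longrightarrow> (h has_derivative blinfun_apply (h' x)) (at x)"
    "C-lipschitz_on K h'" "\<And>x. x \<in> K \<Longrightarrow> norm (h' x) \<le> C"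
    "\<And>x y. x \<in> K \<Longrightarrow> y \<in> K \<Longrightarrow> norm (h y - h x - blinfun_apply (h' x) (y - x)) \<le> C * (norm (y - x))\<^sup>2"
proof -
  obtain h' :: "'a \<Rightarrow> 'a \<Rightarrow>\<^sub>L 'b" where h':
      "\<And>x. x \<in> S \<Longrightarrow> (h has_derivative blinfun_apply (h' x)) (at x)"
      "\<And>x. x \<in> S \<Longrightarrow> \<exists>\<epsilon>>0. \<exists>C. C-lipschitz_on (ball x \<epsilon> \<inter> S) h'"
    using C11 unfolding C11_on_def by blast
  \<comment> \<open>The notion concerns families depending on time; \<open>{0}\<close> is a dummy
    time.\<close>
  have "local_lipschitz {0::real} K (\<lambda>_. h')"
    unfolding local_lipschitz_def
  proof (intro ballI)
    fix x t assume x: "x \<in> K" and t: "t \<in> {0::real}"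
    then obtain \<epsilon> C where \<epsilon>: "0 < \<epsilon>" "C-lipschitz_on (ball x \<epsilon> \<inter> S) h'" using h'(2) K(3) by blast
    have "C-lipschitz_on (cball x (\<epsilon> / 2) \<inter> K) h'"
      by (rule lipschitz_on_subset[OF \<epsilon>(2)]) (use \<epsilon>(1) K(3) in auto)
    then show "\<exists>u>0. \<exists>L. \<forall>t\<in>cball t u \<inter> {0}. L-lipschitz_on (cball x u \<inter> K) h'"
      using \<epsilon>(1) by (intro exI[of _ "\<epsilon> / 2"]) auto
  qed
  then obtain C1 where "\<And>t. t \<in> {0::real} \<Longrightarrow> C1-lipschitz_on K h'"
    using local_lipschitz_compact_implies_lipschitz[where X = K and T = "{0::real}" and f = "\<lambda>_. h'"] K(1) by auto
  then have C1: "C1-lipschitz_on K h'" by simp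
  have "compact (h' ` K)"
    using lipschitz_on_continuous_on[OF C1] K(1) by (rule compact_continuous_image)
  then have "bounded (h' ` K)" by (rule compact_imp_bounded)
  then obtain C2 where C2: "\<forall>t\<in>h' ` K. norm t \<le> C2" unfolding bounded_iff by blast
  define C where "C = max 1 (max C1 C2)"
  have C: "0 < C" by (simp add: C_def)
  have lip: "C-lipschitz_on K h'" by (rule lipschitz_on_le[OF C1]) (simp add: C_def)
  have "norm (h y - h x - blinfun_apply (h' x) (y - x)) \<le> C * (norm (y - x))\<^sup>2"
    if xy: "x \<in> K" "y \<in> K" for x y
  proof -
    have seg: "closed_segment x y \<subseteq> K" using closed_segment_subset[OF xy K(2)] .
    have "norm (h y - h x - blinfun_apply (h' x) (y - x)) \<le> norm (y - x) * (C * norm (y - x))"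
    proof (rule differentiable_bound_linearization[where S = "closed_segment x y"])
      fix t :: real assume "t \<in> {0..1}"
      then show "x + t *\<^sub>R (y - x) \<in> closed_segment x y"
        by (auto simp: in_segment algebra_simps intro!: exI[of _ t])
    next
      fix z assume z: "z \<in> closed_segment x y"
      then show "(h has_derivative blinfun_apply (h' z)) (at z within closed_segment x y)"
        using h'(1) seg K(3) has_derivative_at_withinI by blast
      have "blinfun_apply (h' z) - blinfun_apply (h' x) = blinfun_apply (h' z - h' x)"
        by (auto simp: blinfun.diff_left)
      then have "onorm (blinfun_apply (h' z) - blinfun_apply (h' x)) = norm (h' z - h' x)"
        by (simp add: norm_blinfun.rep_eq)
      also have "\<dots> \<le> C * norm (z - x)" using lipschitz_on_normD[OF lip] z seg xy(1) by blast
      also have "\<dots> \<le> C * norm (y - x)"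
        using segment_bound(1)[OF z] C by (intro mult_left_mono) (auto simp: norm_minus_commute)
      finally show "onorm (blinfun_apply (h' z) - blinfun_apply (h' x)) \<le> C * norm (y - x)" .
    qed simp
    then show ?thesis by (simp add: power2_eq_square mult_ac)
  qed
  moreover have "norm (h' x) \<le> C" if "x \<in> K" for x using C2 that by (auto simp: C_def)
  ultimately show thesis using that[OF C h'(1) lip] by blast
qed

text \<open>Applied to the derivative of \<open>g\<close>: its own derivative is not assumed
  continuous, so bounds for it come from the Lipschitz condition instead of compactness.\<close>

lemma lipschitz_derivative_norm_bound:
  fixes h :: "'a::real_normed_vector \<Rightarrow> 'b::real_normed_vector"
  assumes "(h has_derivative D) (at x)" "C-lipschitz_on U h" "open U" "x \<in> U"
  shows "norm (D d) \<le> C * norm d"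
proof (cases "d = 0")
  case True
  then show ?thesis using linear_0[OF has_derivative_linear[OF assms(1)]] by simp
next
  case False
  then have n: "0 < norm d" by simp
  show ?thesis
  proof (rule field_le_epsilon)
    fix e' :: real assume e': "0 < e'"
    define e where "e = e' / norm d"
    have e: "0 < e" using e' n by (simp add: e_def)
    obtain \<delta> where \<delta>: "0 < \<delta>" "\<And>y. norm (y - x) < \<delta> \<Longrightarrow> norm (h y - h x - D (y - x)) \<le> e * norm (y - x)"
      using assms(1) e unfolding has_derivative_at_alt by blast
    obtain r where r: "0 < r" "ball x r \<subseteq> U" using assms(3,4) open_contains_ball by blast
    \<comment> \<open>Short enough for the linearization estimate and for staying in
      \<open>U\<close>.\<close>
    define t where "t = min \<delta> r / (2 * norm d)"
    have t: "0 < t" using \<delta>(1) r(1) n by (simp add: t_def)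
    have "t * norm d = min \<delta> r / 2" using n by (simp add: t_def)
    then have tn: "t * norm d < \<delta>" "t * norm d < r" using \<delta>(1) r(1) by auto
    define y where "y = x + t *\<^sub>R d"
    have y: "norm (y - x) = t * norm d" using t by (simp add: y_def)
    then have "y \<in> U" using tn r(2) by (auto simp: dist_norm norm_minus_commute)
    then have "norm (h y - h x) \<le> C * norm (y - x)" using lipschitz_on_normD[OF assms(2) _ assms(4)] by blast
    moreover have "norm (h y - h x - D (y - x)) \<le> e * norm (y - x)" by (rule \<delta>(2)) (use y tn in simp)
    moreover have "norm (D (y - x)) \<le> norm (h y - h x) + norm (h y - h x - D (y - x))"
      using norm_triangle_ineq4[of "h y - h x" "h y - h x - D (y - x)"] by simp
    moreover have "D (y - x) = t *\<^sub>R D d"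
      using linear_cmul[OF has_derivative_linear[OF assms(1)], of t d] by (simp add: y_def)
    ultimately have "t * norm (D d) \<le> C * (t * norm d) + e * (t * norm d)" using y t by simp
    then have "t * norm (D d) \<le> t * (C * norm d + e * norm d)" by (simp add: algebra_simps)
    then have "norm (D d) \<le> C * norm d + e * norm d" using t by simp
    then show "norm (D d) \<le> C * norm d + e'" using n by (simp add: e_def)
  qed
qed

section \<open>The quadratic constraint model: expansion, convexity, joint derivative\<close>

lemma Gfun_eq:
  assumes "(g has_derivative blinfun_apply g's) (at s)"
  shows "Gfun g x s L = g s + blinfun_apply g's (x - s) + (1/2 * (norm (x - s))\<^sup>2) *\<^sub>R L"
  unfolding Gfun_def frechet_derivative_at[OF assms, symmetric] ..

lemma Gfun_expand:
  assumes "(g has_derivative blinfun_apply g's) (at s)"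
  shows "Gfun g y s L = Gfun g x s L + (blinfun_apply g's (y - x) + ((x - s) \<bullet> (y - x)) *\<^sub>R L)
    + (1/2 * (norm (y - x))\<^sup>2) *\<^sub>R L"
proof -
  have "(norm (y - s))\<^sup>2 = (norm (x - s))\<^sup>2 + 2 * ((x - s) \<bullet> (y - x)) + (norm (y - x))\<^sup>2"
    by (simp add: power2_norm_eq_inner inner_diff_left inner_diff_right inner_commute)
  then have "(1/2 * (norm (y - s))\<^sup>2) *\<^sub>R L
      = (1/2 * (norm (x - s))\<^sup>2) *\<^sub>R L + ((x - s) \<bullet> (y - x)) *\<^sub>R L + (1/2 * (norm (y - x))\<^sup>2) *\<^sub>R L"
    by (simp add: scaleR_add_left[symmetric] add_divide_distrib)
  moreover have "blinfun_apply g's (y - s) = blinfun_apply g's (x - s) + blinfun_apply g's (y - x)"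
    by (simp add: blinfun.diff_right)
  ultimately show ?thesis by (simp add: Gfun_eq[OF assms])
qed

lemma Gfun_has_derivative:
  assumes "(g has_derivative blinfun_apply g's) (at s)"
  shows "((\<lambda>x. Gfun g x s L) has_derivative (\<lambda>d. blinfun_apply g's d + ((x - s) \<bullet> d) *\<^sub>R L)) (at x)"
  unfolding Gfun_eq[OF assms] power2_norm_eq_inner
  by (auto intro!: derivative_eq_intros simp: inner_commute)

lemma nabla_Gfun_inner:
  fixes g :: "real^'n \<Rightarrow> real^'m"
  assumes "(g has_derivative blinfun_apply g's) (at s)"
  shows "nabla (\<lambda>x. Gfun g x s L) x lam \<bullet> d = lam \<bullet> (blinfun_apply g's d + ((x - s) \<bullet> d) *\<^sub>R L)"
proof -
  note D = Gfun_has_derivative[OF assms, of L x]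
  show ?thesis
    unfolding nabla_def frechet_derivative_at[OF D, symmetric]
    using adjoint_works[OF has_derivative_linear[OF D], of d lam] by (simp add: inner_commute)
qed

text \<open>Since \<open>L\<close> is nonnegative, the model lies above its linearization at the
  combination \<open>z\<close>. Averaging the linearizations at \<open>a\<close> and
  \<open>b\<close> cancels the linear part and leaves the value at \<open>z\<close>.\<close>

lemma Gamma_model_convex:
  fixes g :: "real^'n \<Rightarrow> real^'m"
  assumes "(g has_derivative blinfun_apply g's) (at s)" and L: "0 \<le> L"
  shows "convex (Gamma_model g s L)"
proof (rule convexI)
  fix a b :: "real^'n" and u v :: real
  assume a: "a \<in> Gamma_model g s L" and b: "b \<in> Gamma_model g s L" and uv: "0 \<le> u" "0 \<le> v" "u + v = 1"
  define z where "z = u *\<^sub>R a + v *\<^sub>R b"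
  define T where "T d = blinfun_apply g's d + ((z - s) \<bullet> d) *\<^sub>R L" for d
  have le: "Gfun g z s L + T (c - z) \<le> 0" if "c \<in> Gamma_model g s L" for c
  proof -
    have "Gfun g c s L = Gfun g z s L + T (c - z) + (1/2 * (norm (c - z))\<^sup>2) *\<^sub>R L"
      unfolding T_def by (rule Gfun_expand[OF assms(1)])
    moreover have "0 \<le> (1/2 * (norm (c - z))\<^sup>2) *\<^sub>R L" using L by (intro scaleR_nonneg_nonneg) auto
    moreover have "Gfun g c s L \<le> 0" using that by (simp add: Gamma_model_def)
    ultimately show ?thesis by (metis add_increasing2 add.commute le_add_same_cancel1 order_trans)
  qed
  have "u *\<^sub>R (Gfun g z s L + T (a - z)) + v *\<^sub>R (Gfun g z s L + T (b - z)) \<le> 0"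
    using le[OF a] le[OF b] uv by (intro add_nonpos_nonpos) (auto simp: less_eq_vec_def mult_nonneg_nonpos)
  moreover have "u *\<^sub>R T (a - z) + v *\<^sub>R T (b - z) = T (u *\<^sub>R (a - z) + v *\<^sub>R (b - z))"
    by (simp only: T_def blinfun.add_right blinfun.scaleR_right inner_add_right inner_scaleR_right
        scaleR_add_right scaleR_add_left scaleR_scaleR add_ac)
  moreover have "u *\<^sub>R (a - z) + v *\<^sub>R (b - z) = z - (u + v) *\<^sub>R z"
    by (simp add: z_def algebra_simps)
  moreover have "T 0 = 0" by (simp add: T_def)
  moreover have "u *\<^sub>R Gfun g z s L + v *\<^sub>R Gfun g z s L = Gfun g z s L"
    using uv by (simp add: scaleR_add_left[symmetric])
  ultimately have "Gfun g z s L \<le> 0" using uv by (simp add: scaleR_add_right algebra_simps)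
  then show "u *\<^sub>R a + v *\<^sub>R b \<in> Gamma_model g s L" by (simp add: Gamma_model_def z_def)
qed

text \<open>With respect to the base point, the derivative of \<open>g s\<close> cancels against the
  one coming from \<open>x - s\<close>. What remains carries the factor \<open>x - s\<close>,
  through the second derivative and through \<open>L\<close>; this is why that part of the
  subgradient will be of the order of \<open>x - s\<close>.\<close>

lemma Gfun_joint_has_derivative:
  fixes g :: "real^'n \<Rightarrow> real^'m" and z :: "(real^'n) \<times> (real^'n) \<times> (real^'m) \<times> 'c::real_normed_vector"
  assumes g': "\<And>s. (g has_derivative blinfun_apply (g' s)) (at s)"
    and D: "(g' has_derivative D) (at (fst (snd z)))"
  shows "((\<lambda>z. Gfun g (fst z) (fst (snd z)) (fst (snd (snd z)))) has_derivative
    (\<lambda>d. blinfun_apply (g' (fst (snd z))) (fst d)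
       + ((fst z - fst (snd z)) \<bullet> fst d) *\<^sub>R fst (snd (snd z))
       + (blinfun_apply (D (fst (snd d))) (fst z - fst (snd z))
       - ((fst z - fst (snd z)) \<bullet> fst (snd d)) *\<^sub>R fst (snd (snd z)))
       + (1/2 * (norm (fst z - fst (snd z)))\<^sup>2) *\<^sub>R fst (snd (snd d)))) (at z)"
proof -
  have f: "((\<lambda>z :: (real^'n) \<times> (real^'n) \<times> (real^'m) \<times> 'c. fst (snd z)) has_derivative (\<lambda>d. fst (snd d))) (at z)"
    by (auto intro!: derivative_eq_intros)
  note D' = has_derivative_compose[OF f D]
  note G' = has_derivative_compose[OF f g']
  show ?thesis
    unfolding Gfun_eq[OF g'] power2_norm_eq_inner
    by (rule derivative_eq_intros D' G' bounded_bilinear.FDERIV[OF bounded_bilinear_blinfun_apply] | simp)+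
      (auto simp: fun_eq_iff inner_commute inner_diff_right inner_diff_left blinfun.diff_right algebra_simps add_divide_distrib diff_divide_distrib)
qed

section \<open>Subgradients of the potential\<close>

lemma Phi_eq_real:
  assumes "\<forall>i. 0 < L $ i" "Gfun g x s L \<le> 0" "f x = ereal r" "conjugate_fun \<psi> (- \<xi>) = ereal c"
  shows "Phi f \<phi> \<psi> g (x, s, L, \<xi>) = ereal (r + \<phi> x + x \<bullet> \<xi> + c)"
  using assms by (simp add: Phi_def indicator_fun_def)

text \<open>Fixing one \<open>y\<close> in the supremum replaces the conjugate by an affine
  minorant. It is exact where \<open>- \<xi>\<close> is a subgradient of \<open>\<psi>\<close> at
  \<open>y\<close>.\<close>

lemma Phi_ge_real:
  assumes "\<bar>f x\<bar> \<noteq> \<infinity>"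
  shows "ereal (real_of_ereal (f x) + \<phi> x + x \<bullet> \<xi> + ((- \<xi>) \<bullet> y - \<psi> y)) \<le> Phi f \<phi> \<psi> g (x, s, L, \<xi>)"
proof (cases "(\<forall>i. 0 < L $ i) \<and> Gfun g x s L \<le> 0")
  case True
  obtain r where r: "f x = ereal r" using assms by auto
  have "ereal (r + \<phi> x + x \<bullet> \<xi>) + ereal ((- \<xi>) \<bullet> y - \<psi> y)
      \<le> ereal (r + \<phi> x + x \<bullet> \<xi>) + conjugate_fun \<psi> (- \<xi>)"
    by (intro add_left_mono conjugate_ge)
  then show ?thesis using True r by (simp add: Phi_def indicator_fun_def)
next
  case False
  obtain r where r: "f x = ereal r" using assms by auto
  have "conjugate_fun \<psi> (- \<xi>) \<noteq> - \<infinity>"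
    using conjugate_ge[of "- \<xi>" 0 \<psi>] by auto
  then show ?thesis using False r by (auto simp: Phi_def indicator_fun_def)
qed

text \<open>The constraint enters only through \<open>lam \<bullet> G\<close>, which is nonpositive on the domain of the
  potential and vanishes at the base point; so adding it to the smooth part can only lower the
  values.\<close>

lemma Phi_regular_subgradient:
  fixes f :: "real^'n \<Rightarrow> ereal" and g :: "real^'n \<Rightarrow> real^'m"
  assumes g': "\<And>s. (g has_derivative blinfun_apply (g' s)) (at s)"
    and D: "(g' has_derivative D) (at s)"
    and f_deriv: "((\<lambda>x. real_of_ereal (f x)) has_derivative (\<lambda>d. a \<bullet> d)) (at x)"
    and f_fin: "open U" "x \<in> U" "\<And>x. x \<in> U \<Longrightarrow> \<bar>f x\<bar> \<noteq> \<infinity>"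
    and w: "w \<in> convex_subdiff \<phi> x" and xi: "- \<xi> \<in> convex_subdiff \<psi> s"
    and L: "\<forall>i. 0 < L $ i" and G: "Gfun g x s L \<le> 0"
    and lam: "0 \<le> lam" "lam \<bullet> Gfun g x s L = 0"
    and A: "\<And>d. A \<bullet> d = lam \<bullet> (blinfun_apply (g' s) d + ((x - s) \<bullet> d) *\<^sub>R L)"
    and B: "\<And>d. B \<bullet> d = lam \<bullet> (blinfun_apply (D d) (x - s) - ((x - s) \<bullet> d) *\<^sub>R L)"
  shows "(a + w + \<xi> + A, B, (1/2 * (norm (x - s))\<^sup>2) *\<^sub>R lam, x - s)
    \<in> regular_subdiff (Phi f \<phi> \<psi> g) (x, s, L, \<xi>)"
proof (rule regular_subdiffI)
  let ?z = "(x, s, L, \<xi>)"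
  let ?v = "(a + w + \<xi> + A, B, (1/2 * (norm (x - s))\<^sup>2) *\<^sub>R lam, x - s)"
  let ?u = "(a + \<xi> + A, B, (1/2 * (norm (x - s))\<^sup>2) *\<^sub>R lam, x - s)"
  obtain r where r: "f x = ereal r" using f_fin by auto
  have Phi_z: "Phi f \<phi> \<psi> g ?z = ereal (r + \<phi> x + x \<bullet> \<xi> + ((- \<xi>) \<bullet> s - \<psi> s))"
    by (intro Phi_eq_real conjugate_at_subgradient L G r xi)
  then show "\<bar>Phi f \<phi> \<psi> g ?z\<bar> \<noteq> \<infinity>" by simp
  \<comment> \<open>The differentiable part of a minorant of the potential that is exact at the base
    point: the conjugate is replaced by its affine minorant through \<open>s\<close>, and
    \<open>lam \<bullet> G\<close> stands for the constraint. The term \<open>\<phi>\<close> is left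
    to its subgradient \<open>w\<close>, so \<open>?u\<close> is \<open>?v\<close> without
    \<open>w\<close>.\<close>
  define S where "S y = real_of_ereal (f (fst y)) + fst y \<bullet> snd (snd (snd y)) - s \<bullet> snd (snd (snd y))
      + lam \<bullet> Gfun g (fst y) (fst (snd y)) (fst (snd (snd y)))"
    for y :: "(real^'n) \<times> (real^'n) \<times> (real^'m) \<times> (real^'n)"
  have fst_deriv: "((\<lambda>y :: (real^'n) \<times> (real^'n) \<times> (real^'m) \<times> (real^'n). fst y) has_derivative fst) (at ?z)"
    by (auto intro!: derivative_eq_intros)
  have f1: "((\<lambda>y :: (real^'n) \<times> (real^'n) \<times> (real^'m) \<times> (real^'n). real_of_ereal (f (fst y)))
      has_derivative (\<lambda>d. a \<bullet> fst d)) (at ?z)"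
    by (rule has_derivative_compose[OF fst_deriv]) (use f_deriv in simp)
  have D': "(g' has_derivative D) (at (fst (snd ?z)))" using D by simp
  have S_deriv: "(S has_derivative (\<lambda>d. ?u \<bullet> d)) (at ?z)"
    unfolding S_def
    by (rule derivative_eq_intros f1 Gfun_joint_has_derivative[OF g' D'] | simp)+
      (auto simp: fun_eq_iff inner_prod_def A B inner_add_left inner_add_right inner_diff_left
        inner_diff_right inner_commute)
  fix e :: real assume e: "0 < e"
  have "\<forall>\<^sub>F y in at ?z. S ?z + ?u \<bullet> (y - ?z) - e * norm (y - ?z) \<le> S y"
  proof -
    obtain \<delta> where \<delta>: "0 < \<delta>"
      "\<And>y. norm (y - ?z) < \<delta> \<Longrightarrow> norm (S y - S ?z - ?u \<bullet> (y - ?z)) \<le> e * norm (y - ?z)"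
      using S_deriv e unfolding has_derivative_at_alt by blast
    have "S ?z + ?u \<bullet> (y - ?z) - e * norm (y - ?z) \<le> S y" if "dist y ?z < \<delta>" for y
      using \<delta>(2)[of y] that unfolding dist_norm real_norm_def by linarith
    then show ?thesis using \<delta>(1) unfolding eventually_at by blast
  qed
  moreover have "\<forall>\<^sub>F y in at ?z. fst y \<in> U"
  proof -
    have "(fst \<longlongrightarrow> x) (at ?z)" using tendsto_fst[OF tendsto_ident_at, of ?z UNIV] by simp
    then show ?thesis using f_fin(1,2) by (rule topological_tendstoD)
  qed
  ultimately show "\<forall>\<^sub>F y in at ?z. Phi f \<phi> \<psi> g ?z + ereal (?v \<bullet> (y - ?z) - e * norm (y - ?z)) \<le> Phi f \<phi> \<psi> g y"
  proof eventually_elim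
    case (elim y)
    obtain y1 y2 y3 y4 where y: "y = (y1, y2, y3, y4)" by (metis prod.exhaust)
    show ?case
    proof (cases "(\<forall>i. 0 < y3 $ i) \<and> Gfun g y1 y2 y3 \<le> 0")
      case True
      have "lam \<bullet> Gfun g y1 y2 y3 \<le> 0"
        using True lam(1) unfolding inner_vec_def
        by (intro sum_nonpos) (auto simp: less_eq_vec_def mult_nonneg_nonpos)
      moreover have "S ?z = r + x \<bullet> \<xi> - s \<bullet> \<xi>" using r lam(2) by (simp add: S_def)
      moreover have "S y = real_of_ereal (f y1) + y1 \<bullet> y4 - s \<bullet> y4 + lam \<bullet> Gfun g y1 y2 y3"
        by (simp add: S_def y)
      moreover have "?v \<bullet> (y - ?z) = ?u \<bullet> (y - ?z) + w \<bullet> (y1 - x)"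
        by (simp add: y inner_prod_def inner_add_left)
      moreover have "\<phi> x + w \<bullet> (y1 - x) \<le> \<phi> y1" by (rule convex_subdiffD[OF w])
      ultimately have "r + \<phi> x + x \<bullet> \<xi> + ((- \<xi>) \<bullet> s - \<psi> s) + (?v \<bullet> (y - ?z) - e * norm (y - ?z))
          \<le> real_of_ereal (f y1) + \<phi> y1 + y1 \<bullet> y4 + ((- y4) \<bullet> s - \<psi> s)"
        using elim(1) by (simp add: inner_commute)
      then have "Phi f \<phi> \<psi> g ?z + ereal (?v \<bullet> (y - ?z) - e * norm (y - ?z))
          \<le> ereal (real_of_ereal (f y1) + \<phi> y1 + y1 \<bullet> y4 + ((- y4) \<bullet> s - \<psi> s))"
        unfolding Phi_z plus_ereal.simps(1) ereal_less_eq(3) .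
      also have "ereal (real_of_ereal (f y1) + \<phi> y1 + y1 \<bullet> y4 + ((- y4) \<bullet> s - \<psi> s)) \<le> Phi f \<phi> \<psi> g y"
        unfolding y by (rule Phi_ge_real) (use elim(2) f_fin(3) y in simp)
      finally show ?thesis .
    next
      case False
      \<comment> \<open>Outside the domain the potential must be infinite; this requires that no
        summand equals \<open>- \<infinity>\<close>.\<close>
      have "conjugate_fun \<psi> (- y4) \<noteq> - \<infinity>"
        using conjugate_ge[of "- y4" 0 \<psi>] by auto
      moreover have "\<bar>f y1\<bar> \<noteq> \<infinity>" using elim(2) f_fin(3) y by simp
      ultimately have "Phi f \<phi> \<psi> g y = \<infinity>" using False y by (auto simp: Phi_def indicator_fun_def)
      then show ?thesis by simp
    qed
  qed
qed

section \<open>Auxiliary facts on gradients, operators and cluster points\<close>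

lemma has_derivative_gradient:
  fixes h :: "'a::euclidean_space \<Rightarrow> real"
  assumes "(h has_derivative A) (at x)"
  shows "gradient h x \<bullet> d = A d" and "(h has_derivative (\<lambda>d. gradient h x \<bullet> d)) (at x)"
proof -
  have A: "A d = d \<bullet> adjoint A 1" for d
    using adjoint_works[OF has_derivative_linear[OF assms], of d 1] by simp
  then have "GDERIV h x :> adjoint A 1" using assms unfolding gderiv_def by (simp add: A[symmetric])
  moreover have "D = D'" if "GDERIV h x :> D" "GDERIV h x :> D'" for D D'
  proof -
    have "(\<lambda>d. d \<bullet> D) = (\<lambda>d. d \<bullet> D')"
      using that unfolding gderiv_def by (rule has_derivative_unique)
    then show ?thesis by (metis inner_commute vector_eq_ldot)
  qed
  ultimately have "gradient h x = adjoint A 1" unfolding gradient_def by (metis the_equality)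
  then show *: "gradient h x \<bullet> d = A d" for d by (simp add: A[of d] inner_commute)
  show "(h has_derivative (\<lambda>d. gradient h x \<bullet> d)) (at x)" using assms by (simp add: *)
qed

text \<open>Bounds a vector known only through its inner products, by testing it with itself. The
  alternative \<open>u = 0\<close> remains because \<open>C\<close> may be negative.\<close>

lemma norm_le_of_inner_self:
  fixes u :: "'a::real_inner"
  assumes "u \<bullet> u \<le> C * norm u"
  shows "norm u \<le> C \<or> u = 0"
  using assms by (cases "u = 0") (auto simp: dot_square_norm power2_eq_square)

text \<open>A bound on the form of a positive semidefinite operator bounds its norm, by polarization
  against the image of \<open>d\<close> rescaled to the length of \<open>d\<close>.\<close>

lemma self_adjoint_norm_le:
  fixes Q :: "'a::real_inner \<Rightarrow>\<^sub>L 'a"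
  assumes Q: "self_adjoint Q" and lo: "\<And>d. 0 \<le> d \<bullet> blinfun_apply Q d"
    and hi: "\<And>d. d \<bullet> blinfun_apply Q d \<le> c * (norm d)\<^sup>2"
  shows "norm (blinfun_apply Q d) \<le> c * norm d"
proof (cases "blinfun_apply Q d = 0")
  case True
  have "0 \<le> c * (norm d)\<^sup>2" using lo hi order_trans by blast
  then show ?thesis using True by (cases "d = 0") (auto simp: zero_le_mult_iff)
next
  case False
  define e where "e = (norm d / norm (blinfun_apply Q d)) *\<^sub>R blinfun_apply Q d"
  have ne: "norm e = norm d" using False by (simp add: e_def)
  have sym: "e \<bullet> blinfun_apply Q d = d \<bullet> blinfun_apply Q e"
    using Q by (simp add: self_adjoint_def inner_commute)
  have "4 * (e \<bullet> blinfun_apply Q d)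
      = (e + d) \<bullet> blinfun_apply Q (e + d) - (e - d) \<bullet> blinfun_apply Q (e - d)"
    using sym by (simp add: blinfun.add_right blinfun.diff_right inner_add_left inner_add_right
        inner_diff_left inner_diff_right)
  also have "\<dots> \<le> c * (norm (e + d))\<^sup>2" using lo[of "e - d"] hi[of "e + d"] by linarith
  also have "\<dots> \<le> c * (2 * norm d)\<^sup>2"
  proof -
    have "norm (e + d) \<le> 2 * norm d" using norm_triangle_ineq[of e d] ne by simp
    moreover have "0 \<le> c"
    proof -
      have "d \<noteq> 0" using False by auto
      moreover have "0 \<le> c * (norm d)\<^sup>2" using lo hi order_trans by blast
      ultimately show ?thesis by (simp add: zero_le_mult_iff)
    qed
    ultimately show ?thesis by (intro mult_left_mono power_mono) auto
  qed
  finally have "e \<bullet> blinfun_apply Q d \<le> c * (norm d)\<^sup>2" by (simp add: power2_eq_square)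
  moreover have "e \<bullet> blinfun_apply Q d = norm d * norm (blinfun_apply Q d)"
    using False by (simp add: e_def dot_square_norm power2_eq_square)
  ultimately have "norm d * norm (blinfun_apply Q d) \<le> norm d * (c * norm d)"
    by (simp add: power2_eq_square mult_ac)
  moreover have "d \<noteq> 0" using False by auto
  ultimately show ?thesis by simp
qed

lemma theta_expand:
  assumes "self_adjoint Q"
  shows "theta_model f \<psi> s \<xi> Q z = theta_model f \<psi> s \<xi> Q y
    + (gradient (\<lambda>x'. real_of_ereal (f x')) s + \<xi> + blinfun_apply Q (y - s)) \<bullet> (z - y)
    + 1/2 * ((z - y) \<bullet> blinfun_apply Q (z - y))"
proof -
  have eq: "z - s = (z - y) + (y - s)" by simp
  have sym: "(y - s) \<bullet> blinfun_apply Q (z - y) = (z - y) \<bullet> blinfun_apply Q (y - s)"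
    using assms by (simp add: self_adjoint_def inner_commute)
  have "(z - s) \<bullet> blinfun_apply Q (z - s) = (z - y) \<bullet> blinfun_apply Q (z - y)
      + 2 * (blinfun_apply Q (y - s) \<bullet> (z - y)) + (y - s) \<bullet> blinfun_apply Q (y - s)"
    unfolding eq blinfun.add_right inner_add_left inner_add_right sym
    by (simp add: inner_commute)
  moreover have "(gradient (\<lambda>x'. real_of_ereal (f x')) s + \<xi>) \<bullet> (z - s)
      = (gradient (\<lambda>x'. real_of_ereal (f x')) s + \<xi>) \<bullet> (z - y)
      + (gradient (\<lambda>x'. real_of_ereal (f x')) s + \<xi>) \<bullet> (y - s)"
    unfolding eq inner_add_right ..
  ultimately show ?thesis unfolding theta_model_def by (simp add: inner_add_left)
qed

lemma theta_self [simp]: "theta_model f \<psi> s \<xi> Q s = real_of_ereal (f s) - \<psi> s"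
  by (simp add: theta_model_def)

text \<open>Compactness in sequential form: if no constant worked eventually, indices violating ever
  larger constants would accumulate at a cluster point, near which one constant does work. It serves
  for the multiplier bound and for the KL inequality.\<close>

lemma bounded_cluster_uniform:
  fixes p :: "nat \<Rightarrow> 'a::heine_borel" and P :: "nat \<Rightarrow> real \<Rightarrow> bool"
  assumes p: "bounded (range p)"
    and mono: "\<And>k c c'. P k c \<Longrightarrow> c \<le> c' \<Longrightarrow> P k c'"
    and cluster: "\<And>l. l \<in> cluster_points p \<Longrightarrow>
      \<exists>c U N. open U \<and> l \<in> U \<and> (\<forall>k\<ge>N. p k \<in> U \<longrightarrow> P k c)"
  shows "\<exists>c>0. \<forall>\<^sub>F k in sequentially. P k c"
proof (rule ccontr)
  assume contr: "\<not> ?thesis"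
  have bad: "\<exists>k>m. \<not> P k (real n + 1)" for m n
  proof (rule ccontr)
    assume "\<not> ?thesis"
    then have "\<forall>\<^sub>F k in sequentially. P k (real n + 1)"
      unfolding eventually_sequentially by (intro exI[of _ "Suc m"]) auto
    then show False using contr by (metis of_nat_0_le_iff add_nonneg_pos zero_less_one)
  qed
  have "\<exists>r. \<forall>n. \<not> P (r n) (real n + 1) \<and> r n < r (Suc n)"
  proof (rule dependent_nat_choice)
    show "\<exists>k. \<not> P k (real 0 + 1)" using bad[of 0 0] by blast
    show "\<exists>k'. \<not> P k' (real (Suc n) + 1) \<and> k < k'" if "\<not> P k (real n + 1)" for k n
      using bad[of k "Suc n"] by blast
  qed
  then obtain r where r: "\<And>n. \<not> P (r n) (real n + 1)" "\<And>n. r n < r (Suc n)" by blast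
  have r_mono: "strict_mono r" using r(2) by (simp add: strict_mono_Suc_iff)
  have "bounded (range (p \<circ> r))" using p by (rule bounded_subset) auto
  then obtain l r' where l: "strict_mono r'" "((p \<circ> r) \<circ> r') \<longlonglongrightarrow> l"
    using bounded_imp_convergent_subsequence by blast
  have rr: "strict_mono (r \<circ> r')" using r_mono l(1) by (rule strict_mono_o)
  have "l \<in> cluster_points p"
    unfolding cluster_points_def using rr l(2) by (auto simp: o_assoc)
  then obtain c U N where U: "open U" "l \<in> U" "\<And>k. N \<le> k \<Longrightarrow> p k \<in> U \<Longrightarrow> P k c"
    using cluster[of l] by fast
  obtain N1 where N1: "\<And>n. N1 \<le> n \<Longrightarrow> p (r (r' n)) \<in> U"
    using topological_tendstoD[OF l(2) U(1,2)] unfolding eventually_sequentially by auto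
  obtain N2 where N2: "c \<le> real N2" using real_arch_simple by blast
  \<comment> \<open>Beyond all three thresholds; as \<open>r' n \<ge> n\<close>, the constant
    violated at this index also exceeds \<open>c\<close>.\<close>
  define n where "n = max N (max N1 N2)"
  have "n \<le> r' n" "n \<le> (r \<circ> r') n" using seq_suble[OF l(1)] seq_suble[OF rr] by blast+
  then have "P (r (r' n)) c" using U(3) N1 by (simp add: n_def)
  then have "P (r (r' n)) (real (r' n) + 1)"
    by (rule mono) (use N2 \<open>n \<le> r' n\<close> in \<open>simp add: n_def\<close>)
  then show False using r(1) by blast
qed

section \<open>Bounds along a run\<close>

context DC_problem
begin

text \<open>The objective without its indicator. All iterates are feasible, so the estimates can be
  carried out in the reals.\<close>

definition Fr :: "real^'n \<Rightarrow> real" where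
  "Fr z = real_of_ereal (f z) + \<phi> z - \<psi> z"

abbreviation gradf :: "real^'n \<Rightarrow> real^'n" where
  "gradf \<equiv> gradient (\<lambda>z. real_of_ereal (f z))"

lemma objective_feasible: "z \<in> feasible g \<Longrightarrow> objective f \<phi> \<psi> g z = ereal (Fr z)"
proof -
  assume z: "z \<in> feasible g"
  then have "z \<in> \<O>" using feasible_subset by blast
  then have "\<bar>f z\<bar> \<noteq> \<infinity>" by (rule bspec[OF f_finite])
  then obtain r where "f z = ereal r" by auto
  then show ?thesis using z by (simp add: objective_def Fr_def indicator_fun_def feasible_def)
qed

lemma Fr_bounded_below: "\<exists>m. \<forall>z\<in>feasible g. m \<le> Fr z"
proof -
  define I where "I = (INF z\<in>feasible g. objective f \<phi> \<psi> g z)"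
  have I: "I \<le> ereal (Fr z)" if "z \<in> feasible g" for z
    using INF_lower[OF that, of "objective f \<phi> \<psi> g"] objective_feasible[OF that] by (simp add: I_def)
  have "I \<noteq> - \<infinity>" using bounded_below by (simp add: I_def)
  moreover have "I \<noteq> \<infinity>" using feasible_nonempty I by auto
  ultimately obtain m where "I = ereal m" by (cases I) auto
  then show ?thesis using I by auto
qed

lemma feasible_closed: "closed (feasible g)"
proof -
  obtain g' where "\<And>z. (g has_derivative blinfun_apply (g' z)) (at z)"
    using g_C11 unfolding C11_on_def by blast
  then have "continuous_on UNIV g"
    by (meson continuous_at_imp_continuous_on has_derivative_continuous)
  then have "closed {z. g z $ i \<le> 0}" for i
    by (intro closed_Collect_le continuous_intros)
  then have "closed (\<Inter>i. {z. g z $ i \<le> 0})" by (intro closed_INT) auto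
  moreover have "feasible g = (\<Inter>i. {z. g z $ i \<le> 0})"
    by (auto simp: feasible_def less_eq_vec_def)
  ultimately show ?thesis by simp
qed

lemma f_bounds:
  assumes "compact K" "convex K" "K \<subseteq> \<O>"
  shows "\<exists>C>0. (\<forall>z\<in>K. norm (gradf z) \<le> C)
    \<and> (\<forall>y\<in>K. \<forall>z\<in>K. norm (gradf y - gradf z) \<le> C * norm (y - z))
    \<and> (\<forall>y\<in>K. \<forall>z\<in>K. \<bar>real_of_ereal (f y) - real_of_ereal (f z) - gradf z \<bullet> (y - z)\<bar> \<le> C * (norm (y - z))\<^sup>2)"
proof -
  obtain f' C where f': "0 < C"
    "\<And>z. z \<in> \<O> \<Longrightarrow> ((\<lambda>z. real_of_ereal (f z)) has_derivative blinfun_apply (f' z)) (at z)"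
    "C-lipschitz_on K f'" "\<And>z. z \<in> K \<Longrightarrow> norm (f' z) \<le> C"
    "\<And>z y. z \<in> K \<Longrightarrow> y \<in> K \<Longrightarrow> norm (real_of_ereal (f y) - real_of_ereal (f z)
      - blinfun_apply (f' z) (y - z)) \<le> C * (norm (y - z))\<^sup>2"
    using C11_on_compact_bounds[OF f_C11 assms] by metis
  have grad: "gradf z \<bullet> d = blinfun_apply (f' z) d" if "z \<in> K" for z d
    using has_derivative_gradient(1)[OF f'(2)] that assms(3) by blast
  have "norm (gradf z) \<le> C" if "z \<in> K" for z
  proof -
    have "gradf z \<bullet> gradf z \<le> norm (f' z) * norm (gradf z)"
      using norm_blinfun[of "f' z" "gradf z"] grad[OF that, of "gradf z"] by simp
    also have "\<dots> \<le> C * norm (gradf z)" using f'(4)[OF that] by (intro mult_right_mono) auto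
    finally show ?thesis using norm_le_of_inner_self f'(1) by force
  qed
  moreover have "norm (gradf y - gradf z) \<le> C * norm (y - z)" if "y \<in> K" "z \<in> K" for y z
  proof -
    have "(gradf y - gradf z) \<bullet> (gradf y - gradf z) = blinfun_apply (f' y - f' z) (gradf y - gradf z)"
      using that by (simp add: inner_diff_left[of _ _ "gradf y - gradf z"] grad blinfun.diff_left)
    also have "\<dots> \<le> norm (f' y - f' z) * norm (gradf y - gradf z)"
      using norm_blinfun[of "f' y - f' z" "gradf y - gradf z"] by simp
    also have "\<dots> \<le> (C * norm (y - z)) * norm (gradf y - gradf z)"
      using lipschitz_on_normD[OF f'(3) that] by (intro mult_right_mono) auto
    finally show ?thesis using norm_le_of_inner_self f'(1) by force
  qed
  moreover have "\<bar>real_of_ereal (f y) - real_of_ereal (f z) - gradf z \<bullet> (y - z)\<bar> \<le> C * (norm (y - z))\<^sup>2"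
    if "y \<in> K" "z \<in> K" for y z
    using f'(5)[OF that(2,1)] grad[OF that(2)] by simp
  ultimately show ?thesis using f'(1) by blast
qed

end

section \<open>Boundedness of the iterates and of the backtracking parameters\<close>

locale bounded_MBA = inexact_MBA f \<phi> \<psi> g
  for f :: "real^'n \<Rightarrow> ereal" and \<phi> \<psi> :: "real^'n \<Rightarrow> real" and g :: "real^'n \<Rightarrow> real^'m" +
  assumes x_bounded: "bounded (range x)"
begin

abbreviation Fm :: "nat \<Rightarrow> nat \<Rightarrow> real^'n \<Rightarrow> real" where
  "Fm k j \<equiv> F_model f \<phi> \<psi> (x k) (\<xi> k) (Q k j)"

lemma x_feasible: "x k \<in> feasible g"
proof (cases k)
  case 0
  then show ?thesis using x0 by simp
next
  case (Suc n)
  then show ?thesis using inner_stop[of n] outer_step[of n] by (simp add: accepted_def feasible_def)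
qed

lemma x_bound: "\<exists>R>0. \<forall>k. norm (x k) \<le> R"
proof -
  obtain B where "\<forall>z\<in>range x. norm z \<le> B" using x_bounded unfolding bounded_iff by blast
  then show ?thesis by (intro exI[of _ "\<bar>B\<bar> + 1"]) (auto intro: order_trans[of _ B])
qed

lemma neg_xi_subgradient: "- \<xi> k \<in> convex_subdiff \<psi> (x k)"
  by (rule limiting_subdiff_neg_convex[OF \<psi>_convex xi])

lemma xi_bound: "\<exists>B>0. \<forall>k. norm (\<xi> k) \<le> B"
proof -
  obtain R where R: "\<And>k. norm (x k) \<le> R" using x_bound by blast
  obtain B where B: "0 < B" "\<And>z w. norm z \<le> R \<Longrightarrow> w \<in> convex_subdiff \<psi> z \<Longrightarrow> norm w \<le> B"
    using convex_subdiff_bounded[OF \<psi>_convex] by blast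
  have "norm (\<xi> k) \<le> B" for k using B(2)[OF R neg_xi_subgradient[of k]] by simp
  then show ?thesis using B(1) by blast
qed

text \<open>Taylor estimates need a compact convex set inside \<open>\<O>\<close> that also covers
  points near the iterates, since \<open>xbar\<close> may be infeasible. The feasible set need not
  be convex, but the hull of its bounded part stays in \<open>\<O>\<close>; adding a small ball
  preserves compactness and convexity.\<close>

lemma compact_nbhd:
  "\<exists>K e. compact K \<and> convex K \<and> K \<subseteq> \<O> \<and> 0 < e \<and>
    (\<forall>z\<in>feasible g. \<forall>z'. norm z \<le> R \<longrightarrow> norm (z' - z) \<le> e \<longrightarrow> z' \<in> K)"
proof -
  define H where "H = convex hull (feasible g \<inter> cball 0 R)"
  have H: "compact H" "convex H"
    unfolding H_def using feasible_closed
    by (auto intro!: compact_convex_hull closed_Int_compact convex_convex_hull)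
  have HO: "H \<subseteq> \<O>"
    unfolding H_def using feasible_subset \<O>_convex by (intro hull_minimal) auto
  obtain e where e: "0 < e" "(\<Union>z\<in>H. cball z e) \<subseteq> \<O>"
    using compact_subset_open_imp_cball_epsilon_subset[OF H(1) \<O>_open HO] by blast
  define K where "K = (\<Union>z\<in>H. \<Union>d\<in>cball 0 e. {z + d})"
  have "compact K" unfolding K_def by (intro compact_sums' H compact_cball)
  moreover have "convex K" unfolding K_def by (intro convex_sums H convex_cball)
  moreover have "K \<subseteq> \<O>"
  proof
    fix z assume "z \<in> K"
    then obtain u d where "u \<in> H" "norm d \<le> e" "z = u + d" by (auto simp: K_def)
    then have "z \<in> cball u e" by (simp add: dist_norm)
    then show "z \<in> \<O>" using e(2) \<open>u \<in> H\<close> by blast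
  qed
  moreover have "z' \<in> K" if "z \<in> feasible g" "norm z \<le> R" "norm (z' - z) \<le> e" for z z'
  proof -
    have "z \<in> H" unfolding H_def using that by (intro hull_inc) simp
    then show ?thesis unfolding K_def using that(3) by (intro UN_I[of z] UN_I[of "z' - z"]) auto
  qed
  ultimately show ?thesis using e(1) by blast
qed

lemma x_f_bounds:
  "\<exists>K C e. compact K \<and> K \<subseteq> \<O> \<and> 0 < C \<and> 0 < e
    \<and> (\<forall>z\<in>feasible g. \<forall>z'. norm z \<le> R \<longrightarrow> norm (z' - z) \<le> e \<longrightarrow> z' \<in> K)
    \<and> (\<forall>z\<in>K. norm (gradf z) \<le> C)
    \<and> (\<forall>y\<in>K. \<forall>z\<in>K. norm (gradf y - gradf z) \<le> C * norm (y - z))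
    \<and> (\<forall>y\<in>K. \<forall>z\<in>K. \<bar>real_of_ereal (f y) - real_of_ereal (f z) - gradf z \<bullet> (y - z)\<bar> \<le> C * (norm (y - z))\<^sup>2)"
proof -
  obtain K e where K: "compact K" "convex K" "K \<subseteq> \<O>" "0 < e"
    "\<forall>z\<in>feasible g. \<forall>z'. norm z \<le> R \<longrightarrow> norm (z' - z) \<le> e \<longrightarrow> z' \<in> K"
    using compact_nbhd[of R] by blast
  from f_bounds[OF K(1-3)] K show ?thesis by blast
qed

lemma gradf_bound: "\<exists>B>0. \<forall>k. norm (gradf (x k)) \<le> B"
proof -
  obtain R where R: "\<And>k. norm (x k) \<le> R" using x_bound by blast
  obtain K e C where K: "0 < (C::real)" "0 < (e::real)" "\<forall>z\<in>feasible g. \<forall>z'. norm z \<le> R \<longrightarrow> norm (z' - z) \<le> e \<longrightarrow> z' \<in> K"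
    "\<forall>z\<in>K. norm (gradf z) \<le> C"
    using x_f_bounds[of R] by blast
  have "x k \<in> K" for k using K(2) x_feasible[of k] R[of k] by (intro K(3)[rule_format, of "x k"]) auto
  then show ?thesis using K(1,4) by blast
qed

lemma mu_L_positive:
  assumes "j \<le> jk k"
  shows "\<mu>min \<le> \<mu> k j \<and> (\<forall>i. Lmin \<le> L k j $ i)"
  using assms
proof (induction j)
  case 0
  then show ?case using mu_init[of k] L_init[of k] by simp
next
  case (Suc j)
  then have IH: "\<mu>min \<le> \<mu> k j" "\<And>i. Lmin \<le> L k j $ i" and j: "j < jk k" by auto
  have le: "a \<le> \<tau> * b" if "0 < a" "a \<le> b" for a b
    using that tau mult_mono[of 1 \<tau> a b] by simp
  show ?case
  proof (cases "g (y k j) \<le> 0")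
    case True
    then show ?thesis using update_feasible[OF j True] IH le[OF mu_bounds(1) IH(1)] by simp
  next
    case False
    then show ?thesis using update_infeasible[OF j False] IH le[OF L_bounds(1) IH(2)] by simp
  qed
qed

lemma L_nonneg: "j \<le> jk k \<Longrightarrow> 0 \<le> L k j"
  using mu_L_positive[of j k] L_bounds(1) by (auto simp: less_eq_vec_def intro: order_trans[of _ Lmin])

lemma Q_ge: "j \<le> jk k \<Longrightarrow> \<mu> k j * (norm d)\<^sup>2 \<le> d \<bullet> blinfun_apply (Q k j) d"
  using Q_lower[of j k] by (simp add: loewner_le_def blinfun.scaleR_left power2_norm_eq_inner)

lemma Q_ge_min: "j \<le> jk k \<Longrightarrow> \<mu>min * (norm d)\<^sup>2 \<le> d \<bullet> blinfun_apply (Q k j) d"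
  using Q_ge[of j k d] mu_L_positive[of j k] mult_right_mono[of \<mu>min "\<mu> k j" "(norm d)\<^sup>2"] by simp

lemma model_expand:
  assumes "j \<le> jk k"
  shows "Fm k j z = Fm k j u + (gradf (x k) + \<xi> k + blinfun_apply (Q k j) (u - x k)) \<bullet> (z - u)
    + 1/2 * ((z - u) \<bullet> blinfun_apply (Q k j) (z - u)) + \<phi> z - \<phi> u"
  unfolding F_model_def using theta_expand[OF Q_self_adjoint[OF assms], of f \<psi> "x k" "\<xi> k" z u] by simp

lemma model_self: "Fm k j (x k) = Fr (x k)"
  by (simp add: F_model_def Fr_def)

text \<open>All models share the strong convexity constant \<open>\<mu>min\<close>, while the
  remaining terms fall at most linearly, at a rate uniform in \<open>k\<close>. Both
  \<open>y\<close> and \<open>xbar\<close> lie in the sublevel set of \<open>x k\<close>.\<close>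

lemma sublevel_bounded:
  "\<exists>\<rho>>0. \<forall>k j z. j \<le> jk k \<longrightarrow> Fm k j z \<le> Fm k j (x k) \<longrightarrow> norm (z - x k) \<le> \<rho>"
proof -
  obtain R where R: "\<And>k. norm (x k) \<le> R" using x_bound by blast
  obtain B1 where B1: "0 < B1" "\<And>k. norm (gradf (x k)) \<le> B1" using gradf_bound by blast
  obtain B2 where B2: "0 < B2" "\<And>k. norm (\<xi> k) \<le> B2" using xi_bound by blast
  obtain B3 where B3: "0 < B3" "\<And>u z. norm u \<le> R \<Longrightarrow> \<phi> u - B3 * norm (z - u) \<le> \<phi> z"
    using convex_lower_lipschitz[OF \<phi>_convex] by blast
  define \<rho> where "\<rho> = 2 * (B1 + B2 + B3) / \<mu>min"
  have "norm (z - x k) \<le> \<rho>" if j: "j \<le> jk k" and z: "Fm k j z \<le> Fm k j (x k)" for k j z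
  proof (cases "z = x k")
    case True
    then show ?thesis using B1 B2 B3 mu_bounds(1) by (simp add: \<rho>_def)
  next
    case False
    define n where "n = norm (z - x k)"
    have n: "0 < n" using False by (simp add: n_def)
    have "\<bar>(gradf (x k) + \<xi> k) \<bullet> (z - x k)\<bar> \<le> norm (gradf (x k) + \<xi> k) * n"
      unfolding n_def by (rule Cauchy_Schwarz_ineq2)
    also have "\<dots> \<le> (B1 + B2) * n"
      using norm_triangle_ineq[of "gradf (x k)" "\<xi> k"] B1(2)[of k] B2(2)[of k] n
      by (intro mult_right_mono) auto
    finally have "- ((B1 + B2) * n) \<le> (gradf (x k) + \<xi> k) \<bullet> (z - x k)" by linarith
    moreover have "\<phi> (x k) - B3 * n \<le> \<phi> z" unfolding n_def by (rule B3(2)[OF R])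
    moreover have "\<mu>min * n\<^sup>2 \<le> (z - x k) \<bullet> blinfun_apply (Q k j) (z - x k)"
      unfolding n_def by (rule Q_ge_min[OF j])
    ultimately have "1/2 * (\<mu>min * n\<^sup>2) \<le> (B1 + B2) * n + B3 * n"
      using z model_expand[OF j, of z "x k"] by (simp add: blinfun.zero_right)
    then have "n * (\<mu>min * n) \<le> n * (2 * (B1 + B2 + B3))" by (simp add: power2_eq_square algebra_simps)
    then have "\<mu>min * n \<le> 2 * (B1 + B2 + B3)" using n by simp
    then show ?thesis using mu_bounds(1) by (simp add: \<rho>_def n_def pos_le_divide_eq mult.commute)
  qed
  moreover have "0 < \<rho>" using B1 B2 B3 mu_bounds(1) by (simp add: \<rho>_def)
  ultimately show ?thesis by blast
qed

lemma x_in_model: "x k \<in> Gamma_model g (x k) (L k j)"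
proof -
  obtain g' where "\<And>z. (g has_derivative blinfun_apply (g' z)) (at z)"
    using g_C11 unfolding C11_on_def by blast
  then have "Gfun g (x k) (x k) (L k j) = g (x k)" by (subst Gfun_eq) (auto simp: blinfun.zero_right)
  then show ?thesis using x_feasible[of k] by (simp add: Gamma_model_def feasible_def)
qed

lemma xbar_model_le: "j \<le> jk k \<Longrightarrow> z \<in> Gamma_model g (x k) (L k j) \<Longrightarrow> Fm k j (xbar k j) \<le> Fm k j z"
  using xbar[of j k] by (auto simp: is_arg_min_linorder)

lemma xbar_in_model: "j \<le> jk k \<Longrightarrow> xbar k j \<in> Gamma_model g (x k) (L k j)"
  using xbar[of j k] by (auto simp: is_arg_min_linorder)

lemma y_xbar_bounded:
  "\<exists>R>0. \<forall>k j. j \<le> jk k \<longrightarrow> norm (x k) \<le> R \<and> norm (y k j) \<le> R \<and> norm (xbar k j) \<le> R"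
proof -
  obtain R where R: "0 < R" "\<And>k. norm (x k) \<le> R" using x_bound by blast
  obtain \<rho> where \<rho>: "0 < \<rho>" "\<And>k j z. j \<le> jk k \<Longrightarrow> Fm k j z \<le> Fm k j (x k) \<Longrightarrow> norm (z - x k) \<le> \<rho>"
    using sublevel_bounded by blast
  have "norm z \<le> R + \<rho>" if "norm (z - x k) \<le> \<rho>" for z k
    using norm_triangle_ineq[of "x k" "z - x k"] that R(2)[of k] by simp
  then have "norm (x k) \<le> R + \<rho> \<and> norm (y k j) \<le> R + \<rho> \<and> norm (xbar k j) \<le> R + \<rho>" if "j \<le> jk k" for k j
    using \<rho>(2)[OF that model_decrease[OF that]] \<rho>(2)[OF that xbar_model_le[OF that x_in_model]]
      R(2)[of k] \<rho>(1) by auto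
  then show ?thesis using R(1) \<rho>(1) by (intro exI[of _ "R + \<rho>"]) auto
qed

lemma residual_bound:
  assumes "j \<le> jk k"
  shows "infnorm (pos_part (Gfun g (y k j) (x k) (L k j))) \<le> \<beta>R / 2 * (norm (y k j - x k))\<^sup>2"
  using residual[OF assms] unfolding KKT_residual_def Let_def by (smt (verit) norm_ge_zero)

lemma g_bounds:
  "\<exists>C>0. \<forall>y z. norm y \<le> R \<longrightarrow> norm z \<le> R \<longrightarrow>
    norm (g y - g z - frechet_derivative g (at z) (y - z)) \<le> C * (norm (y - z))\<^sup>2"
proof -
  obtain g' C where g': "0 < C" "\<And>z. z \<in> UNIV \<Longrightarrow> (g has_derivative blinfun_apply (g' z)) (at z)"
    "\<And>z y. z \<in> cball 0 R \<Longrightarrow> y \<in> cball 0 R \<Longrightarrow>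
      norm (g y - g z - blinfun_apply (g' z) (y - z)) \<le> C * (norm (y - z))\<^sup>2"
    using C11_on_compact_bounds[OF g_C11, of "cball 0 R"] by (metis compact_cball convex_cball subset_UNIV)
  have "frechet_derivative g (at z) = blinfun_apply (g' z)" for z
    using frechet_derivative_at[OF g'(2)] by simp
  then show ?thesis using g'(1,3) by (intro exI[of _ C]) auto
qed

text \<open>The threshold \<open>\<beta>R + 2 * C\<close> makes the quadratic term of the model
  cover the Taylor error of \<open>g\<close> as well as the constraint violation tolerated by the
  residual test.\<close>

lemma y_feasible_large_L:
  "\<exists>c>0. \<forall>k j. j \<le> jk k \<longrightarrow> (\<forall>i. c \<le> L k j $ i) \<longrightarrow> g (y k j) \<le> 0"
proof -
  obtain R where R: "\<And>k j. j \<le> jk k \<Longrightarrow> norm (x k) \<le> R \<and> norm (y k j) \<le> R"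
    using y_xbar_bounded by blast
  obtain C where C: "0 < C" "\<And>y z. norm y \<le> R \<Longrightarrow> norm z \<le> R \<Longrightarrow>
      norm (g y - g z - frechet_derivative g (at z) (y - z)) \<le> C * (norm (y - z))\<^sup>2"
    using g_bounds by blast
  have "g (y k j) \<le> 0" if j: "j \<le> jk k" and L: "\<And>i. \<beta>R + 2 * C \<le> L k j $ i" for k j
  proof -
    have "g (y k j) $ i \<le> 0" for i
    proof -
      define n where "n = (norm (y k j - x k))\<^sup>2"
      let ?e = "g (y k j) - g (x k) - frechet_derivative g (at (x k)) (y k j - x k)"
      let ?G = "Gfun g (y k j) (x k) (L k j)"
      have "\<bar>?e $ i\<bar> \<le> C * n"
        using component_le_norm_cart[of ?e i] C(2)[of "y k j" "x k"] R[OF j] by (simp add: n_def)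
      moreover have "?G $ i \<le> \<beta>R / 2 * n"
      proof -
        have "?G $ i \<le> pos_part ?G $ i" by (simp add: pos_part_def)
        also have "\<dots> \<le> infnorm (pos_part ?G)"
          using component_le_infnorm_cart[of "pos_part ?G" i] by simp
        also have "\<dots> \<le> \<beta>R / 2 * n" unfolding n_def by (rule residual_bound[OF j])
        finally show ?thesis .
      qed
      moreover have "?G $ i = (g (x k) + frechet_derivative g (at (x k)) (y k j - x k)) $ i + 1/2 * n * L k j $ i"
        by (simp add: Gfun_def n_def)
      moreover have "1/2 * n * (\<beta>R + 2 * C) \<le> 1/2 * n * L k j $ i"
        by (intro mult_left_mono L) (simp add: n_def)
      ultimately show ?thesis by (simp add: algebra_simps)
    qed
    then show ?thesis by (simp add: less_eq_vec_def)
  qed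
  then show ?thesis using C(1) params_pos by (intro exI[of _ "\<beta>R + 2 * C"]) auto
qed

text \<open>The model decreases at \<open>y\<close>; \<open>- \<psi>\<close> lies below its
  linearization, and the Taylor error of \<open>f\<close> is at most \<open>C\<close> times the
  squared step. A quadratic form of modulus \<open>2 * C + \<alpha>\<close> covers this error and
  leaves the required decrease.\<close>

lemma accepted_large_mu:
  "\<exists>c>0. \<forall>k j. j \<le> jk k \<longrightarrow> g (y k j) \<le> 0 \<longrightarrow> c \<le> \<mu> k j \<longrightarrow> accepted f \<phi> \<psi> g \<alpha> (x k) (y k j)"
proof -
  obtain R where R: "\<And>k j. j \<le> jk k \<Longrightarrow> norm (x k) \<le> R \<and> norm (y k j) \<le> R"
    using y_xbar_bounded by blast
  obtain K e C where K: "0 < C" "0 < e" "\<forall>z\<in>feasible g. \<forall>z'. norm z \<le> R \<longrightarrow> norm (z' - z) \<le> e \<longrightarrow> z' \<in> K"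
    "\<forall>y\<in>K. \<forall>z\<in>K. \<bar>real_of_ereal (f y) - real_of_ereal (f z) - gradf z \<bullet> (y - z)\<bar> \<le> C * (norm (y - z))\<^sup>2"
    using x_f_bounds[of R] by blast
  have "accepted f \<phi> \<psi> g \<alpha> (x k) (y k j)"
    if j: "j \<le> jk k" and g: "g (y k j) \<le> 0" and mu: "2 * C + \<alpha> \<le> \<mu> k j" for k j
  proof -
    define d where "d = y k j - x k"
    have yf: "y k j \<in> feasible g" using g by (simp add: feasible_def)
    \<comment> \<open>Both points are feasible and bounded, so both lie in \<open>K\<close> however
      far apart they are.\<close>
    have "y k j \<in> K" "x k \<in> K" using K(2,3) yf x_feasible R[OF j] by auto
    then have "\<bar>real_of_ereal (f (y k j)) - real_of_ereal (f (x k)) - gradf (x k) \<bullet> d\<bar> \<le> C * (norm d)\<^sup>2"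
      unfolding d_def using K(4) by blast
    moreover have "\<psi> (x k) + (- \<xi> k) \<bullet> d \<le> \<psi> (y k j)"
      unfolding d_def by (rule convex_subdiffD[OF neg_xi_subgradient])
    moreover have "Fm k j (y k j) \<le> Fm k j (x k)" by (rule model_decrease[OF j])
    then have "(gradf (x k) + \<xi> k) \<bullet> d + 1/2 * (d \<bullet> blinfun_apply (Q k j) d) + \<phi> (y k j) - \<phi> (x k) \<le> 0"
      using model_expand[OF j, of "y k j" "x k"] by (simp add: blinfun.zero_right d_def)
    moreover have "(2 * C + \<alpha>) * (norm d)\<^sup>2 \<le> d \<bullet> blinfun_apply (Q k j) d"
      using Q_ge[OF j, of d] mult_right_mono[OF mu, of "(norm d)\<^sup>2"] by simp
    ultimately have "Fr (y k j) \<le> Fr (x k) - \<alpha> / 2 * (norm d)\<^sup>2"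
      by (simp add: Fr_def inner_add_left algebra_simps)
    then show ?thesis
      using g by (simp add: accepted_def objective_feasible x_feasible yf d_def)
  qed
  then show ?thesis using K(1) params_pos by (intro exI[of _ "2 * C + \<alpha>"]) auto
qed

text \<open>The parameter grows only after a feasible trial point is rejected, hence only from below
  the acceptance threshold; the last increase overshoots by the factor \<open>\<tau>\<close> at
  most.\<close>

lemma mu_bounded: "\<exists>c>0. \<forall>k j. j \<le> jk k \<longrightarrow> \<mu> k j \<le> c"
proof -
  obtain c where c: "0 < c" "\<And>k j. j \<le> jk k \<Longrightarrow> g (y k j) \<le> 0 \<Longrightarrow> c \<le> \<mu> k j \<Longrightarrow> accepted f \<phi> \<psi> g \<alpha> (x k) (y k j)"
    using accepted_large_mu by blast
  have "\<mu> k j \<le> max \<mu>max (\<tau> * c)" if "j \<le> jk k" for k j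
    using that
  proof (induction j)
    case 0
    then show ?case using mu_init[of k] by (simp add: le_max_iff_disj)
  next
    case (Suc j)
    then have j: "j < jk k" "j \<le> jk k" and IH: "\<mu> k j \<le> max \<mu>max (\<tau> * c)" by auto
    show ?case
    proof (cases "g (y k j) \<le> 0")
      case True
      then have "\<mu> k j < c" using c(2)[OF j(2) True] inner_continue[OF j(1)] by linarith
      then have "\<tau> * \<mu> k j \<le> \<tau> * c" using tau by simp
      then show ?thesis using update_feasible[OF j(1) True] by simp
    next
      case False
      then show ?thesis using update_infeasible[OF j(1) False] IH by simp
    qed
  qed
  moreover have "0 < max \<mu>max (\<tau> * c)" using c(1) tau by (simp add: less_max_iff_disj)
  ultimately show ?thesis by blast
qed

text \<open>Feasibility is guaranteed only if all entries are large, whereas a rejection says only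
  that some entry is small. As all entries are scaled together, a common factor \<open>t\<close> is
  tracked: one small entry bounds \<open>t\<close>, and \<open>t\<close> bounds all entries.\<close>

lemma L_bounded: "\<exists>c>0. \<forall>k j i. j \<le> jk k \<longrightarrow> L k j $ i \<le> c"
proof -
  obtain c where c: "0 < c" "\<And>k j. j \<le> jk k \<Longrightarrow> (\<And>i. c \<le> L k j $ i) \<Longrightarrow> g (y k j) \<le> 0"
    using y_feasible_large_L by blast
  define T where "T = max 1 (\<tau> * (c / Lmin))"
  have inv: "\<exists>t. 1 \<le> t \<and> t \<le> T \<and> (\<forall>i. Lmin * t \<le> L k j $ i \<and> L k j $ i \<le> Lmax * t)"
    if "j \<le> jk k" for k j
    using that
  proof (induction j)
    case 0
    then show ?case using L_init[of k] by (intro exI[of _ 1]) (simp add: T_def)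
  next
    case (Suc j)
    then have j: "j < jk k" "j \<le> jk k" by auto
    obtain t where t: "1 \<le> t" "t \<le> T" "\<And>i. Lmin * t \<le> L k j $ i \<and> L k j $ i \<le> Lmax * t"
      using Suc by auto
    show ?case
    proof (cases "g (y k j) \<le> 0")
      case True
      then show ?thesis using update_feasible[OF j(1) True] t by (intro exI[of _ t]) auto
    next
      case False
      then obtain i where "L k j $ i < c" using c(2)[OF j(2)] by (meson not_less)
      then have "Lmin * t < c" using t(3)[of i] by linarith
      then have "t \<le> c / Lmin" using L_bounds(1) by (simp add: pos_le_divide_eq mult.commute)
      then have "\<tau> * t \<le> \<tau> * (c / Lmin)" using tau by (intro mult_left_mono) auto
      then have "\<tau> * t \<le> T" unfolding T_def by (rule max.coboundedI2)
      moreover have "1 \<le> \<tau> * t" using tau t(1) mult_mono[of 1 \<tau> 1 t] by simp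
      moreover have "Lmin * (\<tau> * t) \<le> \<tau> * L k j $ i \<and> \<tau> * L k j $ i \<le> Lmax * (\<tau> * t)" for i
        using t(3)[of i] tau mult_left_mono[of "Lmin * t" "L k j $ i" \<tau>]
          mult_left_mono[of "L k j $ i" "Lmax * t" \<tau>] by (simp add: mult_ac)
      ultimately show ?thesis using update_infeasible[OF j(1) False] by (intro exI[of _ "\<tau> * t"]) auto
    qed
  qed
  have "L k j $ i \<le> Lmax * T" if "j \<le> jk k" for k j i
  proof -
    obtain t where "t \<le> T" "L k j $ i \<le> Lmax * t" using inv[OF \<open>j \<le> jk k\<close>] by blast
    then show ?thesis using L_bounds mult_left_mono[of t T Lmax] by linarith
  qed
  moreover have "0 < Lmax * T" using L_bounds by (simp add: T_def)
  ultimately show ?thesis by blast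
qed

end

section \<open>Multipliers and the KL inequality\<close>

locale KL_MBA = bounded_MBA where f = f and \<phi> = \<phi> and \<psi> = \<psi> and g = g
  for f :: "real^'n \<Rightarrow> ereal" and \<phi> \<psi> :: "real^'n \<Rightarrow> real" and g :: "real^'n \<Rightarrow> real^'m" +
  fixes q :: real
  assumes BMP: "\<And>us xs.
      (us, xs) \<in> cluster_points (\<lambda>k. ((L k (jk k), Q k (jk k), \<xi> k, x k), xbar k (jk k))) \<Longrightarrow>
      partial_BMP g us xs"
    and g_twice: "twice_differentiable g"
    and q_range: "1/2 \<le> q" "q < 1"
    and KL: "\<And>zs. zs \<in> cluster_points (\<lambda>k. (xbar k (jk k), x k, L k (jk k), \<xi> k)) \<Longrightarrow>
      KL_exponent (Phi f \<phi> \<psi> g) q zs"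
begin

abbreviation Lk :: "nat \<Rightarrow> real^'m" where "Lk k \<equiv> L k (jk k)"
abbreviation Qk :: "nat \<Rightarrow> (real^'n) \<Rightarrow>\<^sub>L (real^'n)" where "Qk k \<equiv> Q k (jk k)"
abbreviation xb :: "nat \<Rightarrow> real^'n" where "xb k \<equiv> xbar k (jk k)"
abbreviation uk :: "nat \<Rightarrow> ('n, 'm) bmp_param" where "uk k \<equiv> (Lk k, Qk k, \<xi> k, x k)"
abbreviation zk :: "nat \<Rightarrow> (real^'n) \<times> (real^'n) \<times> (real^'m) \<times> (real^'n)" where
  "zk k \<equiv> (xb k, x k, Lk k, \<xi> k)"
abbreviation step :: "nat \<Rightarrow> real" where "step k \<equiv> norm (x (Suc k) - x k)"
abbreviation grad_model :: "nat \<Rightarrow> real^'n" where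
  "grad_model k \<equiv> gradf (x k) + \<xi> k + blinfun_apply (Qk k) (xb k - x k)"

text \<open>The potential at \<open>zk k\<close> as a real number, with the conjugate evaluated by
  the Fenchel equality at \<open>x k\<close>.\<close>

definition PhiR :: "nat \<Rightarrow> real" where
  "PhiR k = real_of_ereal (f (xb k)) + \<phi> (xb k) + xb k \<bullet> \<xi> k + ((- \<xi> k) \<bullet> x k - \<psi> (x k))"

lemma Q_norm_bound: "\<exists>c>0. \<forall>k. (\<forall>d. norm (blinfun_apply (Qk k) d) \<le> c * norm d) \<and> norm (Qk k) \<le> c"
proof -
  obtain c where c: "0 < c" "\<And>k j. j \<le> jk k \<Longrightarrow> \<mu> k j \<le> c" using mu_bounded by blast
  have "norm (blinfun_apply (Qk k) d) \<le> (c + M) * norm d" for k d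
  proof (rule self_adjoint_norm_le)
    show "self_adjoint (Qk k)" using Q_self_adjoint by simp
    fix d
    show "0 \<le> d \<bullet> blinfun_apply (Qk k) d"
      using Q_ge_min[of "jk k" k d] mu_bounds(1) by (smt (verit) order_refl mult_nonneg_nonneg zero_le_power2)
    have "d \<bullet> blinfun_apply (Qk k) d \<le> (\<mu> k (jk k) + M) * (norm d)\<^sup>2"
      using Q_upper[of "jk k" k] by (simp add: loewner_le_def blinfun.scaleR_left power2_norm_eq_inner)
    also have "\<dots> \<le> (c + M) * (norm d)\<^sup>2" using c(2)[of "jk k" k] by (intro mult_right_mono) auto
    finally show "d \<bullet> blinfun_apply (Qk k) d \<le> (c + M) * (norm d)\<^sup>2" .
  qed
  moreover from this have "norm (Qk k) \<le> c + M" for k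
    using c(1) params_pos by (intro norm_blinfun_bound) (auto simp: mult.commute)
  ultimately show ?thesis using c(1) params_pos by (intro exI[of _ "c + M"]) auto
qed

lemma Lk_norm_bound: "\<exists>c>0. \<forall>k. norm (Lk k) \<le> c"
proof -
  obtain c where c: "0 < c" "\<And>k j i. j \<le> jk k \<Longrightarrow> L k j $ i \<le> c" using L_bounded by blast
  have "norm (Lk k) \<le> real CARD('m) * c" for k
  proof -
    have "norm (Lk k) \<le> (\<Sum>i\<in>UNIV. \<bar>Lk k $ i\<bar>)" by (rule norm_le_l1_cart)
    also have "\<dots> \<le> (\<Sum>i\<in>(UNIV :: 'm set). c)"
      using c(2)[of "jk k" k] L_nonneg[of "jk k" k] by (intro sum_mono) (simp add: less_eq_vec_def)
    finally show ?thesis by simp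
  qed
  then show ?thesis using c(1) by (intro exI[of _ "real CARD('m) * c"]) auto
qed

lemma parameters_bounded: "bounded (range (\<lambda>k. (uk k, xb k)))" "bounded (range zk)"
proof -
  obtain cL where cL: "\<And>k. norm (Lk k) \<le> cL" using Lk_norm_bound by blast
  obtain cQ where cQ: "\<And>k. norm (Qk k) \<le> cQ" using Q_norm_bound by blast
  obtain c\<xi> where c\<xi>: "\<And>k. norm (\<xi> k) \<le> c\<xi>" using xi_bound by blast
  obtain R where R: "\<And>k. norm (x k) \<le> R" "\<And>k. norm (xb k) \<le> R" using y_xbar_bounded by blast
  have b: "bounded (range Lk)" "bounded (range Qk)" "bounded (range \<xi>)" "bounded (range x)" "bounded (range xb)"
    unfolding bounded_iff using cL cQ c\<xi> R by auto
  have "bounded ((range Lk \<times> range Qk \<times> range \<xi> \<times> range x) \<times> range xb)"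
    by (intro bounded_Times b)
  then show "bounded (range (\<lambda>k. (uk k, xb k)))" by (rule bounded_subset) auto
  have "bounded (range xb \<times> range x \<times> range Lk \<times> range \<xi>)"
    by (intro bounded_Times b)
  then show "bounded (range zk)" by (rule bounded_subset) auto
qed

lemma g_derivatives:
  "\<exists>g' D C. 0 < C \<and> (\<forall>z. (g has_derivative blinfun_apply (g' z)) (at z))
    \<and> (\<forall>z. (g' has_derivative D z) (at z))
    \<and> (\<forall>z d. norm z \<le> R \<longrightarrow> norm (D z d) \<le> C * norm d)"
proof -
  obtain g' C where g': "0 < C" "\<And>z. z \<in> UNIV \<Longrightarrow> (g has_derivative blinfun_apply (g' z)) (at z)"
    "C-lipschitz_on (cball 0 (R + 1)) g'"
    using C11_on_compact_bounds[OF g_C11, of "cball 0 (R + 1)"] by (metis compact_cball convex_cball subset_UNIV)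
  obtain g2 :: "real^'n \<Rightarrow> (real^'n) \<Rightarrow>\<^sub>L (real^'m)" where g2: "\<And>z. (g has_derivative blinfun_apply (g2 z)) (at z)"
    "\<And>z. g2 differentiable (at z)"
    using g_twice unfolding twice_differentiable_def by blast
  \<comment> \<open>The Lipschitz derivative and the differentiable one come from separate
    hypotheses; uniqueness identifies them.\<close>
  have g2_eq: "g2 = g'"
  proof
    fix z show "g2 z = g' z"
      using has_derivative_unique[OF g2(1) g'(2)[OF UNIV_I], of z] by (simp add: blinfun_apply_inject)
  qed
  then have D: "(g' has_derivative frechet_derivative g' (at z)) (at z)" for z
    using g2(2)[of z] unfolding g2_eq by (simp only: frechet_derivative_works)
  \<comment> \<open>The bound on a derivative needs an open neighbourhood of each point of norm at
    most \<open>R\<close>, hence the radius \<open>R + 1\<close>.\<close>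
  have lip: "C-lipschitz_on (ball 0 (R + 1)) g'"
    by (rule lipschitz_on_subset[OF g'(3)]) auto
  have "norm (frechet_derivative g' (at z) d) \<le> C * norm d" if "norm z \<le> R" for z d
    by (rule lipschitz_derivative_norm_bound[OF D lip]) (use that in auto)
  then show ?thesis using g'(1,2) D
    by (intro exI[of _ g'] exI[of _ "\<lambda>z. frechet_derivative g' (at z)"] exI[of _ C]) simp
qed

text \<open>Exact optimality of \<open>xb k\<close>, with the constraint still in the form of a
  normal cone, which is what the multiplier property takes as input.\<close>

lemma model_normal:
  "\<exists>w\<in>convex_subdiff \<phi> (xb k). - (grad_model k + w) \<in> limiting_normal_cone (S_set g (uk k)) (xb k)"
proof -
  obtain g' where g': "\<And>z. (g has_derivative blinfun_apply (g' z)) (at z)"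
    using g_C11 unfolding C11_on_def by blast
  have S: "S_set g (uk k) = Gamma_model g (x k) (Lk k)"
    by (simp add: S_set_def Hfun_def Gamma_model_def)
  have conv: "convex (Gamma_model g (x k) (Lk k))"
    by (rule Gamma_model_convex[OF g' L_nonneg]) simp
  have xb: "xb k \<in> Gamma_model g (x k) (Lk k)" by (rule xbar_in_model) simp
  have min: "\<phi> (xb k) \<le> grad_model k \<bullet> (z - xb k) + \<phi> z" if z: "z \<in> Gamma_model g (x k) (Lk k)" for z
  proof (rule quadratic_minimizer_first_order[OF \<phi>_convex conv xb z])
    fix z assume "z \<in> Gamma_model g (x k) (Lk k)"
    then have "Fm k (jk k) (xb k) \<le> Fm k (jk k) z" by (intro xbar_model_le) simp_all
    then show "\<phi> (xb k) \<le> grad_model k \<bullet> (z - xb k) + 1/2 * ((z - xb k) \<bullet> blinfun_apply (Qk k) (z - xb k)) + \<phi> z"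
      using model_expand[of "jk k" k z "xb k"] by simp
  qed
  obtain w where w: "w \<in> convex_subdiff \<phi> (xb k)"
    "\<And>z. z \<in> Gamma_model g (x k) (Lk k) \<Longrightarrow> 0 \<le> (grad_model k + w) \<bullet> (z - xb k)"
    using convex_minimizer_subgradient[OF \<phi>_convex conv xb min] by blast
  have "- (grad_model k + w) \<in> limiting_normal_cone (S_set g (uk k)) (xb k)"
    unfolding S using xb
  proof (rule limiting_normal_cone_convexI)
    fix z assume "z \<in> Gamma_model g (x k) (Lk k)"
    then show "- (grad_model k + w) \<bullet> (z - xb k) \<le> 0" using w(2)[of z] unfolding inner_minus_left by simp
  qed
  then show ?thesis using w(1) by blast
qed

lemma uk_in_U_space: "uk k \<in> U_space"
proof -
  have "0 < d \<bullet> blinfun_apply (Qk k) d" if "d \<noteq> 0" for d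
  proof -
    have "0 < \<mu>min * (norm d)\<^sup>2" using that mu_bounds(1) by simp
    then show ?thesis using Q_ge_min[of "jk k" k d] by simp
  qed
  then show ?thesis using L_nonneg[of "jk k" k] Q_self_adjoint[of "jk k" k]
    by (simp add: U_space_def posdef_def)
qed

lemma BMP_uniform:
  "\<exists>c>0. \<forall>\<^sub>F k in sequentially. \<forall>n\<in>limiting_normal_cone (S_set g (uk k)) (xb k).
    \<exists>l\<in>limiting_normal_cone {z. z \<le> 0} (Hfun g (uk k) (xb k)).
      nabla (Hfun g (uk k)) (xb k) l = n \<and> norm l \<le> c * norm n"
proof (rule bounded_cluster_uniform[OF parameters_bounded(1)])
  fix k c c'
  assume 1: "\<forall>n\<in>limiting_normal_cone (S_set g (uk k)) (xb k).
    \<exists>l\<in>limiting_normal_cone {z. z \<le> 0} (Hfun g (uk k) (xb k)).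
      nabla (Hfun g (uk k)) (xb k) l = n \<and> norm l \<le> c * norm n" and 2: "(c::real) \<le> c'"
  show "\<forall>n\<in>limiting_normal_cone (S_set g (uk k)) (xb k).
    \<exists>l\<in>limiting_normal_cone {z. z \<le> 0} (Hfun g (uk k) (xb k)).
      nabla (Hfun g (uk k)) (xb k) l = n \<and> norm l \<le> c' * norm n"
  proof
    fix n assume "n \<in> limiting_normal_cone (S_set g (uk k)) (xb k)"
    then obtain l where l: "l \<in> limiting_normal_cone {z. z \<le> 0} (Hfun g (uk k) (xb k))"
      "nabla (Hfun g (uk k)) (xb k) l = n" "norm l \<le> c * norm n" using 1 by blast
    moreover have "c * norm n \<le> c' * norm n" using 2 by (intro mult_right_mono) auto
    ultimately show "\<exists>l\<in>limiting_normal_cone {z. z \<le> 0} (Hfun g (uk k) (xb k)).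
      nabla (Hfun g (uk k)) (xb k) l = n \<and> norm l \<le> c' * norm n" by (intro bexI[of _ l]) auto
  qed
next
  fix l assume l: "l \<in> cluster_points (\<lambda>k. (uk k, xb k))"
  obtain us xs where us: "l = (us, xs)" by fastforce
  have "partial_BMP g us xs" using BMP l us by blast
  then obtain c U V where UV: "open U" "us \<in> U" "open V" "xs \<in> V"
    and B: "\<forall>u \<in> U \<inter> U_space. \<forall>x \<in> V \<inter> S_set g u. \<forall>y \<in> limiting_normal_cone (S_set g u) x.
           \<exists>lam \<in> limiting_normal_cone {z. z \<le> 0} (Hfun g u x).
             nabla (Hfun g u) x lam = y \<and> norm lam \<le> c * norm y"
    unfolding partial_BMP_def by blast
  have xbS: "xb k \<in> S_set g (uk k)" for k
    using xbar_in_model[of "jk k" k] by (simp add: S_set_def Hfun_def Gamma_model_def)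
  show "\<exists>c U N. open U \<and> l \<in> U \<and> (\<forall>k\<ge>N. (uk k, xb k) \<in> U \<longrightarrow>
    (\<forall>n\<in>limiting_normal_cone (S_set g (uk k)) (xb k).
    \<exists>l\<in>limiting_normal_cone {z. z \<le> 0} (Hfun g (uk k) (xb k)).
      nabla (Hfun g (uk k)) (xb k) l = n \<and> norm l \<le> c * norm n))"
  proof (intro exI[of _ c] exI[of _ "U \<times> V"] exI[of _ 0] conjI allI impI)
    show "open (U \<times> V)" using UV by (intro open_Times)
    show "l \<in> U \<times> V" using UV us by simp
    fix k assume "(uk k, xb k) \<in> U \<times> V"
    then have "uk k \<in> U \<inter> U_space" "xb k \<in> V \<inter> S_set g (uk k)" using uk_in_U_space xbS by auto
    then show "\<forall>n\<in>limiting_normal_cone (S_set g (uk k)) (xb k).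
    \<exists>l\<in>limiting_normal_cone {z. z \<le> 0} (Hfun g (uk k) (xb k)).
      nabla (Hfun g (uk k)) (xb k) l = n \<and> norm l \<le> c * norm n" using B by blast
  qed
qed

text \<open>The multiplier property bounds a multiplier by the normal vector it represents. The
  normal vectors are bounded because gradients, subgradients, operators and iterates are.\<close>

lemma multipliers:
  "\<exists>c>0. \<forall>\<^sub>F k in sequentially. \<exists>w\<in>convex_subdiff \<phi> (xb k). \<exists>l. 0 \<le> l
    \<and> l \<bullet> Gfun g (xb k) (x k) (Lk k) = 0 \<and> norm l \<le> c
    \<and> nabla (\<lambda>z. Gfun g z (x k) (Lk k)) (xb k) l = - (grad_model k + w)"
proof -
  obtain c where c: "0 < c" "\<forall>\<^sub>F k in sequentially. \<forall>n\<in>limiting_normal_cone (S_set g (uk k)) (xb k).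
    \<exists>l\<in>limiting_normal_cone {z. z \<le> 0} (Hfun g (uk k) (xb k)).
      nabla (Hfun g (uk k)) (xb k) l = n \<and> norm l \<le> c * norm n" using BMP_uniform by blast
  obtain R where R: "0 < R" "\<And>k. norm (x k) \<le> R" "\<And>k. norm (xb k) \<le> R" using y_xbar_bounded by blast
  obtain cQ where cQ: "0 < cQ" "\<And>k d. norm (blinfun_apply (Qk k) d) \<le> cQ * norm d" using Q_norm_bound by blast
  obtain c\<xi> where c\<xi>: "0 < c\<xi>" "\<And>k. norm (\<xi> k) \<le> c\<xi>" using xi_bound by blast
  obtain cf where cf: "0 < cf" "\<And>k. norm (gradf (x k)) \<le> cf" using gradf_bound by blast
  obtain c\<phi> where c\<phi>: "0 < c\<phi>" "\<And>z w. norm z \<le> R \<Longrightarrow> w \<in> convex_subdiff \<phi> z \<Longrightarrow> norm w \<le> c\<phi>"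
    using convex_subdiff_bounded[OF \<phi>_convex] by blast
  define b where "b = cf + c\<xi> + cQ * (2 * R) + c\<phi>"
  have b: "norm (- (grad_model k + w)) \<le> b" if "w \<in> convex_subdiff \<phi> (xb k)" for k w
  proof -
    have "norm (xb k - x k) \<le> 2 * R" using norm_triangle_ineq4[of "xb k" "x k"] R(2,3)[of k] by simp
    then have "norm (blinfun_apply (Qk k) (xb k - x k)) \<le> cQ * (2 * R)"
      using cQ(1) by (intro order_trans[OF cQ(2)] mult_left_mono) auto
    moreover have "norm w \<le> c\<phi>" by (rule c\<phi>(2)[OF R(3) that])
    moreover have "norm (grad_model k + w) \<le> norm (gradf (x k)) + norm (\<xi> k)
        + norm (blinfun_apply (Qk k) (xb k - x k)) + norm w"
      by (intro order_trans[OF norm_triangle_ineq] add_right_mono) auto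
    ultimately show ?thesis using cf(2)[of k] c\<xi>(2)[of k] unfolding norm_minus_cancel b_def by linarith
  qed
  have "\<forall>\<^sub>F k in sequentially. \<exists>w\<in>convex_subdiff \<phi> (xb k). \<exists>l. 0 \<le> l
    \<and> l \<bullet> Gfun g (xb k) (x k) (Lk k) = 0 \<and> norm l \<le> c * b
    \<and> nabla (\<lambda>z. Gfun g z (x k) (Lk k)) (xb k) l = - (grad_model k + w)"
    using c(2)
  proof eventually_elim
    case (elim k)
    obtain w where w: "w \<in> convex_subdiff \<phi> (xb k)"
      "- (grad_model k + w) \<in> limiting_normal_cone (S_set g (uk k)) (xb k)"
      using model_normal by blast
    obtain l where l: "l \<in> limiting_normal_cone {z. z \<le> 0} (Hfun g (uk k) (xb k))"
      "nabla (Hfun g (uk k)) (xb k) l = - (grad_model k + w)" "norm l \<le> c * norm (- (grad_model k + w))"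
      using elim[rule_format, OF w(2)] by blast
    have H: "Hfun g (uk k) = (\<lambda>z. Gfun g z (x k) (Lk k))" by (simp add: Hfun_def fun_eq_iff)
    have "norm l \<le> c * b" using l(3) mult_left_mono[OF b[OF w(1)], of c] c(1) by linarith
    then show ?case using nonpos_orthant_normal[OF l(1)] l(2) w(1) unfolding H by blast
  qed
  moreover have "0 < c * b" using c(1) cf c\<xi> cQ R(1) c\<phi> by (simp add: b_def add_pos_pos)
  ultimately show ?thesis by blast
qed

text \<open>Strong convexity at \<open>xb k\<close> compared with the permitted model gap would
  bound the distance from \<open>y\<close> at once if \<open>y\<close> were feasible for the model.
  It may not be, so the first-order term at \<open>xb k\<close> can be negative; the multiplier
  bounds it below by the constraint violation, which the residual test limits to the order of the
  squared step.\<close>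

lemma xbar_step_bound: "\<exists>c>0. \<forall>\<^sub>F k in sequentially. norm (xb k - x k) \<le> c * step k"
proof -
  obtain c where c: "0 < c" "\<forall>\<^sub>F k in sequentially. \<exists>w\<in>convex_subdiff \<phi> (xb k). \<exists>l. 0 \<le> l
    \<and> l \<bullet> Gfun g (xb k) (x k) (Lk k) = 0 \<and> norm l \<le> c
    \<and> nabla (\<lambda>z. Gfun g z (x k) (Lk k)) (xb k) l = - (grad_model k + w)"
    using multipliers by blast
  obtain g' where g': "\<And>z. (g has_derivative blinfun_apply (g' z)) (at z)"
    using g_C11 unfolding C11_on_def by blast
  \<comment> \<open>\<open>s\<close> converts the maximum norm of the residual into the Euclidean
    norm; \<open>b\<close> collects the model gap and the constraint violation, divided by the
    modulus of strong convexity.\<close>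
  define s where "s = sqrt (real DIM(real^'m))"
  define b where "b = (\<beta>F + c * (s * \<beta>R)) / \<mu>min"
  have s: "0 \<le> s" by (simp add: s_def)
  have b: "0 \<le> b" using c(1) s params_pos mu_bounds(1) by (simp add: b_def)
  have "\<forall>\<^sub>F k in sequentially. norm (xb k - x k) \<le> (sqrt b + 1) * step k"
    using c(2)
  proof eventually_elim
    case (elim k)
    then obtain w l where w: "w \<in> convex_subdiff \<phi> (xb k)" and l: "0 \<le> l"
      "l \<bullet> Gfun g (xb k) (x k) (Lk k) = 0" "norm l \<le> c"
      "nabla (\<lambda>z. Gfun g z (x k) (Lk k)) (xb k) l = - (grad_model k + w)" by blast
    define e where "e = y k (jk k) - xb k"
    define d2 where "d2 = (step k)\<^sup>2"
    define G where "G = Gfun g (y k (jk k)) (x k) (Lk k)"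
    have d2: "(norm (y k (jk k) - x k))\<^sup>2 = d2" by (simp add: d2_def outer_step)
    have "G = Gfun g (xb k) (x k) (Lk k) + (blinfun_apply (g' (x k)) e + ((xb k - x k) \<bullet> e) *\<^sub>R Lk k)
        + (1/2 * (norm e)\<^sup>2) *\<^sub>R Lk k"
      unfolding G_def e_def by (rule Gfun_expand[OF g'])
    \<comment> \<open>Complementarity removes the value at \<open>xb k\<close>; the quadratic
      remainder is dropped next because \<open>l\<close> and \<open>Lk k\<close> are
      nonnegative.\<close>
    then have "l \<bullet> G = nabla (\<lambda>z. Gfun g z (x k) (Lk k)) (xb k) l \<bullet> e + 1/2 * (norm e)\<^sup>2 * (l \<bullet> Lk k)"
      unfolding nabla_Gfun_inner[OF g'] using l(2) by (simp add: inner_add_right)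
    moreover have "0 \<le> l \<bullet> Lk k"
      using l(1) L_nonneg[of "jk k" k] unfolding inner_vec_def
      by (intro sum_nonneg) (auto simp: less_eq_vec_def)
    ultimately have "- ((grad_model k + w) \<bullet> e) \<le> l \<bullet> G" unfolding l(4) inner_minus_left by simp
    also have "l \<bullet> G \<le> l \<bullet> pos_part G"
      using l(1) unfolding inner_vec_def
      by (intro sum_mono) (auto simp: less_eq_vec_def pos_part_def intro: mult_left_mono)
    also have "\<dots> \<le> norm l * norm (pos_part G)" by (rule norm_cauchy_schwarz)
    also have "\<dots> \<le> c * (s * infnorm (pos_part G))"
      using l(3) c(1) norm_le_infnorm[of "pos_part G"] unfolding s_def by (intro mult_mono) auto
    also have "\<dots> \<le> c * (s * (\<beta>R / 2 * d2))"
      using residual_bound[of "jk k" k] c(1) s unfolding G_def d2[symmetric] by (intro mult_left_mono) auto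
    finally have "- ((grad_model k + w) \<bullet> e) \<le> (c * (s * \<beta>R) * d2) / 2" by (simp add: mult_ac)
    moreover have "\<phi> (xb k) + w \<bullet> e \<le> \<phi> (y k (jk k))" unfolding e_def by (rule convex_subdiffD[OF w])
    moreover have "\<mu>min * (norm e)\<^sup>2 \<le> e \<bullet> blinfun_apply (Qk k) e" by (rule Q_ge_min) simp
    moreover have "grad_model k \<bullet> e + 1/2 * (e \<bullet> blinfun_apply (Qk k) e) + \<phi> (y k (jk k)) - \<phi> (xb k) \<le> (\<beta>F * d2) / 2"
      using model_gap[of "jk k" k] model_expand[of "jk k" k "y k (jk k)" "xb k"] unfolding d2 e_def by simp
    ultimately have "\<mu>min * (norm e)\<^sup>2 \<le> \<beta>F * d2 + c * (s * \<beta>R) * d2" unfolding inner_add_left by linarith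
    then have "(norm e)\<^sup>2 \<le> b * d2"
      using mu_bounds(1) by (simp add: b_def pos_le_divide_eq distrib_right mult_ac) (simp add: algebra_simps)
    then have "norm e \<le> sqrt (b * d2)" by (rule real_le_rsqrt)
    then have "norm e \<le> sqrt b * step k" by (simp add: d2_def real_sqrt_mult)
    moreover have "norm (xb k - x k) \<le> norm e + step k"
      using norm_triangle_ineq4[of "x (Suc k) - x k" e] unfolding e_def outer_step by (simp add: add.commute)
    ultimately show ?case by (simp add: distrib_right)
  qed
  then show ?thesis using b by (intro exI[of _ "sqrt b + 1"]) (simp add: add_nonneg_pos)
qed

section \<open>Descent, and the potential compared with the objective\<close>

lemma Fr_descent: "\<alpha> / 2 * (step k)\<^sup>2 \<le> Fr (x k) - Fr (x (Suc k))"
proof -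
  have "objective f \<phi> \<psi> g (x (Suc k)) \<le> objective f \<phi> \<psi> g (x k) - ereal (\<alpha> / 2 * (step k)\<^sup>2)"
    using inner_stop[of k] unfolding accepted_def outer_step[symmetric] by simp
  then show ?thesis by (simp add: objective_feasible x_feasible)
qed

definition \<omega> :: real where "\<omega> = lim (\<lambda>k. Fr (x k))"

lemma Fr_tendsto: "(\<lambda>k. Fr (x k)) \<longlonglongrightarrow> \<omega>" and Fr_ge: "\<omega> \<le> Fr (x k)"
proof -
  obtain m where m: "\<And>z. z \<in> feasible g \<Longrightarrow> m \<le> Fr z" using Fr_bounded_below by blast
  have "Fr (x (Suc n)) \<le> Fr (x n)" for n
  proof -
    have "0 \<le> \<alpha> / 2 * (step n)\<^sup>2" using params_pos by simp
    then show ?thesis using Fr_descent[of n] by linarith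
  qed
  then have dec: "decseq (\<lambda>k. Fr (x k))" by (rule decseq_SucI)
  obtain l where l: "(\<lambda>k. Fr (x k)) \<longlonglongrightarrow> l"
    by (rule decseq_convergent[OF dec, of m]) (use m x_feasible in auto)
  then show *: "(\<lambda>k. Fr (x k)) \<longlonglongrightarrow> \<omega>" by (simp add: \<omega>_def limI)
  show "\<omega> \<le> Fr (x k)" by (rule decseq_ge[OF dec *])
qed

lemma step_tendsto_0: "step \<longlonglongrightarrow> 0"
proof -
  have "(\<lambda>k. (2 / \<alpha>) * (Fr (x k) - Fr (x (Suc k)))) \<longlonglongrightarrow> (2 / \<alpha>) * (\<omega> - \<omega>)"
    by (intro tendsto_intros Fr_tendsto LIMSEQ_Suc[OF Fr_tendsto])
  then have lim: "(\<lambda>k. (2 / \<alpha>) * (Fr (x k) - Fr (x (Suc k)))) \<longlonglongrightarrow> 0" by simp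
  have le: "\<forall>\<^sub>F k in sequentially. (step k)\<^sup>2 \<le> (2 / \<alpha>) * (Fr (x k) - Fr (x (Suc k)))"
  proof (rule always_eventually, rule allI)
    fix k
    have "(2 / \<alpha>) * (\<alpha> / 2 * (step k)\<^sup>2) \<le> (2 / \<alpha>) * (Fr (x k) - Fr (x (Suc k)))"
      using params_pos by (intro mult_left_mono Fr_descent) auto
    then show "(step k)\<^sup>2 \<le> (2 / \<alpha>) * (Fr (x k) - Fr (x (Suc k)))" using params_pos by simp
  qed
  have "\<forall>\<^sub>F k in sequentially. 0 \<le> (step k)\<^sup>2" by simp
  from this le tendsto_const lim have "(\<lambda>k. (step k)\<^sup>2) \<longlonglongrightarrow> 0"
    by (rule tendsto_sandwich)
  then have "(\<lambda>k. sqrt ((step k)\<^sup>2)) \<longlonglongrightarrow> sqrt 0" by (rule tendsto_real_sqrt)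
  then show ?thesis by simp
qed

lemma xbar_eventually_near:
  assumes "0 < e"
  shows "\<forall>\<^sub>F k in sequentially. norm (xb k - x k) \<le> e"
proof -
  obtain c where c: "0 < c" "\<forall>\<^sub>F k in sequentially. norm (xb k - x k) \<le> c * step k"
    using xbar_step_bound by blast
  have "\<forall>\<^sub>F k in sequentially. step k < e / c"
    using assms c(1) by (intro order_tendstoD[OF step_tendsto_0]) simp
  with c(2) show ?thesis
  proof eventually_elim
    case (elim k)
    then have "c * step k \<le> e" using c(1) by (simp add: pos_less_divide_eq mult.commute)
    then show ?case using elim(1) by linarith
  qed
qed

lemma Phi_zk:
  assumes "xb k \<in> \<O>"
  shows "Phi f \<phi> \<psi> g (zk k) = ereal (PhiR k)"
proof -
  obtain r where r: "f (xb k) = ereal r" using bspec[OF f_finite assms] by auto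
  have "Phi f \<phi> \<psi> g (zk k) = ereal (r + \<phi> (xb k) + xb k \<bullet> \<xi> k + ((- \<xi> k) \<bullet> x k - \<psi> (x k)))"
  proof (rule Phi_eq_real)
    show "\<forall>i. 0 < Lk k $ i" using mu_L_positive[of "jk k" k] L_bounds(1) by (auto intro: less_le_trans)
    show "Gfun g (xb k) (x k) (Lk k) \<le> 0"
      using xbar_in_model[of "jk k" k] by (simp add: Gamma_model_def)
    show "conjugate_fun \<psi> (- \<xi> k) = ereal ((- \<xi> k) \<bullet> x k - \<psi> (x k))"
      by (rule conjugate_at_subgradient[OF neg_xi_subgradient])
  qed (rule r)
  then show ?thesis using r by (simp add: PhiR_def)
qed

text \<open>The points \<open>xb k\<close> need not satisfy the original constraint; they enter
  \<open>K\<close> only eventually, as their distance from the feasible \<open>x k\<close> tends to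
  zero.\<close>

lemma f_bounds_near:
  "\<exists>K C. compact K \<and> K \<subseteq> \<O> \<and> 0 < C \<and> (\<forall>\<^sub>F k in sequentially. xb k \<in> K) \<and> (\<forall>k. x k \<in> K)
    \<and> (\<forall>y\<in>K. \<forall>z\<in>K. norm (gradf y - gradf z) \<le> C * norm (y - z))
    \<and> (\<forall>y\<in>K. \<forall>z\<in>K. \<bar>real_of_ereal (f y) - real_of_ereal (f z) - gradf z \<bullet> (y - z)\<bar> \<le> C * (norm (y - z))\<^sup>2)"
proof -
  obtain R where R: "\<And>k. norm (x k) \<le> R" using x_bound by blast
  obtain K C e where K: "compact K" "K \<subseteq> \<O>" "0 < C" "0 < e"
    "\<forall>z\<in>feasible g. \<forall>z'. norm z \<le> R \<longrightarrow> norm (z' - z) \<le> e \<longrightarrow> z' \<in> K"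
    "\<forall>y\<in>K. \<forall>z\<in>K. norm (gradf y - gradf z) \<le> C * norm (y - z)"
    "\<forall>y\<in>K. \<forall>z\<in>K. \<bar>real_of_ereal (f y) - real_of_ereal (f z) - gradf z \<bullet> (y - z)\<bar> \<le> C * (norm (y - z))\<^sup>2"
    using x_f_bounds[of R] by blast
  have near: "z' \<in> K" if "norm (z' - x k) \<le> e" for z' k
    using K(5) x_feasible[of k] R[of k] that by blast
  have "x k \<in> K" for k using near[of "x k" k] K(4) by simp
  moreover have "\<forall>\<^sub>F k in sequentially. xb k \<in> K"
    using xbar_eventually_near[OF K(4)] by eventually_elim (rule near)
  ultimately show ?thesis using K by blast
qed

text \<open>The model at \<open>xb k\<close> is the link. It differs from the potential by the
  Taylor error of \<open>f\<close> and the quadratic term only; it is at most the objective at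
  \<open>x k\<close> by minimality, and within the permitted gap of the model at
  \<open>x (Suc k)\<close>, which bounds the objective there.\<close>

lemma Phi_bounds:
  "\<exists>C>0. \<forall>\<^sub>F k in sequentially. Fr (x (Suc k)) \<le> PhiR k + C * (step k)\<^sup>2
    \<and> PhiR k \<le> Fr (x k) + C * (step k)\<^sup>2"
proof -
  obtain c where c: "0 < c" "\<forall>\<^sub>F k in sequentially. norm (xb k - x k) \<le> c * step k"
    using xbar_step_bound by blast
  obtain cQ where cQ: "0 < cQ" "\<And>k d. norm (blinfun_apply (Qk k) d) \<le> cQ * norm d" using Q_norm_bound by blast
  obtain K C where K: "0 < C" "\<forall>\<^sub>F k in sequentially. xb k \<in> K" "\<And>k. x k \<in> K"
    and C: "\<And>y z. y \<in> K \<Longrightarrow> z \<in> K \<Longrightarrow>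
      \<bar>real_of_ereal (f y) - real_of_ereal (f z) - gradf z \<bullet> (y - z)\<bar> \<le> C * (norm (y - z))\<^sup>2"
    using f_bounds_near by blast
  \<comment> \<open>The summands come from the errors at \<open>xb k\<close>, the model gap, and the
    Taylor error of \<open>f\<close> at \<open>x (Suc k)\<close>.\<close>
  define C' where "C' = (C + cQ) * c\<^sup>2 + \<beta>F / 2 + C"
  have C': "0 < C'" using K(1) cQ(1) params_pos by (simp add: C'_def add_nonneg_pos)
  have "\<forall>\<^sub>F k in sequentially. Fr (x (Suc k)) \<le> PhiR k + C' * (step k)\<^sup>2
    \<and> PhiR k \<le> Fr (x k) + C' * (step k)\<^sup>2"
    using c(2) K(2)
  proof eventually_elim
    case (elim k)
    define e where "e = xb k - x k"
    define d where "d = x (Suc k) - x k"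
    have y: "y k (jk k) = x (Suc k)" by (simp add: outer_step)
    have e2: "(norm e)\<^sup>2 \<le> c\<^sup>2 * (step k)\<^sup>2"
      using power_mono[OF elim(1) norm_ge_zero, of 2] by (simp add: e_def power_mult_distrib)
    have "\<bar>e \<bullet> blinfun_apply (Qk k) e\<bar> \<le> norm e * norm (blinfun_apply (Qk k) e)"
      by (rule Cauchy_Schwarz_ineq2)
    also have "\<dots> \<le> norm e * (cQ * norm e)" using cQ(2) by (intro mult_left_mono) auto
    finally have Qe: "\<bar>e \<bullet> blinfun_apply (Qk k) e\<bar> \<le> cQ * (norm e)\<^sup>2" by (simp add: power2_eq_square mult_ac)
    have Qd: "0 \<le> d \<bullet> blinfun_apply (Qk k) d"
      using Q_ge_min[of "jk k" k d] mu_bounds(1) by (smt (verit) order_refl mult_nonneg_nonneg zero_le_power2)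
    have Fe: "\<bar>real_of_ereal (f (xb k)) - real_of_ereal (f (x k)) - gradf (x k) \<bullet> e\<bar> \<le> C * (norm e)\<^sup>2"
      unfolding e_def by (rule C[OF elim(2) K(3)])
    have Fd: "\<bar>real_of_ereal (f (x (Suc k))) - real_of_ereal (f (x k)) - gradf (x k) \<bullet> d\<bar> \<le> C * (norm d)\<^sup>2"
      unfolding d_def by (rule C[OF K(3) K(3)])
    have psi: "\<psi> (x k) + (- \<xi> k) \<bullet> d \<le> \<psi> (x (Suc k))"
      unfolding d_def by (rule convex_subdiffD[OF neg_xi_subgradient])
    have me: "Fm k (jk k) (xb k) = Fr (x k) + (gradf (x k) \<bullet> e + \<xi> k \<bullet> e)
        + 1/2 * (e \<bullet> blinfun_apply (Qk k) e) + \<phi> (xb k) - \<phi> (x k)"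
      using model_expand[of "jk k" k "xb k" "x k"]
      by (simp add: blinfun.zero_right model_self e_def inner_add_left)
    have md: "Fm k (jk k) (x (Suc k)) = Fr (x k) + (gradf (x k) \<bullet> d + \<xi> k \<bullet> d)
        + 1/2 * (d \<bullet> blinfun_apply (Qk k) d) + \<phi> (x (Suc k)) - \<phi> (x k)"
      using model_expand[of "jk k" k "x (Suc k)" "x k"]
      by (simp add: blinfun.zero_right model_self d_def inner_add_left)
    have le: "Fm k (jk k) (xb k) \<le> Fr (x k)"
      using xbar_model_le[of "jk k" k, OF _ x_in_model] by (simp add: model_self)
    have gap: "Fm k (jk k) (x (Suc k)) - Fm k (jk k) (xb k) \<le> \<beta>F / 2 * (norm d)\<^sup>2"
      using model_gap[of "jk k" k] by (simp add: y d_def)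
    have PhiR: "PhiR k = real_of_ereal (f (xb k)) + \<phi> (xb k) + \<xi> k \<bullet> e - \<psi> (x k)"
      unfolding PhiR_def e_def by (simp add: inner_diff_right inner_commute)
    have Ce: "C * (norm e)\<^sup>2 + cQ * (norm e)\<^sup>2 \<le> (C + cQ) * c\<^sup>2 * (step k)\<^sup>2"
      using mult_left_mono[OF e2, of "C + cQ"] K(1) cQ(1) by (simp add: algebra_simps)
    have Qe0: "0 \<le> e \<bullet> blinfun_apply (Qk k) e"
      using Q_ge_min[of "jk k" k e] mu_bounds(1) by (smt (verit) order_refl mult_nonneg_nonneg zero_le_power2)
    have d2: "norm d = step k" by (simp add: d_def)
    have split: "C' * (step k)\<^sup>2 = (C + cQ) * c\<^sup>2 * (step k)\<^sup>2 + \<beta>F / 2 * (step k)\<^sup>2 + C * (step k)\<^sup>2"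
      by (simp add: C'_def algebra_simps)
    have pos: "0 \<le> \<beta>F / 2 * (step k)\<^sup>2" "0 \<le> C * (step k)\<^sup>2" "0 \<le> cQ * (norm e)\<^sup>2"
      using params_pos K(1) cQ(1) by auto
    have "Fr (x (Suc k)) \<le> Fm k (jk k) (x (Suc k)) + C * (step k)\<^sup>2"
      using Fd psi md Qd unfolding Fr_def d2 inner_minus_left by linarith
    also have "\<dots> \<le> Fm k (jk k) (xb k) + \<beta>F / 2 * (step k)\<^sup>2 + C * (step k)\<^sup>2"
      using gap unfolding d2 by linarith
    also have "Fm k (jk k) (xb k) \<le> PhiR k + C * (norm e)\<^sup>2 + cQ * (norm e)\<^sup>2"
      using Fe Qe me pos unfolding PhiR Fr_def by linarith
    finally have "Fr (x (Suc k)) \<le> PhiR k + C' * (step k)\<^sup>2" using Ce unfolding split by linarith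
    moreover have "PhiR k \<le> Fm k (jk k) (xb k) + C * (norm e)\<^sup>2"
      using Fe Qe0 me unfolding PhiR Fr_def by linarith
    then have "PhiR k \<le> Fr (x k) + C' * (step k)\<^sup>2" using Ce le pos unfolding split by linarith
    ultimately show ?case by blast
  qed
  then show ?thesis using C' by blast
qed

lemma PhiR_tendsto: "PhiR \<longlonglongrightarrow> \<omega>"
proof -
  obtain C where C: "\<forall>\<^sub>F k in sequentially. Fr (x (Suc k)) \<le> PhiR k + C * (step k)\<^sup>2
    \<and> PhiR k \<le> Fr (x k) + C * (step k)\<^sup>2" using Phi_bounds by blast
  have 0: "(\<lambda>k. C * (step k)\<^sup>2) \<longlonglongrightarrow> C * 0\<^sup>2" by (intro tendsto_intros step_tendsto_0)
  have lo: "(\<lambda>k. Fr (x (Suc k)) - C * (step k)\<^sup>2) \<longlonglongrightarrow> \<omega> - C * 0\<^sup>2"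
    by (intro tendsto_diff 0 LIMSEQ_Suc[OF Fr_tendsto])
  have hi: "(\<lambda>k. Fr (x k) + C * (step k)\<^sup>2) \<longlonglongrightarrow> \<omega> + C * 0\<^sup>2"
    by (intro tendsto_add 0 Fr_tendsto)
  have "\<forall>\<^sub>F k in sequentially. Fr (x (Suc k)) - C * (step k)\<^sup>2 \<le> PhiR k"
    using C by eventually_elim linarith
  moreover have "\<forall>\<^sub>F k in sequentially. PhiR k \<le> Fr (x k) + C * (step k)\<^sup>2"
    using C by eventually_elim linarith
  ultimately show ?thesis by (rule tendsto_sandwich) (use lo hi in simp_all)
qed

text \<open>The subgradient is built from the optimality conditions of the subproblem. They cancel
  all terms of its first component except differences between \<open>xb k\<close> and
  \<open>x k\<close>; the other components carry such a factor already.\<close>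

lemma Phi_subgradient_bound:
  "\<exists>C>0. \<forall>\<^sub>F k in sequentially. edist_set 0 (limiting_subdiff (Phi f \<phi> \<psi> g) (zk k)) \<le> ereal (C * step k)"
proof -
  obtain c where c: "0 < c" "\<forall>\<^sub>F k in sequentially. norm (xb k - x k) \<le> c * step k"
    using xbar_step_bound by blast
  obtain cm where cm: "0 < cm" "\<forall>\<^sub>F k in sequentially. \<exists>w\<in>convex_subdiff \<phi> (xb k). \<exists>l. 0 \<le> l
    \<and> l \<bullet> Gfun g (xb k) (x k) (Lk k) = 0 \<and> norm l \<le> cm
    \<and> nabla (\<lambda>z. Gfun g z (x k) (Lk k)) (xb k) l = - (grad_model k + w)"
    using multipliers by blast
  obtain R where R: "0 < R" "\<And>k. norm (x k) \<le> R" "\<And>k. norm (xb k) \<le> R" using y_xbar_bounded by blast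
  obtain cQ where cQ: "0 < cQ" "\<And>k d. norm (blinfun_apply (Qk k) d) \<le> cQ * norm d" using Q_norm_bound by blast
  obtain cL where cL: "0 < cL" "\<And>k. norm (Lk k) \<le> cL" using Lk_norm_bound by blast
  obtain g' D cg where g': "0 < cg" "\<And>z. (g has_derivative blinfun_apply (g' z)) (at z)"
    "\<And>z. (g' has_derivative D z) (at z)" "\<And>z d. norm z \<le> R \<Longrightarrow> norm (D z d) \<le> cg * norm d"
    using g_derivatives[of R] by blast
  obtain K C where K: "K \<subseteq> \<O>" "0 < C" "\<forall>\<^sub>F k in sequentially. xb k \<in> K" "\<And>k. x k \<in> K"
    and C: "\<And>y z. y \<in> K \<Longrightarrow> z \<in> K \<Longrightarrow> norm (gradf y - gradf z) \<le> C * norm (y - z)"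
    using f_bounds_near by blast
  \<comment> \<open>One summand for each component of the subgradient.\<close>
  define b where "b = (C + cQ) + cm * (cg + cL) + R * cm + 1"
  have b: "0 < b" using K(2) cQ(1) cm(1) g'(1) cL(1) R(1) by (simp add: b_def add_pos_pos)
  have "\<forall>\<^sub>F k in sequentially. edist_set 0 (limiting_subdiff (Phi f \<phi> \<psi> g) (zk k)) \<le> ereal (b * c * step k)"
    using c(2) cm(2) K(3)
  proof eventually_elim
    case (elim k)
    define e where "e = xb k - x k"
    obtain w l where w: "w \<in> convex_subdiff \<phi> (xb k)" and l: "0 \<le> l"
      "l \<bullet> Gfun g (xb k) (x k) (Lk k) = 0" "norm l \<le> cm"
      "nabla (\<lambda>z. Gfun g z (x k) (Lk k)) (xb k) l = - (grad_model k + w)" using elim(2) by blast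
    define A where "A = nabla (\<lambda>z. Gfun g z (x k) (Lk k)) (xb k) l"
    define T where "T d = blinfun_apply (D (x k) d) e - (e \<bullet> d) *\<^sub>R Lk k" for d
    have "linear (D (x k))" using has_derivative_linear[OF g'(3)] .
    then have T: "linear T"
      by (intro linearI) (simp_all add: T_def linear_add linear_cmul blinfun.add_left blinfun.scaleR_left
          inner_add_right scaleR_add_left scaleR_diff_right)
    define B where "B = adjoint T l"
    have B: "B \<bullet> d = l \<bullet> T d" for d
      unfolding B_def using adjoint_works[OF T, of d l] by (simp add: inner_commute)
    have "((\<lambda>z. real_of_ereal (f z)) has_derivative (\<lambda>d. gradf (xb k) \<bullet> d)) (at (xb k))"
    proof -
      obtain f' :: "real^'n \<Rightarrow> (real^'n) \<Rightarrow>\<^sub>L real" where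
        "\<And>z. z \<in> \<O> \<Longrightarrow> ((\<lambda>z. real_of_ereal (f z)) has_derivative blinfun_apply (f' z)) (at z)"
        using f_C11 unfolding C11_on_def by blast
      then show ?thesis using elim(3) K(1) by (intro has_derivative_gradient(2)) blast
    qed
    then have sub: "(gradf (xb k) + w + \<xi> k + A, B, (1/2 * (norm (xb k - x k))\<^sup>2) *\<^sub>R l, xb k - x k)
        \<in> regular_subdiff (Phi f \<phi> \<psi> g) (zk k)"
    proof (rule Phi_regular_subgradient[OF g'(2) g'(3) _ \<O>_open _ _ w neg_xi_subgradient _ _ l(1,2)])
      show "xb k \<in> \<O>" using elim(3) K(1) by blast
      show "\<bar>f z\<bar> \<noteq> \<infinity>" if "z \<in> \<O>" for z by (rule bspec[OF f_finite that])
      show "\<forall>i. 0 < Lk k $ i" using mu_L_positive[of "jk k" k] L_bounds(1) by (auto intro: less_le_trans)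
      show "Gfun g (xb k) (x k) (Lk k) \<le> 0"
        using xbar_in_model[of "jk k" k] by (simp add: Gamma_model_def)
      show "A \<bullet> d = l \<bullet> (blinfun_apply (g' (x k)) d + ((xb k - x k) \<bullet> d) *\<^sub>R Lk k)" for d
        unfolding A_def by (rule nabla_Gfun_inner[OF g'(2)])
      show "B \<bullet> d = l \<bullet> (blinfun_apply (D (x k) d) (xb k - x k) - ((xb k - x k) \<bullet> d) *\<^sub>R Lk k)" for d
        unfolding B T_def e_def ..
    qed
    let ?v = "(gradf (xb k) + w + \<xi> k + A, B, (1/2 * (norm (xb k - x k))\<^sup>2) *\<^sub>R l, xb k - x k)"
    have v1: "norm (gradf (xb k) + w + \<xi> k + A) \<le> (C + cQ) * norm e"
    proof -
      \<comment> \<open>The multiplier equation eliminates \<open>w\<close>, \<open>\<xi> k\<close>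
        and the gradient at \<open>x k\<close> up to a difference of gradients.\<close>
      have eq: "gradf (xb k) + w + \<xi> k + A = (gradf (xb k) - gradf (x k)) - blinfun_apply (Qk k) e"
        by (simp add: A_def l(4) e_def)
      have "norm (gradf (xb k) + w + \<xi> k + A) \<le> norm (gradf (xb k) - gradf (x k)) + norm (blinfun_apply (Qk k) e)"
        unfolding eq by (rule norm_triangle_ineq4)
      also have "\<dots> \<le> C * norm e + cQ * norm e"
        unfolding e_def by (intro add_mono C elim K cQ)
      finally show ?thesis by (simp add: distrib_right)
    qed
    have v2: "norm B \<le> cm * (cg + cL) * norm e"
    proof -
      have "norm (T B) \<le> norm (blinfun_apply (D (x k) B) e) + norm ((e \<bullet> B) *\<^sub>R Lk k)"
        unfolding T_def by (rule norm_triangle_ineq4)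
      also have "norm (blinfun_apply (D (x k) B) e) \<le> norm (D (x k) B) * norm e" by (rule norm_blinfun)
      also have "norm (D (x k) B) * norm e \<le> cg * norm B * norm e"
        by (intro mult_right_mono g'(4) R) simp
      also have "norm ((e \<bullet> B) *\<^sub>R Lk k) \<le> norm e * norm B * cL"
        using Cauchy_Schwarz_ineq2[of e B] cL(2)[of k] by (simp add: mult_mono)
      finally have T: "norm (T B) \<le> (cg + cL) * norm e * norm B" by (simp add: algebra_simps)
      \<comment> \<open>\<open>B\<close> is known only through its inner products, so it is tested
        with itself.\<close>
      have "B \<bullet> B \<le> norm l * norm (T B)" unfolding B by (rule norm_cauchy_schwarz)
      also have "\<dots> \<le> cm * ((cg + cL) * norm e * norm B)" using l(3) T cm(1) by (intro mult_mono) auto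
      finally have "B \<bullet> B \<le> (cm * (cg + cL) * norm e) * norm B" by (simp add: mult_ac)
      moreover have "0 \<le> cm * (cg + cL) * norm e" using cm(1) g'(1) cL(1) by simp
      ultimately show ?thesis using norm_le_of_inner_self by force
    qed
    \<comment> \<open>One factor \<open>norm e\<close> is kept and the other is bounded by
      \<open>2 * R\<close>, which makes the quadratic component linear in \<open>e\<close>.\<close>
    have v3: "norm ((1/2 * (norm (xb k - x k))\<^sup>2) *\<^sub>R l) \<le> R * cm * norm e"
    proof -
      have "norm e \<le> 2 * R" using norm_triangle_ineq4[of "xb k" "x k"] R(2,3)[of k] by (simp add: e_def)
      then have "1/2 * norm e * norm e * norm l \<le> R * norm e * cm"
        using l(3) R(1) by (intro mult_mono) auto
      then show ?thesis by (simp add: e_def power2_eq_square mult_ac)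
    qed
    have "norm ?v \<le> norm (gradf (xb k) + w + \<xi> k + A) + (norm B
        + (norm ((1/2 * (norm (xb k - x k))\<^sup>2) *\<^sub>R l) + norm (xb k - x k)))"
      by (intro order_trans[OF norm_Pair_le] add_left_mono order_refl)
    also have "\<dots> \<le> b * norm e" using v1 v2 v3 unfolding e_def[symmetric] b_def by (simp add: distrib_right)
    also have "\<dots> \<le> b * (c * step k)" using elim(1) b unfolding e_def by (intro mult_left_mono) auto
    finally have v: "norm ?v \<le> b * c * step k" by (simp add: mult.assoc)
    have "edist_set 0 (limiting_subdiff (Phi f \<phi> \<psi> g) (zk k)) \<le> ereal (dist 0 ?v)"
      unfolding edist_set_def using regular_subdiff_subset_limiting sub by (intro INF_lower) blast
    also have "\<dots> \<le> ereal (b * c * step k)" unfolding dist_0_norm ereal_less_eq by (rule v)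
    finally show ?case .
  qed
  then show ?thesis using b c(1) by (intro exI[of _ "b * c"]) auto
qed

text \<open>The KL inequality measures against the value at the cluster point, which must be the
  limit value. The potential can be infinite, so this does not follow from convergence of the
  arguments alone: the constraint, the positivity of \<open>L\<close> and the subgradient relation
  are passed to the limit, and the Fenchel equality then determines the conjugate there.\<close>

lemma cluster_zk_Phi:
  assumes "zs \<in> cluster_points zk"
  shows "Phi f \<phi> \<psi> g zs = ereal \<omega>"
proof -
  obtain r where r: "strict_mono r" "(zk \<circ> r) \<longlonglongrightarrow> zs"
    using assms unfolding cluster_points_def by blast
  obtain l1 l2 l3 l4 where zs: "zs = (l1, l2, l3, l4)" by (metis prod.exhaust)
  have lim1: "(\<lambda>n. xb (r n)) \<longlonglongrightarrow> l1" using tendsto_fst[OF r(2)] by (simp add: zs)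
  have lim2: "(\<lambda>n. x (r n)) \<longlonglongrightarrow> l2" using tendsto_fst[OF tendsto_snd[OF r(2)]] by (simp add: zs)
  have lim3: "(\<lambda>n. Lk (r n)) \<longlonglongrightarrow> l3"
    using tendsto_fst[OF tendsto_snd[OF tendsto_snd[OF r(2)]]] by (simp add: zs)
  have lim4: "(\<lambda>n. \<xi> (r n)) \<longlonglongrightarrow> l4"
    using tendsto_snd[OF tendsto_snd[OF tendsto_snd[OF r(2)]]] by (simp add: zs)
  \<comment> \<open>Strict inequalities can be lost in a limit; the uniform bound
    \<open>Lmin\<close> prevents it.\<close>
  have L: "\<forall>i. 0 < l3 $ i"
  proof
    fix i
    have "(\<lambda>n. Lk (r n) $ i) \<longlonglongrightarrow> l3 $ i" by (rule tendsto_vec_nth[OF lim3])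
    then have "Lmin \<le> l3 $ i"
      by (rule LIMSEQ_le_const) (use mu_L_positive in blast)
    then show "0 < l3 $ i" using L_bounds(1) by linarith
  qed
  obtain g' D c where g': "\<And>z. (g has_derivative blinfun_apply (g' z)) (at z)"
    "\<And>z. (g' has_derivative D z) (at z)" using g_derivatives by blast
  have G: "Gfun g l1 l2 l3 \<le> 0"
  proof -
    have "isCont (\<lambda>z. Gfun g (fst z) (fst (snd z)) (fst (snd (snd z)))) zs"
      by (rule has_derivative_continuous[OF Gfun_joint_has_derivative[OF g'(1) g'(2)]])
    from isCont_tendsto_compose[OF this r(2)]
    have lim: "(\<lambda>n. Gfun g (xb (r n)) (x (r n)) (Lk (r n))) \<longlonglongrightarrow> Gfun g l1 l2 l3"
      by (simp add: zs o_def)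
    have "Gfun g l1 l2 l3 $ i \<le> 0" for i
    proof (rule LIMSEQ_le_const2[OF tendsto_vec_nth[OF lim]])
      have "Gfun g (xb k) (x k) (Lk k) $ i \<le> 0" for k
        using xbar_in_model[of "jk k" k] by (simp add: Gamma_model_def less_eq_vec_def)
      then show "\<exists>N. \<forall>n\<ge>N. Gfun g (xb (r n)) (x (r n)) (Lk (r n)) $ i \<le> 0" by blast
    qed
    then show ?thesis by (simp add: less_eq_vec_def)
  qed
  obtain K where K: "compact K" "K \<subseteq> \<O>" "\<forall>\<^sub>F k in sequentially. xb k \<in> K"
    using f_bounds_near by blast
  have "\<forall>\<^sub>F n in sequentially. xb (r n) \<in> K"
    using K(3) r(1) by (rule eventually_subseq[rotated])
  then have "l1 \<in> K"
    using compact_imp_closed[OF K(1)] lim1 by (intro Lim_in_closed_set[of K]) auto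
  then have l1: "l1 \<in> \<O>" using K(2) by blast
  obtain f' :: "real^'n \<Rightarrow> (real^'n) \<Rightarrow>\<^sub>L real" where
    "\<And>z. z \<in> \<O> \<Longrightarrow> ((\<lambda>z. real_of_ereal (f z)) has_derivative blinfun_apply (f' z)) (at z)"
    using f_C11 unfolding C11_on_def by blast
  then have "isCont (\<lambda>z. real_of_ereal (f z)) l1" using l1 has_derivative_continuous by blast
  from isCont_tendsto_compose[OF this lim1]
  have limf: "(\<lambda>n. real_of_ereal (f (xb (r n)))) \<longlonglongrightarrow> real_of_ereal (f l1)" .
  have cont: "(\<lambda>n. h (s n)) \<longlonglongrightarrow> h l" if "convex_on UNIV h" "s \<longlonglongrightarrow> l" for h :: "real^'n \<Rightarrow> real" and s l
  proof -
    have "isCont h l" using convex_continuous_UNIV[OF that(1), of UNIV] by (simp add: continuous_on_eq_continuous_at)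
    then show ?thesis using that(2) by (rule isCont_tendsto_compose)
  qed
  have sub: "- l4 \<in> convex_subdiff \<psi> l2"
    unfolding convex_subdiff_def
  proof (intro CollectI allI)
    fix z
    have "(\<lambda>n. \<psi> (x (r n)) + (- \<xi> (r n)) \<bullet> (z - x (r n))) \<longlonglongrightarrow> \<psi> l2 + (- l4) \<bullet> (z - l2)"
      by (intro tendsto_intros cont[OF \<psi>_convex] lim2 lim4)
    then show "\<psi> l2 + (- l4) \<bullet> (z - l2) \<le> \<psi> z"
      by (rule LIMSEQ_le_const2) (use convex_subdiffD[OF neg_xi_subgradient] in blast)
  qed
  obtain s where s: "f l1 = ereal s" using bspec[OF f_finite l1] by auto
  have "(\<lambda>n. PhiR (r n)) \<longlonglongrightarrow> real_of_ereal (f l1) + \<phi> l1 + l1 \<bullet> l4 + ((- l4) \<bullet> l2 - \<psi> l2)"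
    unfolding PhiR_def by (intro tendsto_intros limf cont[OF \<phi>_convex] cont[OF \<psi>_convex] lim1 lim2 lim4)
  moreover have "(\<lambda>n. PhiR (r n)) \<longlonglongrightarrow> \<omega>"
    using LIMSEQ_subseq_LIMSEQ[OF PhiR_tendsto r(1)] by (simp add: o_def)
  ultimately have "\<omega> = s + \<phi> l1 + l1 \<bullet> l4 + ((- l4) \<bullet> l2 - \<psi> l2)"
    using LIMSEQ_unique s by fastforce
  moreover have "Phi f \<phi> \<psi> g zs = ereal (s + \<phi> l1 + l1 \<bullet> l4 + ((- l4) \<bullet> l2 - \<psi> l2))"
    unfolding zs by (intro Phi_eq_real L G s conjugate_at_subgradient sub)
  ultimately show ?thesis by simp
qed

text \<open>All cluster points have the same value \<open>\<omega>\<close>, so the local KL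
  inequalities, whose constants differ, concern the same quantity and can be made uniform.\<close>

lemma KL_uniform:
  "\<exists>c>0. \<forall>\<^sub>F k in sequentially. \<omega> < PhiR k \<longrightarrow> (PhiR k - \<omega>) powr q \<le> c * step k"
proof (rule bounded_cluster_uniform[OF parameters_bounded(2)])
  fix k and c c' :: real
  assume "\<omega> < PhiR k \<longrightarrow> (PhiR k - \<omega>) powr q \<le> c * step k" "c \<le> c'"
  then show "\<omega> < PhiR k \<longrightarrow> (PhiR k - \<omega>) powr q \<le> c' * step k"
    using mult_right_mono[of c c' "step k"] by auto
next
  fix zs assume zs: "zs \<in> cluster_points zk"
  obtain \<delta> \<eta> c where c: "0 < \<delta>" "0 < (\<eta>::ereal)" "0 < c" and
    KLz: "\<And>z. norm (z - zs) \<le> \<delta> \<Longrightarrow> Phi f \<phi> \<psi> g zs < Phi f \<phi> \<psi> g z \<Longrightarrow>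
      Phi f \<phi> \<psi> g z < Phi f \<phi> \<psi> g zs + \<eta> \<Longrightarrow>
      1 \<le> ereal (deriv (\<lambda>t. c * t powr (1 - q)) (real_of_ereal (Phi f \<phi> \<psi> g z - Phi f \<phi> \<psi> g zs)))
          * edist_set 0 (limiting_subdiff (Phi f \<phi> \<psi> g) z)"
    using KL[OF zs] unfolding KL_exponent_def by blast
  obtain C where C: "0 < C" "\<forall>\<^sub>F k in sequentially.
      edist_set 0 (limiting_subdiff (Phi f \<phi> \<psi> g) (zk k)) \<le> ereal (C * step k)"
    using Phi_subgradient_bound by blast
  obtain K where K: "K \<subseteq> \<O>" "\<forall>\<^sub>F k in sequentially. xb k \<in> K"
    using f_bounds_near by blast
  have "\<forall>\<^sub>F k in sequentially. ereal (PhiR k) < ereal \<omega> + \<eta>"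
  proof (cases \<eta>)
    case (real e)
    then have "\<omega> < \<omega> + e" using c(2) by simp
    then have "\<forall>\<^sub>F k in sequentially. PhiR k < \<omega> + e" by (rule order_tendstoD(2)[OF PhiR_tendsto])
    then show ?thesis using real by simp
  qed (use c(2) in auto)
  then have "\<forall>\<^sub>F k in sequentially. norm (zk k - zs) \<le> \<delta> \<longrightarrow> \<omega> < PhiR k \<longrightarrow>
      (PhiR k - \<omega>) powr q \<le> (c * (1 - q) * C) * step k"
    using C(2) K(2)
  proof eventually_elim
    case (elim k)
    show ?case
    proof (intro impI)
      assume near: "norm (zk k - zs) \<le> \<delta>" and gt: "\<omega> < PhiR k"
      define t where "t = PhiR k - \<omega>"
      have t: "0 < t" using gt by (simp add: t_def)
      have Phi: "Phi f \<phi> \<psi> g (zk k) = ereal (PhiR k)" by (rule Phi_zk) (use elim(3) K(1) in blast)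
      have Phis: "Phi f \<phi> \<psi> g zs = ereal \<omega>" by (rule cluster_zk_Phi[OF zs])
      have "((\<lambda>t. c * t powr (1 - q)) has_real_derivative c * ((1 - q) * t powr (1 - q - 1))) (at t)"
        by (intro DERIV_cmult has_real_derivative_powr t)
      then have deriv: "deriv (\<lambda>t. c * t powr (1 - q)) t = c * (1 - q) * t powr (- q)"
        by (simp add: DERIV_imp_deriv mult.assoc)
      have nonneg: "0 \<le> c * (1 - q) * t powr (- q)" using c(3) q_range by simp
      have "1 \<le> ereal (c * (1 - q) * t powr (- q)) * edist_set 0 (limiting_subdiff (Phi f \<phi> \<psi> g) (zk k))"
        using KLz[OF near] gt elim(1) unfolding Phi Phis by (simp add: deriv flip: t_def)
      also have "\<dots> \<le> ereal (c * (1 - q) * t powr (- q)) * ereal (C * step k)"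
        using nonneg by (intro ereal_mult_left_mono elim(2)) simp
      finally have "1 \<le> c * (1 - q) * t powr (- q) * (C * step k)" by (simp add: one_ereal_def)
      \<comment> \<open>Multiplication by \<open>t powr q\<close> undoes the negative power in the
        derivative of the desingularizing function.\<close>
      then have "1 * t powr q \<le> c * (1 - q) * t powr (- q) * (C * step k) * t powr q"
        by (intro mult_right_mono) auto
      also have "\<dots> = c * (1 - q) * C * step k * (t powr (- q) * t powr q)" by (simp only: mult_ac)
      also have "t powr (- q) * t powr q = 1" using t by (simp only: powr_add[symmetric]) simp
      finally show "(PhiR k - \<omega>) powr q \<le> (c * (1 - q) * C) * step k" by (simp add: t_def)
    qed
  qed
  then obtain N where N: "\<And>k. N \<le> k \<Longrightarrow> norm (zk k - zs) \<le> \<delta> \<Longrightarrow> \<omega> < PhiR k \<Longrightarrow>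
      (PhiR k - \<omega>) powr q \<le> (c * (1 - q) * C) * step k"
    unfolding eventually_sequentially by blast
  have "zs \<in> ball zs \<delta>" using c(1) by simp
  moreover have "\<omega> < PhiR k \<longrightarrow> (PhiR k - \<omega>) powr q \<le> (c * (1 - q) * C) * step k"
    if "N \<le> k" "zk k \<in> ball zs \<delta>" for k
  proof -
    have "norm (zk k - zs) \<le> \<delta>" using that(2) by (simp add: dist_norm norm_minus_commute[of zs])
    then show ?thesis using N[OF that(1)] by blast
  qed
  ultimately show "\<exists>c U N. open U \<and> zs \<in> U \<and>
      (\<forall>k\<ge>N. zk k \<in> U \<longrightarrow> \<omega> < PhiR k \<longrightarrow> (PhiR k - \<omega>) powr q \<le> c * step k)"
    by (intro exI[of _ "c * (1 - q) * C"] exI[of _ "ball zs \<delta>"] exI[of _ N]) simp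
qed

text \<open>Transfers the KL bound from the potential to the objective after the step; the price is
  a squared step inside the power.\<close>

lemma KL_recursion_MBA:
  "\<exists>C. KL_recursion (\<lambda>k. Fr (x k) - \<omega>) step (\<alpha> / 2) C q"
proof -
  obtain c where c: "0 < c" "\<forall>\<^sub>F k in sequentially. \<omega> < PhiR k \<longrightarrow> (PhiR k - \<omega>) powr q \<le> c * step k"
    using KL_uniform by blast
  obtain C where C: "0 < C" "\<forall>\<^sub>F k in sequentially. Fr (x (Suc k)) \<le> PhiR k + C * (step k)\<^sup>2
    \<and> PhiR k \<le> Fr (x k) + C * (step k)\<^sup>2" using Phi_bounds by blast
  have "\<forall>\<^sub>F k in sequentially. step k < 1" by (rule order_tendstoD(2)[OF step_tendsto_0]) simp
  with c(2) C(2) have step: "\<forall>\<^sub>F k in sequentially. (Fr (x (Suc k)) - \<omega>) powr q \<le> (2 powr q * (c + C powr q)) * step k"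
  proof eventually_elim
    case (elim k)
    \<comment> \<open>The KL bound says nothing when \<open>PhiR k \<le> \<omega>\<close>;
      truncation makes its left side zero in that case.\<close>
    define t where "t = max 0 (PhiR k - \<omega>)"
    have t: "t powr q \<le> c * step k" using elim(1) c(1) by (auto simp: t_def max_def)
    have "(C * (step k)\<^sup>2) powr q = C powr q * (step k powr 2) powr q"
      by (simp add: powr_mult)
    also have "(step k powr 2) powr q = step k powr (2 * q)" by (rule powr_powr)
    \<comment> \<open>Here \<open>2 * q \<ge> 1\<close> is essential: for steps below one the larger
      exponent gives the smaller power.\<close>
    also have "step k powr (2 * q) \<le> step k powr 1"
      using elim(3) q_range by (intro powr_mono') auto
    finally have s: "(C * (step k)\<^sup>2) powr q \<le> C powr q * step k"
      by (simp add: mult_left_mono)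
    have "(Fr (x (Suc k)) - \<omega>) powr q \<le> (t + C * (step k)\<^sup>2) powr q"
      using elim(2) Fr_ge[of "Suc k"] q_range by (intro powr_mono2) (auto simp: t_def)
    also have "\<dots> \<le> 2 powr q * (t powr q + (C * (step k)\<^sup>2) powr q)"
      using C(1) q_range by (intro powr_add_le) (auto simp: t_def)
    also have "\<dots> \<le> 2 powr q * (c * step k + C powr q * step k)"
      using t s by (intro mult_left_mono add_mono) auto
    finally show ?case by (simp add: distrib_right mult.assoc)
  qed
  have "KL_recursion (\<lambda>k. Fr (x k) - \<omega>) step (\<alpha> / 2) (2 powr q * (c + C powr q)) q"
  proof
    show "0 \<le> Fr (x k) - \<omega>" for k using Fr_ge[of k] by simp
    show "0 < \<alpha> / 2" using params_pos by simp
    show "0 < 2 powr q * (c + C powr q)" using c(1) by (simp add: add_pos_nonneg)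
    show "\<alpha> / 2 * (step k)\<^sup>2 \<le> Fr (x k) - \<omega> - (Fr (x (Suc k)) - \<omega>)" for k
      using Fr_descent[of k] by simp
    show "(\<lambda>k. Fr (x k) - \<omega>) \<longlonglongrightarrow> 0" using tendsto_diff[OF Fr_tendsto tendsto_const, of \<omega>] by simp
  qed (use q_range step in auto)
  then show ?thesis by blast
qed

end

theorem theorem8:
  fixes f :: "real^'n \<Rightarrow> ereal"
    and \<phi> \<psi> :: "real^'n \<Rightarrow> real"
    and g :: "real^'n \<Rightarrow> real^'m"
    and \<O> :: "(real^'n) set"
    and \<mu>min \<mu>max Lmin Lmax M \<beta>R \<beta>F \<alpha> \<tau> q :: real
    and x \<xi> :: "nat \<Rightarrow> real^'n"
    and \<mu> :: "nat \<Rightarrow> nat \<Rightarrow> real"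
    and L lam :: "nat \<Rightarrow> nat \<Rightarrow> real^'m"
    and Q :: "nat \<Rightarrow> nat \<Rightarrow> ((real^'n) \<Rightarrow>\<^sub>L (real^'n))"
    and xbar y v :: "nat \<Rightarrow> nat \<Rightarrow> real^'n"
    and jk :: "nat \<Rightarrow> nat"
  assumes run: "inexact_MBA f \<phi> \<psi> g \<O> \<mu>min \<mu>max Lmin Lmax M \<beta>R \<beta>F \<alpha> \<tau> x \<xi> \<mu> L Q xbar y v lam jk"
    and subregular: "\<And>k j. j \<le> jk k \<Longrightarrow>
      metrically_subregular (\<lambda>z. {Gfun g z (x k) (L k j) - w | w. w \<le> 0}) (xbar k j) 0"
    and x_bounded: "bounded (range x)"
    and BMP: "\<And>us xs.
      (us, xs) \<in> cluster_points (\<lambda>k. ((L k (jk k), Q k (jk k), \<xi> k, x k), xbar k (jk k))) \<Longrightarrow>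
      partial_BMP g us xs"
    and g_twice: "twice_differentiable g"
    and conj_cont: "continuous_on {p. conjugate_fun \<psi> p < \<infinity>} (conjugate_fun \<psi>)"
    and q_range: "1/2 \<le> q" "q < 1"
    and KL: "\<And>zs. zs \<in> cluster_points (\<lambda>k. (xbar k (jk k), x k, L k (jk k), \<xi> k)) \<Longrightarrow>
      KL_exponent (Phi f \<phi> \<psi> g) q zs"
  shows "\<exists>\<omega> xlim.
    (\<lambda>k. objective f \<phi> \<psi> g (x k)) \<longlonglongrightarrow> ereal \<omega> \<and> x \<longlonglongrightarrow> xlim \<and>
    (q = 1/2 \<longrightarrow>
      (\<exists>a1 \<rho> \<rho>h. 0 < a1 \<and> \<rho> \<in> {0<..<1} \<and> \<rho>h \<in> {0<..<1} \<and>
        (\<forall>\<^sub>F k in sequentially.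
          objective f \<phi> \<psi> g (x (Suc k)) - ereal \<omega> \<le> ereal \<rho> * (objective f \<phi> \<psi> g (x k) - ereal \<omega>) \<and>
          norm (x k - xlim) \<le> a1 * \<rho>h ^ k))) \<and>
    (1/2 < q \<longrightarrow>
      (\<exists>a2 a3. 0 < a2 \<and> 0 < a3 \<and>
        (\<forall>\<^sub>F k in sequentially.
          objective f \<phi> \<psi> g (x k) - ereal \<omega> \<le> ereal (a2 * real k powr (1 / (1 - 2 * q))) \<and>
          norm (x k - xlim) \<le> a3 * real k powr ((1 - q) / (1 - 2 * q)))))"
proof -
  interpret inexact_MBA f \<phi> \<psi> g \<O> \<mu>min \<mu>max Lmin Lmax M \<beta>R \<beta>F \<alpha> \<tau> x \<xi> \<mu> L Q xbar y v lam jk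
    by (rule run)
  interpret KL_MBA \<O> \<mu>min \<mu>max Lmin Lmax M \<beta>R \<beta>F \<alpha> \<tau> x \<xi> \<mu> L Q xbar y v lam jk f \<phi> \<psi> g q
    by unfold_locales (fact x_bounded BMP g_twice q_range KL)+
  obtain C where "KL_recursion (\<lambda>k. Fr (x k) - \<omega>) step (\<alpha> / 2) C q"
    using KL_recursion_MBA by blast
  \<comment> \<open>Feasibility of all iterates turns the extended-real claims into real ones about
    \<open>Fr\<close>.\<close>
  from KL_recursion_rates[OF this]
  show ?thesis
    unfolding objective_feasible[OF x_feasible] ereal_minus(1) times_ereal.simps(1) ereal_less_eq(3) lim_ereal
    using Fr_tendsto by blast
qed

end
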